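(* Consider the generalized ARCH model $$X_t=\sigma_t\epsilon_t,\qquad \sigma_t^2=\alpha_0+\alpha_1X_{t-1}^2+l_1L_{t-1},\qquad t\in\mathbb{Z},$$ with $\alpha_0\ge 0$, $\alpha_1,l_1>0$, where $(\sigma_t^2)_{t\in\mathbb{Z}}$ is the strictly stationary solution $$\sigma_{t+1}^2=\sum_{i=0}^\infty\left(\prod_{j=0}^{i-1}\alpha_1\epsilon_{t-j}^2\right)(\alpha_0+l_1L_{t-i}).$$ Suppose $\mathbb{E}(L_0^4)<\infty$, $\mathbb{E}(\epsilon_0^8)<\infty$ and $\alpha_1<\frac{1}{\mathbb{E}(\epsilon_0^8)^{1/4}}$. Assume further that for every fixed $m,m_1,m_2\in\mathbb{Z}$, as $t\to\infty$, $$\mathrm{Cov}(L_0,L_t)\to0,\qquad \mathrm{Cov}(L_0L_m,L_{\pm t})\to 0,\qquad \mathrm{Cov}(L_0L_{m_1},L_tL_{t+m_2})\to0 .$$ Fix integers $n_1,n_2\neq0$ with $n_1\neq n_2$, and let $\boldsymbol{\gamma}=[\gamma(n_1+1),\gamma(n_2+1),\gamma(n_1),\gamma(n_2),\gamma(n_1-1),\gamma(n_2-1)]$. Assume that $s(n_2)\neq0$, $a(\boldsymbol{\gamma})\neq0$ and $g(\boldsymbol{\gamma})>0$. Then the estimators $$\hat\alpha_1=\frac{-b(\hat{\boldsymbol{\gamma}}_N)\pm\sqrt{g(\hat{\boldsymbol{\gamma}}_N)}}{2a(\hat{\boldsymbol{\gamma}}_N)},$$ $$\hat l_1=\sqrt{\frac{\hat\alpha_1^2\hat\gamma_N(n_2)-\hat\alpha_1\bigl(\hat\gamma_N(n_2+1)+\hat\gamma_N(n_2-1)\bigr)+\hat\gamma_N(n_2)}{s(n_2)}},$$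 $$\hat\alpha_0=\hat\mu_N(1-\hat\alpha_1)-\hat l_1,$$ where the sign $\pm$ is the correct one, i.e. the one for which $\alpha_1=\frac{-b(\boldsymbol{\gamma})\pm\sqrt{g(\boldsymbol{\gamma})}}{2a(\boldsymbol{\gamma})}$, are consistent: $\hat\alpha_1\to\alpha_1$, $\hat l_1\to l_1$ and $\hat\alpha_0\to\alpha_0$ in probability as $N\to\infty$.
   Context: Standing assumptions on the model: $(\epsilon_t)_{t\in\mathbb{Z}}$ is an i.i.d. process with $\mathbb{E}(\epsilon_0)=0$ and $\mathbb{E}(\epsilon_0^2)=1$; $(L_t)_{t\in\mathbb{Z}}$ (the liquidity) is a strictly stationary positive process with $\mathbb{E}(L_0)=1$, independent of $(\epsilon_t)_{t\in\mathbb{Z}}$. The empty product is $1$. Notation: $\gamma(k)=\mathrm{Cov}(X_t^2,X_{t+k}^2)$ and $s(k)=\mathrm{Cov}(L_t,L_{t+k})=\mathbb{E}(L_tL_{t+k})-1$; the function $s$ is treated as known. For a vector $\mathbf{v}=[v_1,\dots,v_6]$ in the place of $[\gamma(n_1+1),\gamma(n_2+1),\gamma(n_1),\gamma(n_2),\gamma(n_1-1),\gamma(n_2-1)]$, set $$a(\mathbf v)=v_3-\tfrac{s(n_1)}{s(n_2)}v_4,\qquad b(\mathbf v)=\tfrac{s(n_1)}{s(n_2)}(v_2+v_6)-(v_1+v_5),\qquad g(\mathbf v)=b(\mathbf v)^2-4a(\mathbf v)^2.$$ Given observations $X_1^2,\dots,X_N^2$, set $\hat\mu_N=\frac1N\sum_{t=1}^NX_t^2$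 and for $k\ge0$ $$\hat\gamma_N(k)=\frac1N\sum_{t=1}^{N-k}(X_t^2-\hat\mu_N)(X_{t+k}^2-\hat\mu_N),$$ with $\hat\gamma_N(-k)=\hat\gamma_N(k)$. Then $\hat{\boldsymbol{\gamma}}_N=[\hat\gamma_N(n_1+1),\hat\gamma_N(n_2+1),\hat\gamma_N(n_1),\hat\gamma_N(n_2),\hat\gamma_N(n_1-1),\hat\gamma_N(n_2-1)]$. For finite $N$ the estimators may be complex-valued (a square root of a negative number is taken in $\mathbb{C}$); on the event where a denominator vanishes they may be assigned any fixed value. *)

theory Defs
  imports "HOL-Probability.Probability"
begin

definition iid_process :: "'w measure \<Rightarrow> ('i \<Rightarrow> 'w \<Rightarrow> real) \<Rightarrow> bool" where
  "iid_process M Y \<longleftrightarrow>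
     prob_space.indep_vars M (\<lambda>_. borel) Y UNIV \<and>
     (\<forall>s t. distr M borel (Y s) = distr M borel (Y t))"

definition strictly_stationary :: "'w measure \<Rightarrow> (int \<Rightarrow> 'w \<Rightarrow> real) \<Rightarrow> bool" where
  "strictly_stationary M Y \<longleftrightarrow>
     (\<forall>t. Y t \<in> borel_measurable M) \<and>
     (\<forall>h J. finite J \<longrightarrow>
        distr M (Pi\<^sub>M J (\<lambda>_. borel)) (\<lambda>\<omega>. \<lambda>j\<in>J. Y (j + h) \<omega>) =
        distr M (Pi\<^sub>M J (\<lambda>_. borel)) (\<lambda>\<omega>. \<lambda>j\<in>J. Y j \<omega>))"

text \<open>Independence of the two processes as wholes, i.e. as random elements of the
  product space of real sequences indexed by the integers.\<close>

definition indep_processes ::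
  "'w measure \<Rightarrow> (int \<Rightarrow> 'w \<Rightarrow> real) \<Rightarrow> (int \<Rightarrow> 'w \<Rightarrow> real) \<Rightarrow> bool" where
  "indep_processes M Y Z \<longleftrightarrow>
     prob_space.indep_var M
       (Pi\<^sub>M UNIV (\<lambda>_. borel)) (\<lambda>\<omega> t. Y t \<omega>)
       (Pi\<^sub>M UNIV (\<lambda>_. borel)) (\<lambda>\<omega> t. Z t \<omega>)"

definition cov :: "'w measure \<Rightarrow> ('w \<Rightarrow> real) \<Rightarrow> ('w \<Rightarrow> real) \<Rightarrow> real" where
  "cov M U V = (\<integral>\<omega>. (U \<omega> - (\<integral>\<omega>'. U \<omega>' \<partial>M)) * (V \<omega> - (\<integral>\<omega>'. V \<omega>' \<partial>M)) \<partial>M)"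

text \<open>Only used for stationary processes, for which the covariance of the values at times
  \<open>t\<close> and \<open>t + k\<close> does not depend on \<open>t\<close>; we take \<open>t = 0\<close>.\<close>

definition autocov :: "'w measure \<Rightarrow> (int \<Rightarrow> 'w \<Rightarrow> real) \<Rightarrow> int \<Rightarrow> real" where
  "autocov M Y k = cov M (Y 0) (Y k)"

text \<open>The measurability requirement excludes the convention that \<open>measure\<close> is zero on
  non-measurable sets.\<close>

definition conv_in_prob ::
  "'w measure \<Rightarrow> (nat \<Rightarrow> 'w \<Rightarrow> 'b::{metric_space,second_countable_topology}) \<Rightarrow> 'b \<Rightarrow> bool" where
  "conv_in_prob M Y c \<longleftrightarrow>
     (\<forall>N. Y N \<in> borel_measurable M) \<and>
     (\<forall>e>0. (\<lambda>N. measure M {\<omega> \<in> space M. dist (Y N \<omega>) c > e}) \<longlonglongrightarrow> 0)"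

definition sample_mean :: "(int \<Rightarrow> 'w \<Rightarrow> real) \<Rightarrow> nat \<Rightarrow> 'w \<Rightarrow> real" where
  "sample_mean Y N \<omega> = (1 / real N) * (\<Sum>t\<in>{1..int N}. Y t \<omega>)"

definition sample_autocov :: "(int \<Rightarrow> 'w \<Rightarrow> real) \<Rightarrow> nat \<Rightarrow> 'w \<Rightarrow> int \<Rightarrow> real" where
  "sample_autocov Y N \<omega> k =
     (1 / real N) * (\<Sum>t\<in>{1..int N - \<bar>k\<bar>}.
        (Y t \<omega> - sample_mean Y N \<omega>) * (Y (t + \<bar>k\<bar>) \<omega> - sample_mean Y N \<omega>))"

type_synonym vec6 = "real \<times> real \<times> real \<times> real \<times> real \<times> real"

definition gamma_vec :: "(int \<Rightarrow> real) \<Rightarrow> int \<Rightarrow> int \<Rightarrow> vec6" where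
  "gamma_vec c n1 n2 = (c (n1 + 1), c (n2 + 1), c n1, c n2, c (n1 - 1), c (n2 - 1))"

definition a_coef :: "(int \<Rightarrow> real) \<Rightarrow> int \<Rightarrow> int \<Rightarrow> vec6 \<Rightarrow> real" where
  "a_coef s n1 n2 = (\<lambda>(v1, v2, v3, v4, v5, v6). v3 - s n1 / s n2 * v4)"

definition b_coef :: "(int \<Rightarrow> real) \<Rightarrow> int \<Rightarrow> int \<Rightarrow> vec6 \<Rightarrow> real" where
  "b_coef s n1 n2 = (\<lambda>(v1, v2, v3, v4, v5, v6). s n1 / s n2 * (v2 + v6) - (v1 + v5))"

definition g_coef :: "(int \<Rightarrow> real) \<Rightarrow> int \<Rightarrow> int \<Rightarrow> vec6 \<Rightarrow> real" where
  "g_coef s n1 n2 v = (b_coef s n1 n2 v)\<^sup>2 - 4 * (a_coef s n1 n2 v)\<^sup>2"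

text \<open>The estimators are complex valued, with \<open>csqrt\<close> the principal square root. The real
  number \<open>sg\<close>, always \<open>1\<close> or \<open>-1\<close>, is the sign chosen in the quadratic formula, and \<open>d\<close> is
  the arbitrary fixed value taken on the event that the denominator \<open>2 a\<close> vanishes.\<close>

definition alpha1_hat ::
  "(int \<Rightarrow> real) \<Rightarrow> int \<Rightarrow> int \<Rightarrow> real \<Rightarrow> complex \<Rightarrow>
   (int \<Rightarrow> 'w \<Rightarrow> real) \<Rightarrow> nat \<Rightarrow> 'w \<Rightarrow> complex" where
  "alpha1_hat s n1 n2 sg d Y N \<omega> =
     (let v = gamma_vec (sample_autocov Y N \<omega>) n1 n2 in
      if a_coef s n1 n2 v = 0 then d
      else (- complex_of_real (b_coef s n1 n2 v)
              + complex_of_real sg * csqrt (complex_of_real (g_coef s n1 n2 v)))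
           / (2 * complex_of_real (a_coef s n1 n2 v)))"

text \<open>In the next two definitions \<open>A\<close> and \<open>B\<close> are the estimators of \<open>\<alpha>\<^sub>1\<close> and \<open>l\<^sub>1\<close> that are
  plugged in.\<close>

definition l1_hat ::
  "(int \<Rightarrow> real) \<Rightarrow> int \<Rightarrow> int \<Rightarrow> complex \<Rightarrow> (nat \<Rightarrow> 'w \<Rightarrow> complex) \<Rightarrow>
   (int \<Rightarrow> 'w \<Rightarrow> real) \<Rightarrow> nat \<Rightarrow> 'w \<Rightarrow> complex" where
  "l1_hat s n1 n2 d A Y N \<omega> =
     (let c = sample_autocov Y N \<omega> in
      if a_coef s n1 n2 (gamma_vec c n1 n2) = 0 then d
      else csqrt (((A N \<omega>)\<^sup>2 * complex_of_real (c n2)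
                   - A N \<omega> * complex_of_real (c (n2 + 1) + c (n2 - 1))
                   + complex_of_real (c n2))
                  / complex_of_real (s n2)))"

definition alpha0_hat ::
  "(int \<Rightarrow> real) \<Rightarrow> int \<Rightarrow> int \<Rightarrow> complex \<Rightarrow> (nat \<Rightarrow> 'w \<Rightarrow> complex) \<Rightarrow> (nat \<Rightarrow> 'w \<Rightarrow> complex) \<Rightarrow>
   (int \<Rightarrow> 'w \<Rightarrow> real) \<Rightarrow> nat \<Rightarrow> 'w \<Rightarrow> complex" where
  "alpha0_hat s n1 n2 d A B Y N \<omega> =
     (if a_coef s n1 n2 (gamma_vec (sample_autocov Y N \<omega>) n1 n2) = 0 then d
      else complex_of_real (sample_mean Y N \<omega>) * (1 - A N \<omega>) - B N \<omega>)"

text \<open>The sign \<open>sg\<close> for which the quadratic formula at the true autocovariances gives the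
  true parameter.\<close>

definition correct_sign ::
  "(int \<Rightarrow> real) \<Rightarrow> int \<Rightarrow> int \<Rightarrow> vec6 \<Rightarrow> real \<Rightarrow> real \<Rightarrow> bool" where
  "correct_sign s n1 n2 v \<alpha>1 sg \<longleftrightarrow>
     sg \<in> {1, -1} \<and>
     \<alpha>1 = (- b_coef s n1 n2 v + sg * sqrt (g_coef s n1 n2 v)) / (2 * a_coef s n1 n2 v)"

end

(*
  Iterating the recursion writes the squared process as the series of alpha1^i times the product of
  the squared innovations at times t, ..., t - i, times an affine function of the liquidity at time
  t - 1 - i. The eighth moment condition gives alpha1^2 E(eps^4) < 1, so the partial sums converge
  geometrically in L2, uniformly in t. For a finite partial sum, products of innovations over
  disjoint windows are independent of each other and of the liquidity, so the covariances of products
  X_t^2 X_{t+k}^2 reduce to covariances of products of two liquidities and tend to zero; a Chebyshev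
  argument then gives the weak law of large numbers in L1, which survives the L2 limit. Hence sample
  means and sample autocovariances are consistent. Since eps_t^2 has mean one and is independent of the
  past and of the liquidity, taking covariances in the recursion twice gives
  alpha1^2 gamma(k) - alpha1 (gamma(k+1) + gamma(k-1)) + gamma(k) = l1^2 s(k) for k <> 0.
  Eliminating l1 between k = n1 and k = n2 shows that alpha1 solves the quadratic with coefficients
  a, b, a, and the estimators are functions of the sample moments that are continuous at the true values.
*)
theory Submission
  imports Defs
begin

section \<open>Laws of large numbers in L1\<close>

text \<open>The series converges in L2, so products of two squared observations are approximated in
  L1 only, and Chebyshev's inequality is applied to products of truncations. A truncation is a sum
  of terms that contain each squared innovation at most to the first power and are affine in one
  liquidity value. A product of two truncations therefore has squared innovations to at most the
  second power and two liquidity factors, and its second moment calls for E(\<epsilon>^8) and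
  E(L^4). The passage to the limit is a triangle inequality, because the approximation is uniform in
  time.

  Independence of the past is tracked without filtrations: approximants carry a set of relative
  times whose innovations do not occur in them, and removing the factor \<epsilon>_t^2 from an
  expectation becomes a computation with exponents. In place of stationarity in law of the squared
  process stands the constancy in time of the means of products, which is part of the law of large
  numbers as it is formulated here.\<close>

lemma cesaro_null:
  fixes b :: "nat \<Rightarrow> real"
  assumes "b \<longlonglongrightarrow> 0"
  shows "(\<lambda>N. (\<Sum>n<N. b n) / real N) \<longlonglongrightarrow> 0"
proof (rule LIMSEQ_I)
  fix r :: real assume "r > 0"
  then obtain n0 where n0: "\<And>n. n \<ge> n0 \<Longrightarrow> \<bar>b n\<bar> < r / 2"
    using LIMSEQ_D[OF assms, of "r / 2"] by auto
  define C where "C = (\<Sum>n<n0. \<bar>b n\<bar>)"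
  \<comment> \<open>The initial block sums to the constant \<open>C\<close>; beyond
    \<open>n1\<close> it is smaller than \<open>r / 2 * N\<close>, the other half of the
    allowance.\<close>
  obtain n1 where n1: "2 * C / r < real n1" using reals_Archimedean2 by blast
  show "\<exists>no. \<forall>N\<ge>no. norm ((\<Sum>n<N. b n) / real N - 0) < r"
  proof (intro exI allI impI)
    fix N assume N: "N \<ge> max (max n0 n1) 1"
    have "{..<N} = {..<n0} \<union> {n0..<N}" using N by auto
    then have "(\<Sum>n<N. \<bar>b n\<bar>) = C + (\<Sum>n\<in>{n0..<N}. \<bar>b n\<bar>)"
      unfolding C_def by (simp add: sum.union_disjoint ivl_disj_int)
    also have "(\<Sum>n\<in>{n0..<N}. \<bar>b n\<bar>) \<le> (\<Sum>n\<in>{n0..<N}. r / 2)"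
      using n0 by (intro sum_mono) (auto intro: less_imp_le)
    also have "\<dots> \<le> N * (r / 2)"
      using \<open>r > 0\<close> by (simp add: mult_right_mono)
    finally have "\<bar>\<Sum>n<N. b n\<bar> \<le> C + N * (r / 2)"
      using sum_abs[of b "{..<N}"] by linarith
    moreover have "C < r / 2 * N"
    proof -
      have "2 * C / r < real N" using n1 N by linarith
      then show ?thesis using \<open>r > 0\<close> by (simp add: field_simps)
    qed
    ultimately have "\<bar>\<Sum>n<N. b n\<bar> < r * N" by (simp add: field_simps)
    then show "norm ((\<Sum>n<N. b n) / real N - 0) < r"
      using N by (simp add: field_simps)
  qed
qed

section \<open>Cauchy-Schwarz estimates for square integrable functions\<close>

lemma integrable_mult_square_integrable:
  fixes f g :: "'w \<Rightarrow> real"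
  assumes [measurable]: "f \<in> borel_measurable M" "g \<in> borel_measurable M"
    and "integrable M (\<lambda>x. (f x)\<^sup>2)" "integrable M (\<lambda>x. (g x)\<^sup>2)"
  shows "integrable M (\<lambda>x. f x * g x)"
proof (rule Bochner_Integration.integrable_bound)
  show "integrable M (\<lambda>x. (f x)\<^sup>2 + (g x)\<^sup>2)" using assms by simp
  have "\<bar>u * v\<bar> \<le> u\<^sup>2 + v\<^sup>2" for u v :: real
  proof -
    have "2 * (\<bar>u\<bar> * \<bar>v\<bar>) \<le> u\<^sup>2 + v\<^sup>2"
      using sum_squares_bound[of "\<bar>u\<bar>" "\<bar>v\<bar>"] by simp
    moreover have "0 \<le> \<bar>u\<bar> * \<bar>v\<bar>" by simp
    ultimately show ?thesis unfolding abs_mult by linarith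
  qed
  then show "AE x in M. norm (f x * g x) \<le> norm ((f x)\<^sup>2 + (g x)\<^sup>2)" by simp
qed simp

lemma integrable_square_add:
  fixes f g :: "'w \<Rightarrow> real"
  assumes [measurable]: "f \<in> borel_measurable M" "g \<in> borel_measurable M"
    and "integrable M (\<lambda>x. (f x)\<^sup>2)" "integrable M (\<lambda>x. (g x)\<^sup>2)"
  shows "integrable M (\<lambda>x. (f x + g x)\<^sup>2)"
  using integrable_mult_square_integrable[OF assms] assms by (simp add: power2_sum mult.assoc)

lemma integral_abs_mult_le:
  fixes f g :: "'w \<Rightarrow> real"
  assumes [measurable]: "f \<in> borel_measurable M" "g \<in> borel_measurable M"
    and f2: "integrable M (\<lambda>x. (f x)\<^sup>2)" and g2: "integrable M (\<lambda>x. (g x)\<^sup>2)"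
  shows "(\<integral>x. \<bar>f x * g x\<bar> \<partial>M) \<le> sqrt (\<integral>x. (f x)\<^sup>2 \<partial>M) * sqrt (\<integral>x. (g x)\<^sup>2 \<partial>M)"
proof -
  have fg: "integrable M (\<lambda>x. \<bar>f x * g x\<bar>)"
    using integrable_mult_square_integrable[OF assms] by simp
  have "(\<integral>\<^sup>+x. ennreal \<bar>f x\<bar> * ennreal \<bar>g x\<bar> \<partial>M)\<^sup>2 \<le>
      (\<integral>\<^sup>+x. (ennreal \<bar>f x\<bar>)\<^sup>2 \<partial>M) * (\<integral>\<^sup>+x. (ennreal \<bar>g x\<bar>)\<^sup>2 \<partial>M)"
    by (rule Cauchy_Schwarz_nn_integral) auto
  also have "(\<integral>\<^sup>+x. (ennreal \<bar>f x\<bar>)\<^sup>2 \<partial>M) = ennreal (\<integral>x. (f x)\<^sup>2 \<partial>M)"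
    using f2 by (simp add: ennreal_power nn_integral_eq_integral)
  also have "(\<integral>\<^sup>+x. (ennreal \<bar>g x\<bar>)\<^sup>2 \<partial>M) = ennreal (\<integral>x. (g x)\<^sup>2 \<partial>M)"
    using g2 by (simp add: ennreal_power nn_integral_eq_integral)
  also have "(\<integral>\<^sup>+x. ennreal \<bar>f x\<bar> * ennreal \<bar>g x\<bar> \<partial>M) = ennreal (\<integral>x. \<bar>f x * g x\<bar> \<partial>M)"
    using fg by (simp add: nn_integral_eq_integral flip: ennreal_mult'' abs_mult)
  finally have "(\<integral>x. \<bar>f x * g x\<bar> \<partial>M)\<^sup>2 \<le> (\<integral>x. (f x)\<^sup>2 \<partial>M) * (\<integral>x. (g x)\<^sup>2 \<partial>M)"
    by (simp add: ennreal_power flip: ennreal_mult'')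
  then have "(\<integral>x. \<bar>f x * g x\<bar> \<partial>M) \<le> sqrt ((\<integral>x. (f x)\<^sup>2 \<partial>M) * (\<integral>x. (g x)\<^sup>2 \<partial>M))"
    by (rule real_le_rsqrt)
  then show ?thesis by (simp add: real_sqrt_mult)
qed

text \<open>Equal means at all times are built in, since they later serve as the available form of
  stationarity. The averages start at an arbitrary offset \<open>h\<close>; the samples start at
  time 1.\<close>

definition L1_lln :: "'w measure \<Rightarrow> (int \<Rightarrow> 'w \<Rightarrow> real) \<Rightarrow> real \<Rightarrow> bool" where
  "L1_lln M Z z \<longleftrightarrow>
     (\<forall>t. integrable M (Z t) \<and> (\<integral>\<omega>. Z t \<omega> \<partial>M) = z) \<and>
     (\<forall>h. (\<lambda>N. \<integral>\<omega>. \<bar>(\<Sum>i<N. Z (h + int i) \<omega>) / real N - z\<bar> \<partial>M) \<longlonglongrightarrow> 0)"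

lemma L1_llnD:
  assumes "L1_lln M Z z"
  shows "integrable M (Z t)" "(\<integral>\<omega>. Z t \<omega> \<partial>M) = z"
    "(\<lambda>N. \<integral>\<omega>. \<bar>(\<Sum>i<N. Z (h + int i) \<omega>) / real N - z\<bar> \<partial>M) \<longlonglongrightarrow> 0"
  using assms by (auto simp: L1_lln_def)

context prob_space
begin

lemma expectation_abs_le_sqrt:
  fixes f :: "'a \<Rightarrow> real"
  assumes "f \<in> borel_measurable M" "integrable M (\<lambda>x. (f x)\<^sup>2)"
  shows "(\<integral>x. \<bar>f x\<bar> \<partial>M) \<le> sqrt (\<integral>x. (f x)\<^sup>2 \<partial>M)"
  using integral_abs_mult_le[of f M "\<lambda>_. 1"] assms by (simp add: prob_space)

text \<open>A row of the covariance matrix of N consecutive terms meets every lag at most twice, so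
  their sum has variance at most 2 N (b 0 + ... + b (N - 1)); after division by N^2 a Cesaro mean of
  a null sequence remains. The bound \<open>c\<close> is asked for from lag \<open>T\<close> on,
  because windows of innovations may overlap at small lags.\<close>

lemma L1_lln_weak_dependence:
  fixes Z :: "int \<Rightarrow> 'a \<Rightarrow> real" and c :: "nat \<Rightarrow> real"
  assumes [measurable]: "\<And>t. Z t \<in> borel_measurable M"
    and sq: "\<And>t. integrable M (\<lambda>\<omega>. (Z t \<omega>)\<^sup>2)"
    and K: "\<And>t. (\<integral>\<omega>. (Z t \<omega>)\<^sup>2 \<partial>M) \<le> K"
    and mean: "\<And>t. (\<integral>\<omega>. Z t \<omega> \<partial>M) = z"
    and c: "\<And>t n. n \<ge> T \<Longrightarrow> \<bar>(\<integral>\<omega>. Z t \<omega> * Z (t + int n) \<omega> \<partial>M) - z\<^sup>2\<bar> \<le> c n"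
    and c0: "c \<longlonglongrightarrow> 0"
  shows "L1_lln M Z z"
proof -
  have int: "integrable M (Z t)" for t
    using sq by (rule square_integrable_imp_integrable[rotated]) simp
  have intp: "integrable M (\<lambda>\<omega>. Z t \<omega> * Z s \<omega>)" for t s
    using sq by (intro integrable_mult_square_integrable) auto
  have cov: "(\<integral>\<omega>. (Z t \<omega> - z) * (Z s \<omega> - z) \<partial>M) = (\<integral>\<omega>. Z t \<omega> * Z s \<omega> \<partial>M) - z\<^sup>2" for t s
    using int intp mean by (simp add: algebra_simps prob_space power2_eq_square)
  have intD: "integrable M (\<lambda>\<omega>. (Z t \<omega> - z) * (Z s \<omega> - z))" for t s
    using int intp by (simp add: algebra_simps)
  have bdd: "\<bar>\<integral>\<omega>. (Z t \<omega> - z) * (Z s \<omega> - z) \<partial>M\<bar> \<le> K" for t s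
  proof -
    have sqD: "integrable M (\<lambda>\<omega>. (Z t \<omega> - z)\<^sup>2)" and leD: "(\<integral>\<omega>. (Z t \<omega> - z)\<^sup>2 \<partial>M) \<le> K" for t
      using intD[of t t] cov[of t t] K[of t] zero_le_square[of z]
      unfolding power2_eq_square by linarith+
    have "\<bar>\<integral>\<omega>. (Z t \<omega> - z) * (Z s \<omega> - z) \<partial>M\<bar> \<le> (\<integral>\<omega>. \<bar>(Z t \<omega> - z) * (Z s \<omega> - z)\<bar> \<partial>M)"
      by (rule integral_abs_bound)
    also have "\<dots> \<le> sqrt (\<integral>\<omega>. (Z t \<omega> - z)\<^sup>2 \<partial>M) * sqrt (\<integral>\<omega>. (Z s \<omega> - z)\<^sup>2 \<partial>M)"
      using sqD by (intro integral_abs_mult_le) auto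
    also have "\<dots> \<le> sqrt K * sqrt K"
      using leD order_trans[OF _ K, of 0 t] by (intro mult_mono) auto
    also have "\<dots> = K" using order_trans[OF _ K, of 0 t] by simp
    finally show ?thesis .
  qed
  \<comment> \<open>Below lag \<open>T\<close> the Cauchy-Schwarz bound \<open>K\<close> is used;
    finitely many lags do not affect the Cesaro limit.\<close>
  define b where "b n = (if n < T then K else \<bar>c n\<bar>)" for n
  have K0: "K \<ge> 0" using order_trans[OF _ K, of 0 0] by simp
  have b0: "b n \<ge> 0" for n using K0 by (simp add: b_def)
  have "(\<lambda>n. \<bar>c n\<bar>) \<longlonglongrightarrow> 0" using c0 by (rule tendsto_rabs_zero)
  then have "b \<longlonglongrightarrow> 0"
    by (rule Lim_transform_eventually) (auto simp: b_def eventually_sequentially intro!: exI[of _ T])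
  then have ces: "(\<lambda>N. (\<Sum>n<N. b n) / real N) \<longlonglongrightarrow> 0" by (rule cesaro_null)
  have covb: "\<bar>\<integral>\<omega>. (Z t \<omega> - z) * (Z (t + int n) \<omega> - z) \<partial>M\<bar> \<le> b n" for t n
    using bdd[of t "t + int n"] c[of n t] by (auto simp: b_def cov)
  have "(\<lambda>N. \<integral>\<omega>. \<bar>(\<Sum>i<N. Z (h + int i) \<omega>) / real N - z\<bar> \<partial>M) \<longlonglongrightarrow> 0" for h
  proof (rule tendsto_sandwich[where f = "\<lambda>_. 0"])
    define D where "D i \<omega> = Z (h + int i) \<omega> - z" for i \<omega>
    have [measurable]: "D i \<in> borel_measurable M" for i unfolding D_def by measurable
    have iD: "integrable M (\<lambda>\<omega>. D i \<omega> * D j \<omega>)" for i j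
      unfolding D_def by (rule intD)
    have cD: "\<bar>\<integral>\<omega>. D i \<omega> * D j \<omega> \<partial>M\<bar> \<le> b (if i \<le> j then j - i else i - j)" for i j
    proof (cases "i \<le> j")
      case True
      then have "int (j - i) = int j - int i" by (rule of_nat_diff)
      then show ?thesis using covb[of "h + int i" "j - i"] True by (simp add: D_def)
    next
      case False
      then have "int (i - j) = int i - int j" by (intro of_nat_diff) simp
      then show ?thesis using covb[of "h + int j" "i - j"] False by (simp add: D_def mult.commute)
    qed
    have S: "(\<integral>\<omega>. (\<Sum>i<N. D i \<omega>)\<^sup>2 \<partial>M) \<le> 2 * real N * (\<Sum>n<N. b n)" for N
    proof -
      \<comment> \<open>Columns left of the diagonal run through the lags \<open>1..i\<close>, the
        others through \<open>0..N - 1 - i\<close>; both sets lie in \<open>{..<N}\<close> and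
        \<open>b\<close> is nonnegative.\<close>
      have row: "(\<Sum>j<N. b (if i \<le> j then j - i else i - j)) \<le> 2 * (\<Sum>n<N. b n)" if "i < N" for i
      proof -
        have "{..<N} = {..<i} \<union> {i..<N}" using that by auto
        then have "(\<Sum>j<N. b (if i \<le> j then j - i else i - j)) =
            (\<Sum>j<i. b (if i \<le> j then j - i else i - j)) + (\<Sum>j\<in>{i..<N}. b (if i \<le> j then j - i else i - j))"
          by (simp add: sum.union_disjoint ivl_disj_int)
        also have "(\<Sum>j<i. b (if i \<le> j then j - i else i - j)) = (\<Sum>n\<in>(\<lambda>j. i - j) ` {..<i}. b n)"
          by (subst sum.reindex) (auto simp: inj_on_def)
        also have "\<dots> \<le> (\<Sum>n<N. b n)"
          using b0 that by (intro sum_mono2) auto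
        also have "(\<Sum>j\<in>{i..<N}. b (if i \<le> j then j - i else i - j)) = (\<Sum>n\<in>(\<lambda>j. j - i) ` {i..<N}. b n)"
          by (subst sum.reindex) (auto simp: inj_on_def)
        also have "\<dots> \<le> (\<Sum>n<N. b n)"
          using b0 that by (intro sum_mono2) auto
        finally show ?thesis by simp
      qed
      have "(\<integral>\<omega>. (\<Sum>i<N. D i \<omega>)\<^sup>2 \<partial>M) = (\<integral>\<omega>. (\<Sum>i<N. \<Sum>j<N. D i \<omega> * D j \<omega>) \<partial>M)"
        by (simp add: power2_eq_square sum_product)
      also have "\<dots> = (\<Sum>i<N. \<Sum>j<N. \<integral>\<omega>. D i \<omega> * D j \<omega> \<partial>M)"
        using iD by (simp add: integral_sum)
      also have "\<dots> \<le> (\<Sum>i<N. \<Sum>j<N. b (if i \<le> j then j - i else i - j))"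
        using cD by (intro sum_mono) (smt (verit))
      also have "\<dots> \<le> (\<Sum>i<N. 2 * (\<Sum>n<N. b n))"
        using row by (intro sum_mono) auto
      finally show ?thesis by (simp add: mult.commute mult.left_commute)
    qed
    show "\<forall>\<^sub>F N in sequentially. (\<integral>\<omega>. \<bar>(\<Sum>i<N. Z (h + int i) \<omega>) / real N - z\<bar> \<partial>M)
        \<le> sqrt (2 * ((\<Sum>n<N. b n) / real N))"
    proof (rule eventually_sequentiallyI[of 1])
      fix N :: nat assume N: "1 \<le> N"
      have eq: "(\<Sum>i<N. Z (h + int i) \<omega>) / real N - z = (\<Sum>i<N. D i \<omega>) / real N" for \<omega>
        using N by (simp add: D_def sum_subtractf field_simps)
      have "integrable M (\<lambda>\<omega>. (\<Sum>i<N. \<Sum>j<N. D i \<omega> * D j \<omega>))"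
        using iD by auto
      then have "integrable M (\<lambda>\<omega>. (\<Sum>i<N. D i \<omega>)\<^sup>2)"
        by (simp add: power2_eq_square sum_product)
      then have "(\<integral>\<omega>. \<bar>(\<Sum>i<N. D i \<omega>) / real N\<bar> \<partial>M) \<le> sqrt (\<integral>\<omega>. ((\<Sum>i<N. D i \<omega>) / real N)\<^sup>2 \<partial>M)"
        by (intro expectation_abs_le_sqrt) (auto simp: power_divide)
      also have "(\<integral>\<omega>. ((\<Sum>i<N. D i \<omega>) / real N)\<^sup>2 \<partial>M) \<le> 2 * real N * (\<Sum>n<N. b n) / (real N)\<^sup>2"
        using S[of N] by (simp add: power_divide divide_right_mono)
      also have "\<dots> = 2 * ((\<Sum>n<N. b n) / real N)"
        using N by (simp add: power2_eq_square field_simps)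
      finally show "(\<integral>\<omega>. \<bar>(\<Sum>i<N. Z (h + int i) \<omega>) / real N - z\<bar> \<partial>M)
        \<le> sqrt (2 * ((\<Sum>n<N. b n) / real N))" by (simp add: eq)
    qed
    show "(\<lambda>N. sqrt (2 * ((\<Sum>n<N. b n) / real N))) \<longlonglongrightarrow> 0"
      using tendsto_real_sqrt[OF tendsto_mult[OF tendsto_const[of 2] ces]] by simp
  qed (auto simp: integral_nonneg_AE)
  then show ?thesis using int mean by (simp add: L1_lln_def)
qed

lemma L1_lln_add:
  assumes "L1_lln M Y y" "L1_lln M Z z"
  shows "L1_lln M (\<lambda>t \<omega>. Y t \<omega> + Z t \<omega>) (y + z)"
proof -
  note Y = L1_llnD[OF assms(1)] and Z = L1_llnD[OF assms(2)]
  have "(\<lambda>N. \<integral>\<omega>. \<bar>(\<Sum>i<N. Y (h + int i) \<omega> + Z (h + int i) \<omega>) / real N - (y + z)\<bar> \<partial>M) \<longlonglongrightarrow> 0" for h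
  proof (rule tendsto_sandwich[where f = "\<lambda>_. 0"])
    show "(\<lambda>N. (\<integral>\<omega>. \<bar>(\<Sum>i<N. Y (h + int i) \<omega>) / real N - y\<bar> \<partial>M) +
        (\<integral>\<omega>. \<bar>(\<Sum>i<N. Z (h + int i) \<omega>) / real N - z\<bar> \<partial>M)) \<longlonglongrightarrow> 0"
      using tendsto_add[OF Y(3) Z(3)] by simp
    show "\<forall>\<^sub>F N in sequentially. (\<integral>\<omega>. \<bar>(\<Sum>i<N. Y (h + int i) \<omega> + Z (h + int i) \<omega>) / real N - (y + z)\<bar> \<partial>M)
      \<le> (\<integral>\<omega>. \<bar>(\<Sum>i<N. Y (h + int i) \<omega>) / real N - y\<bar> \<partial>M) +
        (\<integral>\<omega>. \<bar>(\<Sum>i<N. Z (h + int i) \<omega>) / real N - z\<bar> \<partial>M)"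
    proof (rule always_eventually, rule allI)
      fix N
      have "(\<integral>\<omega>. \<bar>(\<Sum>i<N. Y (h + int i) \<omega> + Z (h + int i) \<omega>) / real N - (y + z)\<bar> \<partial>M)
        \<le> (\<integral>\<omega>. \<bar>(\<Sum>i<N. Y (h + int i) \<omega>) / real N - y\<bar> +
            \<bar>(\<Sum>i<N. Z (h + int i) \<omega>) / real N - z\<bar> \<partial>M)"
        using Y(1) Z(1) by (intro integral_mono) (auto simp: sum.distrib add_divide_distrib)
      then show "(\<integral>\<omega>. \<bar>(\<Sum>i<N. Y (h + int i) \<omega> + Z (h + int i) \<omega>) / real N - (y + z)\<bar> \<partial>M)
      \<le> (\<integral>\<omega>. \<bar>(\<Sum>i<N. Y (h + int i) \<omega>) / real N - y\<bar> \<partial>M) +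
        (\<integral>\<omega>. \<bar>(\<Sum>i<N. Z (h + int i) \<omega>) / real N - z\<bar> \<partial>M)"
        using Y(1) Z(1) by simp
    qed
  qed (auto simp: integral_nonneg_AE)
  then show ?thesis using Y Z by (simp add: L1_lln_def)
qed

lemma L1_lln_cmult:
  assumes "L1_lln M Z z"
  shows "L1_lln M (\<lambda>t \<omega>. c * Z t \<omega>) (c * z)"
proof -
  note Z = L1_llnD[OF assms]
  have "(\<Sum>i<N. c * Z (h + int i) \<omega>) / real N - c * z = c * ((\<Sum>i<N. Z (h + int i) \<omega>) / real N - z)" for N h \<omega>
    by (simp add: right_diff_distrib flip: sum_distrib_left)
  then have "(\<lambda>N. \<integral>\<omega>. \<bar>(\<Sum>i<N. c * Z (h + int i) \<omega>) / real N - c * z\<bar> \<partial>M) \<longlonglongrightarrow> 0" for h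
    using tendsto_mult_right_zero[OF Z(3), of "\<bar>c\<bar>" h] by (simp add: abs_mult)
  then show ?thesis using Z by (simp add: L1_lln_def)
qed

lemma L1_lln_const: "L1_lln M (\<lambda>_ _. c) c"
proof -
  have "(\<lambda>N. \<integral>\<omega>. \<bar>(\<Sum>i<N. c) / real N - c\<bar> \<partial>M) \<longlonglongrightarrow> 0"
    by (rule Lim_transform_eventually[OF tendsto_const])
       (auto simp: eventually_sequentially prob_space intro!: exI[of _ 1])
  then show ?thesis by (simp add: L1_lln_def prob_space)
qed

text \<open>The average of \<open>Z - Y\<close> has L1 norm at most \<delta> for every N, because
  the approximation is uniform in \<open>t\<close>. The mean of \<open>Z t\<close> is constant for
  the same reason: it is within \<delta> of a number \<open>y\<close> that does not depend on
  \<open>t\<close>.\<close>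

lemma L1_lln_approx:
  assumes int: "\<And>t. integrable M (Z t)"
    and approx: "\<And>\<delta>. \<delta> > 0 \<Longrightarrow> \<exists>Y y. L1_lln M Y y \<and> (\<forall>t. (\<integral>\<omega>. \<bar>Z t \<omega> - Y t \<omega>\<bar> \<partial>M) \<le> \<delta>)"
  shows "L1_lln M Z (\<integral>\<omega>. Z 0 \<omega> \<partial>M)"
proof -
  define z where "z = (\<integral>\<omega>. Z 0 \<omega> \<partial>M)"
  have near: "\<bar>(\<integral>\<omega>. Z t \<omega> \<partial>M) - y\<bar> \<le> \<delta>"
    if "L1_lln M Y y" "\<And>t. (\<integral>\<omega>. \<bar>Z t \<omega> - Y t \<omega>\<bar> \<partial>M) \<le> \<delta>" for Y y \<delta> t
  proof -
    have "(\<integral>\<omega>. Z t \<omega> \<partial>M) - y = (\<integral>\<omega>. Z t \<omega> - Y t \<omega> \<partial>M)"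
      using L1_llnD[OF that(1)] int by simp
    then show ?thesis
      using integral_abs_bound[of M "\<lambda>\<omega>. Z t \<omega> - Y t \<omega>"] that(2)[of t] by linarith
  qed
  have mean: "(\<integral>\<omega>. Z t \<omega> \<partial>M) = z" for t
  proof (rule ccontr)
    assume ne: "(\<integral>\<omega>. Z t \<omega> \<partial>M) \<noteq> z"
    define \<delta> where "\<delta> = \<bar>(\<integral>\<omega>. Z t \<omega> \<partial>M) - z\<bar> / 3"
    have "\<delta> > 0" using ne by (simp add: \<delta>_def)
    then obtain Y y where Y: "L1_lln M Y y" "\<And>t. (\<integral>\<omega>. \<bar>Z t \<omega> - Y t \<omega>\<bar> \<partial>M) \<le> \<delta>"
      using approx by blast
    have "\<bar>(\<integral>\<omega>. Z t \<omega> \<partial>M) - y\<bar> \<le> \<delta>" "\<bar>z - y\<bar> \<le> \<delta>"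
      using near[OF Y] by (auto simp: z_def)
    moreover have "\<bar>(\<integral>\<omega>. Z t \<omega> \<partial>M) - z\<bar> = 3 * \<delta>" by (simp add: \<delta>_def)
    ultimately show False using \<open>\<delta> > 0\<close> by (smt (verit))
  qed
  have "(\<lambda>N. \<integral>\<omega>. \<bar>(\<Sum>i<N. Z (h + int i) \<omega>) / real N - z\<bar> \<partial>M) \<longlonglongrightarrow> 0" for h
  proof (rule LIMSEQ_I)
    fix r :: real assume "r > 0"
    then obtain Y y where Y: "L1_lln M Y y" "\<And>t. (\<integral>\<omega>. \<bar>Z t \<omega> - Y t \<omega>\<bar> \<partial>M) \<le> r / 3"
      using approx[of "r / 3"] by auto
    note YD = L1_llnD[OF Y(1)]
    have yz: "\<bar>z - y\<bar> \<le> r / 3" using near[OF Y, of 0] by (simp add: z_def)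
    obtain n0 where n0: "\<And>N. N \<ge> n0 \<Longrightarrow> \<bar>\<integral>\<omega>. \<bar>(\<Sum>i<N. Y (h + int i) \<omega>) / real N - y\<bar> \<partial>M\<bar> < r / 3"
      using LIMSEQ_D[OF YD(3)[of h], of "r / 3"] \<open>r > 0\<close> by auto
    show "\<exists>no. \<forall>N\<ge>no. norm ((\<integral>\<omega>. \<bar>(\<Sum>i<N. Z (h + int i) \<omega>) / real N - z\<bar> \<partial>M) - 0) < r"
    proof (intro exI allI impI)
      fix N assume N: "N \<ge> max n0 1"
      have "(\<integral>\<omega>. \<bar>(\<Sum>i<N. Z (h + int i) \<omega>) / real N - z\<bar> \<partial>M)
        \<le> (\<integral>\<omega>. (\<Sum>i<N. \<bar>Z (h + int i) \<omega> - Y (h + int i) \<omega>\<bar>) / real N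
            + \<bar>(\<Sum>i<N. Y (h + int i) \<omega>) / real N - y\<bar> + \<bar>z - y\<bar> \<partial>M)"
      proof (rule integral_mono)
        fix \<omega>
        have "(\<Sum>i<N. Z (h + int i) \<omega>) / real N - z =
          (\<Sum>i<N. Z (h + int i) \<omega> - Y (h + int i) \<omega>) / real N
            + ((\<Sum>i<N. Y (h + int i) \<omega>) / real N - y) - (z - y)"
          by (simp add: sum_subtractf diff_divide_distrib)
        moreover have "\<bar>(\<Sum>i<N. Z (h + int i) \<omega> - Y (h + int i) \<omega>) / real N\<bar>
          \<le> (\<Sum>i<N. \<bar>Z (h + int i) \<omega> - Y (h + int i) \<omega>\<bar>) / real N"
          by (simp add: divide_right_mono)
        ultimately show "\<bar>(\<Sum>i<N. Z (h + int i) \<omega>) / real N - z\<bar> \<le>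
          (\<Sum>i<N. \<bar>Z (h + int i) \<omega> - Y (h + int i) \<omega>\<bar>) / real N
            + \<bar>(\<Sum>i<N. Y (h + int i) \<omega>) / real N - y\<bar> + \<bar>z - y\<bar>" by linarith
      qed (use int YD(1) in auto)
      also have "\<dots> = (\<Sum>i<N. (\<integral>\<omega>. \<bar>Z (h + int i) \<omega> - Y (h + int i) \<omega>\<bar> \<partial>M)) / real N
            + (\<integral>\<omega>. \<bar>(\<Sum>i<N. Y (h + int i) \<omega>) / real N - y\<bar> \<partial>M) + \<bar>z - y\<bar>"
        using int YD(1) by (simp add: prob_space integral_sum)
      also have "(\<Sum>i<N. (\<integral>\<omega>. \<bar>Z (h + int i) \<omega> - Y (h + int i) \<omega>\<bar> \<partial>M)) / real N \<le> (\<Sum>i<N. r / 3) / real N"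
        using Y(2) by (intro divide_right_mono sum_mono) auto
      also have "\<dots> = r / 3" using N by simp
      finally have "(\<integral>\<omega>. \<bar>(\<Sum>i<N. Z (h + int i) \<omega>) / real N - z\<bar> \<partial>M) < r"
        using n0[of N] N yz by simp
      then show "norm ((\<integral>\<omega>. \<bar>(\<Sum>i<N. Z (h + int i) \<omega>) / real N - z\<bar> \<partial>M) - 0) < r"
        by (simp add: integral_nonneg_AE)
    qed
  qed
  then show ?thesis using int mean unfolding z_def[symmetric] by (simp add: L1_lln_def)
qed

text \<open>Half of the decay of the second moments is spent on weights:
  \<open>(a i \<omega>)\<^sup>2 / w ^ i\<close> is summable in L1, and Cauchy-Schwarz against
  \<open>w ^ i\<close> bounds the squared tail from \<open>m\<close> on by
  \<open>w ^ m / (1 - w)\<close> times an integrable sum. The hypothesis on \<open>S\<close> is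
  attached to the second conclusion alone, so that the first one can help to establish it.\<close>

lemma L2_geometric_series:
  fixes a :: "nat \<Rightarrow> 'a \<Rightarrow> real"
  assumes [measurable]: "\<And>i. a i \<in> borel_measurable M" "S \<in> borel_measurable M"
    and sq: "\<And>i. integrable M (\<lambda>\<omega>. (a i \<omega>)\<^sup>2)"
    and B: "\<And>i. (\<integral>\<omega>. (a i \<omega>)\<^sup>2 \<partial>M) \<le> B * (w\<^sup>2) ^ i"
    and w: "0 < w" "w < 1"
  shows "AE \<omega> in M. summable (\<lambda>i. a i \<omega>)"
    and "AE \<omega> in M. S \<omega> = (\<Sum>i. a i \<omega>) \<Longrightarrow>
      integrable M (\<lambda>\<omega>. (S \<omega> - (\<Sum>i<m. a i \<omega>))\<^sup>2) \<and>
      (\<integral>\<omega>. (S \<omega> - (\<Sum>i<m. a i \<omega>))\<^sup>2 \<partial>M) \<le> B / (1 - w)\<^sup>2 * w ^ m"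
proof -
  define b where "b i \<omega> = (a i \<omega>)\<^sup>2 / w ^ i" for i \<omega>
  have [measurable]: "b i \<in> borel_measurable M" for i unfolding b_def by measurable
  have b0: "b i \<omega> \<ge> 0" for i \<omega> using w by (simp add: b_def)
  have bi: "integrable M (b i)" for i unfolding b_def using sq by simp
  have bB: "(\<integral>\<omega>. b i \<omega> \<partial>M) \<le> B * w ^ i" for i
  proof -
    have "(\<integral>\<omega>. b i \<omega> \<partial>M) = (\<integral>\<omega>. (a i \<omega>)\<^sup>2 \<partial>M) / w ^ i" by (simp add: b_def)
    also have "\<dots> \<le> B * (w\<^sup>2) ^ i / w ^ i" using B[of i] w by (intro divide_right_mono) auto
    also have "\<dots> = B * w ^ i" using w by (simp add: power2_eq_square power_mult_distrib)
    finally show ?thesis .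
  qed
  have geo: "(\<lambda>i. B * w ^ i) sums (B / (1 - w))"
    using sums_mult[OF geometric_sums[of w], of B] w by simp
  have sumb: "summable (\<lambda>i. \<integral>\<omega>. b i \<omega> \<partial>M)"
    by (rule summable_comparison_test[OF _ sums_summable[OF geo]])
       (use bB b0 in \<open>auto intro!: exI[of _ 0] simp: integral_nonneg_AE\<close>)
  have "(\<integral>\<^sup>+\<omega>. (\<Sum>i. ennreal (b i \<omega>)) \<partial>M) = (\<Sum>i. \<integral>\<^sup>+\<omega>. ennreal (b i \<omega>) \<partial>M)"
    by (rule nn_integral_suminf) simp
  also have "\<dots> = (\<Sum>i. ennreal (\<integral>\<omega>. b i \<omega> \<partial>M))"
    using bi b0 by (simp add: nn_integral_eq_integral)
  also have "\<dots> \<noteq> \<infinity>"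
    unfolding infinity_ennreal_def using b0
    by (intro ennreal_suminf_neq_top[OF sumb] integral_nonneg_AE) auto
  finally have "AE \<omega> in M. (\<Sum>i. ennreal (b i \<omega>)) \<noteq> \<infinity>"
    by (intro nn_integral_PInf_AE) auto
  then have AEb: "AE \<omega> in M. summable (\<lambda>i. b i \<omega>)"
    by eventually_elim (rule summable_suminf_not_top, use b0 in auto)
  define G where "G \<omega> = (\<Sum>i. b i \<omega>)" for \<omega>
  have Gi: "integrable M G" unfolding G_def
    by (rule integrable_suminf) (use bi AEb sumb b0 in auto)
  have "(\<integral>\<omega>. G \<omega> \<partial>M) = (\<Sum>i. \<integral>\<omega>. b i \<omega> \<partial>M)" unfolding G_def
    by (rule integral_suminf) (use bi AEb sumb b0 in auto)
  also have "\<dots> \<le> (\<Sum>i. B * w ^ i)"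
    using bB sumb sums_summable[OF geo] by (intro suminf_le) auto
  also have "\<dots> = B / (1 - w)" using geo by (simp add: sums_iff)
  finally have GB: "(\<integral>\<omega>. G \<omega> \<partial>M) \<le> B / (1 - w)" .
  have wsum: "summable (\<lambda>i. w ^ i)" using w by (simp add: summable_geometric)
  have abs_summable: "summable (\<lambda>i. \<bar>a i \<omega>\<bar>)" if "summable (\<lambda>i. b i \<omega>)" for \<omega>
  proof (rule summable_comparison_test[OF _ summable_add[OF that wsum]])
    have "\<bar>a i \<omega>\<bar> \<le> b i \<omega> + w ^ i" for i
    proof -
      \<comment> \<open>The weight \<open>u\<close> balances the inequality between arithmetic and
        geometric mean, so that absolute summability follows from that of \<open>b\<close> and of
        the geometric series.\<close>
      define u where "u = sqrt (w ^ i)"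
      have u: "u > 0" "u\<^sup>2 = w ^ i" using w by (auto simp: u_def)
      have "2 * (\<bar>a i \<omega>\<bar> / u) * u \<le> (\<bar>a i \<omega>\<bar> / u)\<^sup>2 + u\<^sup>2" by (rule sum_squares_bound)
      then have "2 * \<bar>a i \<omega>\<bar> \<le> b i \<omega> + w ^ i" using u by (simp add: power_divide b_def)
      then show ?thesis by linarith
    qed
    then show "\<exists>N. \<forall>n\<ge>N. norm \<bar>a n \<omega>\<bar> \<le> b n \<omega> + w ^ n" by auto
  qed
  show AEs: "AE \<omega> in M. summable (\<lambda>i. a i \<omega>)"
    using AEb by eventually_elim (rule summable_rabs_cancel, rule abs_summable)
  assume S: "AE \<omega> in M. S \<omega> = (\<Sum>i. a i \<omega>)"
  have key: "AE \<omega> in M. (S \<omega> - (\<Sum>i<m. a i \<omega>))\<^sup>2 \<le> w ^ m / (1 - w) * G \<omega>"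
    using AEb AEs S
  proof eventually_elim
    case (elim \<omega>)
    have lim: "(\<lambda>n. (\<Sum>i<n. a (i + m) \<omega>)\<^sup>2) \<longlonglongrightarrow> (\<Sum>i. a (i + m) \<omega>)\<^sup>2"
      using elim(2) by (intro tendsto_power summable_LIMSEQ summable_ignore_initial_segment)
    have fin: "(\<Sum>i<n. a (i + m) \<omega>)\<^sup>2 \<le> w ^ m / (1 - w) * G \<omega>" for n
    proof -
      have "(\<Sum>i<n. a (i + m) \<omega>) = (\<Sum>i<n. sqrt (w ^ (i + m)) * (a (i + m) \<omega> / sqrt (w ^ (i + m))))"
        using w by simp
      then have "(\<Sum>i<n. a (i + m) \<omega>)\<^sup>2 \<le>
          (\<Sum>i<n. (sqrt (w ^ (i + m)))\<^sup>2) * (\<Sum>i<n. (a (i + m) \<omega> / sqrt (w ^ (i + m)))\<^sup>2)"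
        using Cauchy_Schwarz_ineq_sum[of "\<lambda>i. sqrt (w ^ (i + m))" "\<lambda>i. a (i + m) \<omega> / sqrt (w ^ (i + m))" "{..<n}"]
        by simp
      also have "(\<Sum>i<n. (sqrt (w ^ (i + m)))\<^sup>2) = w ^ m * (\<Sum>i<n. w ^ i)"
        using w by (simp add: power_add sum_distrib_left mult.commute)
      also have "(\<Sum>i<n. (a (i + m) \<omega> / sqrt (w ^ (i + m)))\<^sup>2) = (\<Sum>i<n. b (i + m) \<omega>)"
        using w by (simp add: power_divide b_def)
      also have "w ^ m * (\<Sum>i<n. w ^ i) * (\<Sum>i<n. b (i + m) \<omega>) \<le> w ^ m * (1 / (1 - w)) * G \<omega>"
      proof (intro mult_mono mult_left_mono)
        show "(\<Sum>i<n. w ^ i) \<le> 1 / (1 - w)"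
          using sum_le_suminf[OF wsum, of "{..<n}"] suminf_geometric[of w] w by simp
        have "(\<Sum>i<n. b (i + m) \<omega>) = sum (\<lambda>i. b i \<omega>) ((\<lambda>i. i + m) ` {..<n})"
          by (subst sum.reindex) auto
        also have "\<dots> \<le> G \<omega>" unfolding G_def
          using elim(1) b0 by (intro sum_le_suminf) auto
        finally show "(\<Sum>i<n. b (i + m) \<omega>) \<le> G \<omega>" .
      qed (use w b0 in \<open>auto intro: sum_nonneg\<close>)
      finally show ?thesis by simp
    qed
    have "S \<omega> - (\<Sum>i<m. a i \<omega>) = (\<Sum>i. a (i + m) \<omega>)"
      using suminf_minus_initial_segment[OF elim(2), of m] elim(3) by simp
    then show ?case using LIMSEQ_le_const2[OF lim] fin by auto
  qed
  have I: "integrable M (\<lambda>\<omega>. (S \<omega> - (\<Sum>i<m. a i \<omega>))\<^sup>2)"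
  proof (rule Bochner_Integration.integrable_bound)
    show "integrable M (\<lambda>\<omega>. w ^ m / (1 - w) * G \<omega>)" using Gi by simp
    show "AE \<omega> in M. norm ((S \<omega> - (\<Sum>i<m. a i \<omega>))\<^sup>2) \<le> norm (w ^ m / (1 - w) * G \<omega>)"
      using key by eventually_elim (smt (verit) real_norm_def zero_le_power2)
  qed simp
  have "(\<integral>\<omega>. (S \<omega> - (\<Sum>i<m. a i \<omega>))\<^sup>2 \<partial>M) \<le> (\<integral>\<omega>. w ^ m / (1 - w) * G \<omega> \<partial>M)"
    using I Gi key by (intro integral_mono_AE) auto
  also have "\<dots> = w ^ m / (1 - w) * (\<integral>\<omega>. G \<omega> \<partial>M)" by simp
  also have "\<dots> \<le> w ^ m / (1 - w) * (B / (1 - w))" using GB w by (intro mult_left_mono) auto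
  also have "\<dots> = B / (1 - w)\<^sup>2 * w ^ m" by (simp add: power2_eq_square)
  finally show "integrable M (\<lambda>\<omega>. (S \<omega> - (\<Sum>i<m. a i \<omega>))\<^sup>2) \<and>
      (\<integral>\<omega>. (S \<omega> - (\<Sum>i<m. a i \<omega>))\<^sup>2 \<partial>M) \<le> B / (1 - w)\<^sup>2 * w ^ m" using I by simp
qed

end

section \<open>Monomials in the squared innovations\<close>

text \<open>\<open>e j\<close> counts powers of the square of \<open>x j\<close>. Over an infinite
  support the product is 1 by convention, so the rules on expectations ask for a finite one.\<close>

definition even_monomial :: "(int \<Rightarrow> nat) \<Rightarrow> (int \<Rightarrow> real) \<Rightarrow> real" where
  "even_monomial e x = (\<Prod>j\<in>{j. e j \<noteq> 0}. x j ^ (2 * e j))"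

definition shift_exp :: "int \<Rightarrow> (int \<Rightarrow> nat) \<Rightarrow> int \<Rightarrow> nat" where
  "shift_exp t e = (\<lambda>j. e (j - t))"

abbreviation fin_supp :: "(int \<Rightarrow> nat) \<Rightarrow> bool" where
  "fin_supp e \<equiv> finite {j. e j \<noteq> 0}"

lemma even_monomial_superset:
  assumes "finite J" "{j. e j \<noteq> 0} \<subseteq> J"
  shows "even_monomial e x = (\<Prod>j\<in>J. x j ^ (2 * e j))"
  unfolding even_monomial_def using assms by (intro prod.mono_neutral_left) auto

lemma fin_supp_add: "fin_supp e \<Longrightarrow> fin_supp f \<Longrightarrow> fin_supp (\<lambda>j. e j + f j)"
  by (rule finite_subset[of _ "{j. e j \<noteq> 0} \<union> {j. f j \<noteq> 0}"]) auto

lemma supp_shift: "{j. shift_exp t e j \<noteq> 0} = (\<lambda>j. j + t) ` {j. e j \<noteq> 0}"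
proof (rule set_eqI)
  fix j
  show "j \<in> {j. shift_exp t e j \<noteq> 0} \<longleftrightarrow> j \<in> (\<lambda>j. j + t) ` {j. e j \<noteq> 0}"
    by (auto simp: shift_exp_def image_iff intro!: exI[of _ "j - t"])
qed

lemma fin_supp_shift: "fin_supp e \<Longrightarrow> fin_supp (shift_exp t e)"
  unfolding supp_shift by (rule finite_imageI)

lemma even_monomial_add:
  assumes "fin_supp e" "fin_supp f"
  shows "even_monomial (\<lambda>j. e j + f j) x = even_monomial e x * even_monomial f x"
proof -
  let ?J = "{j. e j \<noteq> 0} \<union> {j. f j \<noteq> 0}"
  have "finite ?J" using assms by simp
  then have "even_monomial (\<lambda>j. e j + f j) x = (\<Prod>j\<in>?J. x j ^ (2 * (e j + f j)))"
    "even_monomial e x = (\<Prod>j\<in>?J. x j ^ (2 * e j))" "even_monomial f x = (\<Prod>j\<in>?J. x j ^ (2 * f j))"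
    by (intro even_monomial_superset; auto)+
  then show ?thesis by (simp add: distrib_left power_add prod.distrib)
qed

lemma even_monomial_measurable [measurable]:
  "even_monomial e \<in> borel_measurable (Pi\<^sub>M UNIV (\<lambda>_. borel))"
  unfolding even_monomial_def by measurable

text \<open>In U W - U' W' = (U - U') W + U (W - W') - (U - U') (W - W') only \<open>U\<close> and
  \<open>W\<close> need a second moment bound in advance. \<delta> depends on \<open>B\<close> and
  \<eta> alone, hence it is the same at all times of a process.\<close>

lemma L2_product_continuous:
  assumes "(B::real) \<ge> 0" "\<eta> > 0"
  obtains \<delta> where "\<delta> > 0"
    "\<And>(M :: 'w measure) U U' W W'.
      \<lbrakk> U \<in> borel_measurable M; U' \<in> borel_measurable M; W \<in> borel_measurable M; W' \<in> borel_measurable M;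
        integrable M (\<lambda>\<omega>. (U \<omega>)\<^sup>2); integrable M (\<lambda>\<omega>. (W \<omega>)\<^sup>2);
        (\<integral>\<omega>. (U \<omega>)\<^sup>2 \<partial>M) \<le> B; (\<integral>\<omega>. (W \<omega>)\<^sup>2 \<partial>M) \<le> B;
        integrable M (\<lambda>\<omega>. (U \<omega> - U' \<omega>)\<^sup>2); integrable M (\<lambda>\<omega>. (W \<omega> - W' \<omega>)\<^sup>2);
        (\<integral>\<omega>. (U \<omega> - U' \<omega>)\<^sup>2 \<partial>M) \<le> \<delta>; (\<integral>\<omega>. (W \<omega> - W' \<omega>)\<^sup>2 \<partial>M) \<le> \<delta> \<rbrakk> \<Longrightarrow>
      integrable M (\<lambda>\<omega>. U \<omega> * W \<omega> - U' \<omega> * W' \<omega>) \<and>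
      (\<integral>\<omega>. \<bar>U \<omega> * W \<omega> - U' \<omega> * W' \<omega>\<bar> \<partial>M) \<le> (\<eta> :: real)"
proof -
  \<comment> \<open>The three terms contribute at most \<open>r * sqrt B\<close>,
    \<open>sqrt B * r\<close> and \<open>r * r\<close>; as \<open>r \<le> 1\<close>, their sum is at
    most \<open>r * (2 * sqrt B + 1)\<close>.\<close>
  define r where "r = min 1 (\<eta> / (2 * sqrt B + 1))"
  have r: "r > 0" "r \<le> 1" "r * (2 * sqrt B + 1) \<le> \<eta>"
  proof -
    have p: "2 * sqrt B + 1 > 0" using assms by (simp add: add_nonneg_pos)
    then show "r > 0" "r \<le> 1" using assms by (auto simp: r_def)
    have "r \<le> \<eta> / (2 * sqrt B + 1)" by (simp add: r_def)
    then show "r * (2 * sqrt B + 1) \<le> \<eta>" using p by (simp add: pos_le_divide_eq)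
  qed
  show thesis
  proof (rule that[of "r\<^sup>2"])
    fix M :: "'w measure" and U U' W W' :: "'w \<Rightarrow> real"
    assume [measurable]: "U \<in> borel_measurable M" "U' \<in> borel_measurable M"
        "W \<in> borel_measurable M" "W' \<in> borel_measurable M"
      and i: "integrable M (\<lambda>\<omega>. (U \<omega>)\<^sup>2)" "integrable M (\<lambda>\<omega>. (W \<omega>)\<^sup>2)"
        "integrable M (\<lambda>\<omega>. (U \<omega> - U' \<omega>)\<^sup>2)" "integrable M (\<lambda>\<omega>. (W \<omega> - W' \<omega>)\<^sup>2)"
      and b: "(\<integral>\<omega>. (U \<omega>)\<^sup>2 \<partial>M) \<le> B" "(\<integral>\<omega>. (W \<omega>)\<^sup>2 \<partial>M) \<le> B"
        "(\<integral>\<omega>. (U \<omega> - U' \<omega>)\<^sup>2 \<partial>M) \<le> r\<^sup>2" "(\<integral>\<omega>. (W \<omega> - W' \<omega>)\<^sup>2 \<partial>M) \<le> r\<^sup>2"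
    have s: "sqrt (\<integral>\<omega>. (U \<omega>)\<^sup>2 \<partial>M) \<le> sqrt B" "sqrt (\<integral>\<omega>. (W \<omega>)\<^sup>2 \<partial>M) \<le> sqrt B"
      "sqrt (\<integral>\<omega>. (U \<omega> - U' \<omega>)\<^sup>2 \<partial>M) \<le> r" "sqrt (\<integral>\<omega>. (W \<omega> - W' \<omega>)\<^sup>2 \<partial>M) \<le> r"
      using b r(1) by (auto intro: real_le_lsqrt)
    have eq: "U \<omega> * W \<omega> - U' \<omega> * W' \<omega> = (U \<omega> - U' \<omega>) * W \<omega> + U \<omega> * (W \<omega> - W' \<omega>)
        - (U \<omega> - U' \<omega>) * (W \<omega> - W' \<omega>)" for \<omega>
      by (simp add: algebra_simps)
    have I: "integrable M (\<lambda>\<omega>. (U \<omega> - U' \<omega>) * W \<omega>)" "integrable M (\<lambda>\<omega>. U \<omega> * (W \<omega> - W' \<omega>))"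
      "integrable M (\<lambda>\<omega>. (U \<omega> - U' \<omega>) * (W \<omega> - W' \<omega>))"
      using i by (auto intro!: integrable_mult_square_integrable)
    have le: "(\<integral>\<omega>. \<bar>(U \<omega> - U' \<omega>) * W \<omega>\<bar> \<partial>M) \<le> r * sqrt B"
      "(\<integral>\<omega>. \<bar>U \<omega> * (W \<omega> - W' \<omega>)\<bar> \<partial>M) \<le> sqrt B * r"
      "(\<integral>\<omega>. \<bar>(U \<omega> - U' \<omega>) * (W \<omega> - W' \<omega>)\<bar> \<partial>M) \<le> r * r"
      using i s r(1) assms(1)
      by (auto intro!: order_trans[OF integral_abs_mult_le] mult_mono simp: integral_nonneg_AE)
    have "(\<integral>\<omega>. \<bar>U \<omega> * W \<omega> - U' \<omega> * W' \<omega>\<bar> \<partial>M) \<le> (\<integral>\<omega>. \<bar>(U \<omega> - U' \<omega>) * W \<omega>\<bar> +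
        \<bar>U \<omega> * (W \<omega> - W' \<omega>)\<bar> + \<bar>(U \<omega> - U' \<omega>) * (W \<omega> - W' \<omega>)\<bar> \<partial>M)"
      using I unfolding eq by (intro integral_mono) auto
    also have "\<dots> = (\<integral>\<omega>. \<bar>(U \<omega> - U' \<omega>) * W \<omega>\<bar> \<partial>M) + (\<integral>\<omega>. \<bar>U \<omega> * (W \<omega> - W' \<omega>)\<bar> \<partial>M)
        + (\<integral>\<omega>. \<bar>(U \<omega> - U' \<omega>) * (W \<omega> - W' \<omega>)\<bar> \<partial>M)"
      using I by simp
    also have "\<dots> \<le> r * sqrt B + sqrt B * r + r * r"
      using le by linarith
    also have "\<dots> \<le> r * (2 * sqrt B + 1)"
      using mult_left_mono[OF r(2), of r] r(1) by (simp add: algebra_simps)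
    also have "\<dots> \<le> \<eta>" by (rule r)
    finally show "integrable M (\<lambda>\<omega>. U \<omega> * W \<omega> - U' \<omega> * W' \<omega>) \<and>
      (\<integral>\<omega>. \<bar>U \<omega> * W \<omega> - U' \<omega> * W' \<omega>\<bar> \<partial>M) \<le> \<eta>"
      using I unfolding eq by auto
  qed (use r in simp)
qed

text \<open>\<open>mixing2\<close> pairs the process of products at gap \<open>m\<close> with its
  own translates, which is the form that averages of this process call for.\<close>

locale noise_liquidity = prob_space M for M :: "'w measure" +
  fixes \<epsilon> L :: "int \<Rightarrow> 'w \<Rightarrow> real"
  assumes iid: "iid_process M \<epsilon>"
    and var_eps: "(\<integral>\<omega>. (\<epsilon> 0 \<omega>)\<^sup>2 \<partial>M) = 1"
    and int_eps8: "integrable M (\<lambda>\<omega>. (\<epsilon> 0 \<omega>) ^ 8)"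
    and stat: "strictly_stationary M L"
    and int_L4: "integrable M (\<lambda>\<omega>. (L 0 \<omega>) ^ 4)"
    and indep: "indep_processes M L \<epsilon>"
    and mixing1: "((\<lambda>t. cov M (L 0) (L t)) \<longlongrightarrow> 0) at_top"
    and mixing2: "\<And>m. ((\<lambda>t. cov M (\<lambda>\<omega>. L 0 \<omega> * L m \<omega>) (\<lambda>\<omega>. L t \<omega> * L (t + m) \<omega>)) \<longlongrightarrow> 0) at_top"
begin

section \<open>Moments and stationarity of innovations and liquidity\<close>

lemma indep_eps: "indep_vars (\<lambda>_. borel) \<epsilon> UNIV"
  using iid by (simp add: iid_process_def)

lemma eps_measurable [measurable]: "\<epsilon> t \<in> borel_measurable M"
  using indep_eps by (simp add: indep_vars_def)

lemma L_measurable [measurable]: "L t \<in> borel_measurable M"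
  using stat by (simp add: strictly_stationary_def)

lemma L_process_measurable [measurable]: "(\<lambda>\<omega> t. L t \<omega>) \<in> M \<rightarrow>\<^sub>M Pi\<^sub>M UNIV (\<lambda>_. borel)"
  by (rule measurable_PiM_single') auto

lemma eps_identically_distributed:
  fixes f :: "real \<Rightarrow> real"
  assumes [measurable]: "f \<in> borel_measurable borel"
  shows "integrable M (\<lambda>\<omega>. f (\<epsilon> t \<omega>)) \<longleftrightarrow> integrable M (\<lambda>\<omega>. f (\<epsilon> 0 \<omega>))"
    and "(\<integral>\<omega>. f (\<epsilon> t \<omega>) \<partial>M) = (\<integral>\<omega>. f (\<epsilon> 0 \<omega>) \<partial>M)"
proof -
  have "distr M borel (\<epsilon> t) = distr M borel (\<epsilon> 0)"
    using iid unfolding iid_process_def by blast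
  moreover have "integrable (distr M borel (\<epsilon> s)) f \<longleftrightarrow> integrable M (\<lambda>\<omega>. f (\<epsilon> s \<omega>))"
    "(\<integral>x. f x \<partial>distr M borel (\<epsilon> s)) = (\<integral>\<omega>. f (\<epsilon> s \<omega>) \<partial>M)" for s
    by (rule integrable_distr_eq integral_distr; simp)+
  ultimately show "integrable M (\<lambda>\<omega>. f (\<epsilon> t \<omega>)) \<longleftrightarrow> integrable M (\<lambda>\<omega>. f (\<epsilon> 0 \<omega>))"
    "(\<integral>\<omega>. f (\<epsilon> t \<omega>) \<partial>M) = (\<integral>\<omega>. f (\<epsilon> 0 \<omega>) \<partial>M)" by metis+
qed

lemma stationary_integral:
  fixes H :: "(int \<Rightarrow> real) \<Rightarrow> real"
  assumes "finite J" and [measurable]: "H \<in> borel_measurable (Pi\<^sub>M J (\<lambda>_. borel))"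
  shows "integrable M (\<lambda>\<omega>. H (\<lambda>j\<in>J. L (j + h) \<omega>)) \<longleftrightarrow> integrable M (\<lambda>\<omega>. H (\<lambda>j\<in>J. L j \<omega>))"
    and "(\<integral>\<omega>. H (\<lambda>j\<in>J. L (j + h) \<omega>) \<partial>M) = (\<integral>\<omega>. H (\<lambda>j\<in>J. L j \<omega>) \<partial>M)"
proof -
  have eq: "distr M (Pi\<^sub>M J (\<lambda>_. borel)) (\<lambda>\<omega>. \<lambda>j\<in>J. L (j + h) \<omega>) =
        distr M (Pi\<^sub>M J (\<lambda>_. borel)) (\<lambda>\<omega>. \<lambda>j\<in>J. L j \<omega>)"
    using stat assms by (simp add: strictly_stationary_def)
  have "integrable (distr M (Pi\<^sub>M J (\<lambda>_. borel)) (\<lambda>\<omega>. \<lambda>j\<in>J. L (j + h) \<omega>)) H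
      \<longleftrightarrow> integrable M (\<lambda>\<omega>. H (\<lambda>j\<in>J. L (j + h) \<omega>))"
    "integral\<^sup>L (distr M (Pi\<^sub>M J (\<lambda>_. borel)) (\<lambda>\<omega>. \<lambda>j\<in>J. L (j + h) \<omega>)) H
      = (\<integral>\<omega>. H (\<lambda>j\<in>J. L (j + h) \<omega>) \<partial>M)" for h
    by (rule integrable_distr_eq integral_distr; simp)+
  from this[of h] this[of 0] eq
  show "integrable M (\<lambda>\<omega>. H (\<lambda>j\<in>J. L (j + h) \<omega>)) \<longleftrightarrow> integrable M (\<lambda>\<omega>. H (\<lambda>j\<in>J. L j \<omega>))"
    "(\<integral>\<omega>. H (\<lambda>j\<in>J. L (j + h) \<omega>) \<partial>M) = (\<integral>\<omega>. H (\<lambda>j\<in>J. L j \<omega>) \<partial>M)" by simp_all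
qed

text \<open>The functionals live on index sets such as \<open>{a, b, c, d}\<close>, in which times
  may coincide, so no case distinction on equal times arises.\<close>

lemma L_moments_stationary:
  "integrable M (\<lambda>\<omega>. L h \<omega> ^ k) \<longleftrightarrow> integrable M (\<lambda>\<omega>. L 0 \<omega> ^ k)"
  "(\<integral>\<omega>. L h \<omega> ^ k \<partial>M) = (\<integral>\<omega>. L 0 \<omega> ^ k \<partial>M)"
  "(\<integral>\<omega>. L (a + h) \<omega> * L (b + h) \<omega> \<partial>M) = (\<integral>\<omega>. L a \<omega> * L b \<omega> \<partial>M)"
  "(\<integral>\<omega>. L (a + h) \<omega> * L (b + h) \<omega> * (L (c + h) \<omega> * L (d + h) \<omega>) \<partial>M) =
    (\<integral>\<omega>. L a \<omega> * L b \<omega> * (L c \<omega> * L d \<omega>) \<partial>M)"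
  using stationary_integral[of "{0}" "\<lambda>x. x 0 ^ k" h]
    stationary_integral(2)[of "{a, b}" "\<lambda>x. x a * x b" h]
    stationary_integral(2)[of "{a, b, c, d}" "\<lambda>x. x a * x b * (x c * x d)" h]
  by simp_all

lemma integrable_L4: "integrable M (\<lambda>\<omega>. L t \<omega> ^ 4)"
  using int_L4 L_moments_stationary(1)[of t 4] by simp

lemma integrable_L2: "integrable M (\<lambda>\<omega>. (L t \<omega>)\<^sup>2)"
  using integrable_L4[of t] by (intro square_integrable_imp_integrable[of "\<lambda>\<omega>. (L t \<omega>)\<^sup>2"]) simp_all

lemma integrable_L: "integrable M (L t)"
  using integrable_L2 by (rule square_integrable_imp_integrable[rotated]) simp

lemma integrable_LL: "integrable M (\<lambda>\<omega>. L a \<omega> * L b \<omega>)"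
  using integrable_L2 by (intro integrable_mult_square_integrable) simp_all

lemma integrable_LL2: "integrable M (\<lambda>\<omega>. (L a \<omega> * L b \<omega>)\<^sup>2)"
  using integrable_L4 integrable_mult_square_integrable[of "\<lambda>\<omega>. (L a \<omega>)\<^sup>2" M "\<lambda>\<omega>. (L b \<omega>)\<^sup>2"]
  by (simp add: power_mult_distrib)

definition eps_moment :: "nat \<Rightarrow> real" where
  "eps_moment k = (\<integral>\<omega>. \<epsilon> 0 \<omega> ^ (2 * k) \<partial>M)"

lemma eps_moment_0_1 [simp]: "eps_moment 0 = 1" "eps_moment (Suc 0) = 1"
  by (simp_all add: eps_moment_def prob_space var_eps)

text \<open>Domination by \<open>1 + x ^ 8\<close>. The bound 4 on \<open>k\<close> reappears as the
  cap on exponents in all expectations of monomials.\<close>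

lemma integrable_eps_power:
  assumes "k \<le> 4"
  shows "integrable M (\<lambda>\<omega>. \<epsilon> t \<omega> ^ (2 * k))"
proof -
  have "integrable M (\<lambda>\<omega>. \<epsilon> 0 \<omega> ^ (2 * k))"
  proof (rule Bochner_Integration.integrable_bound)
    show "integrable M (\<lambda>\<omega>. 1 + \<epsilon> 0 \<omega> ^ 8)" using int_eps8 by simp
    have "\<bar>x ^ (2 * k)\<bar> \<le> \<bar>1 + x ^ 8\<bar>" for x :: real
    proof (cases "\<bar>x\<bar> \<le> 1")
      case True
      have "\<bar>x ^ (2 * k)\<bar> \<le> 1" using True by (simp add: power_abs power_le_one)
      moreover have "0 \<le> x ^ 8" by simp
      ultimately show ?thesis by linarith
    next
      case False
      then have "\<bar>x\<bar> ^ (2 * k) \<le> \<bar>x\<bar> ^ 8" using assms by (intro power_increasing) auto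
      then have "x ^ (2 * k) \<le> x ^ 8" using power_even_abs[of "2 * k" x] by simp
      then show ?thesis by simp
    qed
    then show "AE \<omega> in M. norm (\<epsilon> 0 \<omega> ^ (2 * k)) \<le> norm (1 + \<epsilon> 0 \<omega> ^ 8)" by simp
  qed simp
  then show ?thesis using eps_identically_distributed(1)[of "\<lambda>x. x ^ (2 * k)" t] by simp
qed

section \<open>Expectations of monomials in the innovations\<close>

definition eps_mon :: "(int \<Rightarrow> nat) \<Rightarrow> 'w \<Rightarrow> real" where
  "eps_mon e \<omega> = even_monomial e (\<lambda>t. \<epsilon> t \<omega>)"

lemma eps_mon_measurable [measurable]: "eps_mon e \<in> borel_measurable M"
  unfolding eps_mon_def even_monomial_def by measurable

lemma eps_mon_add:
  "fin_supp e \<Longrightarrow> fin_supp f \<Longrightarrow> eps_mon (\<lambda>j. e j + f j) \<omega> = eps_mon e \<omega> * eps_mon f \<omega>"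
  by (simp add: eps_mon_def even_monomial_add)

lemma eps_mon_moments:
  assumes e: "fin_supp e" "\<And>j. e j \<le> 4"
  shows "integrable M (eps_mon e)" "(\<integral>\<omega>. eps_mon e \<omega> \<partial>M) = (\<Prod>j\<in>{j. e j \<noteq> 0}. eps_moment (e j))"
proof -
  have "indep_vars (\<lambda>_. borel) \<epsilon> {j. e j \<noteq> 0}"
    using indep_eps by (rule indep_vars_subset) simp
  then have ind: "indep_vars (\<lambda>_. borel) (\<lambda>j \<omega>. \<epsilon> j \<omega> ^ (2 * e j)) {j. e j \<noteq> 0}"
    by (rule indep_vars_compose2[where Y = "\<lambda>j x. x ^ (2 * e j)"]) simp
  have mom: "(\<integral>\<omega>. \<epsilon> j \<omega> ^ (2 * e j) \<partial>M) = eps_moment (e j)" for j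
    unfolding eps_moment_def by (rule eps_identically_distributed(2)[of "\<lambda>x. x ^ (2 * e j)"]) simp
  have ex: "eps_mon e = (\<lambda>\<omega>. \<Prod>j\<in>{j. e j \<noteq> 0}. \<epsilon> j \<omega> ^ (2 * e j))"
    by (simp add: eps_mon_def even_monomial_def fun_eq_iff)
  show "integrable M (eps_mon e)" unfolding ex
    using e by (intro indep_vars_integrable ind integrable_eps_power) auto
  show "(\<integral>\<omega>. eps_mon e \<omega> \<partial>M) = (\<Prod>j\<in>{j. e j \<noteq> 0}. eps_moment (e j))"
    unfolding ex using e by (subst indep_vars_lebesgue_integral[OF _ ind]) (auto simp: mom integrable_eps_power)
qed

text \<open>Additional indices contribute \<open>eps_moment 0 = 1\<close>; this allows two monomials
  to be compared over a common index set.\<close>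

lemma expectation_eps_mon_superset:
  assumes "finite J" "{j. e j \<noteq> 0} \<subseteq> J" "\<And>j. e j \<le> 4"
  shows "(\<integral>\<omega>. eps_mon e \<omega> \<partial>M) = (\<Prod>j\<in>J. eps_moment (e j))"
proof -
  have "fin_supp e" using assms(1,2) by (rule finite_subset[rotated])
  show ?thesis
    unfolding eps_mon_moments(2)[OF \<open>fin_supp e\<close> assms(3)] using assms(1,2)
    by (intro prod.mono_neutral_left) auto
qed

lemma expectation_eps_mon_shift:
  assumes "fin_supp e" "\<And>j. e j \<le> 4"
  shows "(\<integral>\<omega>. eps_mon (shift_exp t e) \<omega> \<partial>M) = (\<integral>\<omega>. eps_mon e \<omega> \<partial>M)"
proof -
  have "(\<integral>\<omega>. eps_mon (shift_exp t e) \<omega> \<partial>M) = (\<Prod>j\<in>{j. shift_exp t e j \<noteq> 0}. eps_moment (shift_exp t e j))"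
    by (rule eps_mon_moments(2)) (use assms fin_supp_shift in \<open>auto simp: shift_exp_def\<close>)
  also have "\<dots> = (\<Prod>j\<in>{j. e j \<noteq> 0}. eps_moment (e j))"
    unfolding supp_shift by (subst prod.reindex) (auto simp: shift_exp_def)
  also have "\<dots> = (\<integral>\<omega>. eps_mon e \<omega> \<partial>M)" using assms by (simp add: eps_mon_moments(2))
  finally show ?thesis .
qed

text \<open>At each index one of the two exponents is zero, and \<open>eps_moment 0 = 1\<close>
  turns the moment of the sum into the product of the moments.\<close>

lemma expectation_eps_mon_disjoint:
  assumes "fin_supp e" "\<And>j. e j \<le> 4" "fin_supp f" "\<And>j. f j \<le> 4" "\<And>j. e j = 0 \<or> f j = 0"
  shows "(\<integral>\<omega>. eps_mon (\<lambda>j. e j + f j) \<omega> \<partial>M) = (\<integral>\<omega>. eps_mon e \<omega> \<partial>M) * (\<integral>\<omega>. eps_mon f \<omega> \<partial>M)"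
proof -
  let ?J = "{j. e j \<noteq> 0} \<union> {j. f j \<noteq> 0}"
  have fin: "finite ?J" using assms by simp
  have le: "e j + f j \<le> 4" for j using assms(2,4,5)[of j] by auto
  have split: "eps_moment (e j + f j) = eps_moment (e j) * eps_moment (f j)" for j
    using assms(5)[of j] by auto
  have "(\<integral>\<omega>. eps_mon (\<lambda>j. e j + f j) \<omega> \<partial>M) = (\<Prod>j\<in>?J. eps_moment (e j + f j))"
    using fin le by (intro expectation_eps_mon_superset) auto
  also have "\<dots> = (\<Prod>j\<in>?J. eps_moment (e j)) * (\<Prod>j\<in>?J. eps_moment (f j))"
    by (simp add: split prod.distrib)
  also have "(\<Prod>j\<in>?J. eps_moment (e j)) = (\<integral>\<omega>. eps_mon e \<omega> \<partial>M)"
    using fin assms by (intro expectation_eps_mon_superset[symmetric]) auto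
  also have "(\<Prod>j\<in>?J. eps_moment (f j)) = (\<integral>\<omega>. eps_mon f \<omega> \<partial>M)"
    using fin assms by (intro expectation_eps_mon_superset[symmetric]) auto
  finally show ?thesis .
qed

text \<open>The two processes are independent as random elements of path space, so independence is
  kept when one side is composed with a monomial and the other with any measurable path functional
  \<open>G\<close>.\<close>

lemma eps_mon_L_factor:
  assumes "fin_supp e" "\<And>j. e j \<le> 4"
    and [measurable]: "G \<in> borel_measurable (Pi\<^sub>M UNIV (\<lambda>_. borel))"
    and "integrable M (\<lambda>\<omega>. G (\<lambda>t. L t \<omega>))"
  shows "integrable M (\<lambda>\<omega>. eps_mon e \<omega> * G (\<lambda>t. L t \<omega>))"
    "(\<integral>\<omega>. eps_mon e \<omega> * G (\<lambda>t. L t \<omega>) \<partial>M) = (\<integral>\<omega>. eps_mon e \<omega> \<partial>M) * (\<integral>\<omega>. G (\<lambda>t. L t \<omega>) \<partial>M)"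
proof -
  have "indep_var borel (G \<circ> (\<lambda>\<omega> t. L t \<omega>)) borel (even_monomial e \<circ> (\<lambda>\<omega> t. \<epsilon> t \<omega>))"
    using indep unfolding indep_processes_def by (rule indep_var_compose) measurable
  then have iv: "indep_var borel (\<lambda>\<omega>. G (\<lambda>t. L t \<omega>)) borel (eps_mon e)"
    by (simp add: comp_def eps_mon_def[abs_def])
  note mon = eps_mon_moments(1)[OF assms(1,2)]
  show "integrable M (\<lambda>\<omega>. eps_mon e \<omega> * G (\<lambda>t. L t \<omega>))"
    using indep_var_integrable[OF iv assms(4) mon] by (simp add: mult.commute)
  show "(\<integral>\<omega>. eps_mon e \<omega> * G (\<lambda>t. L t \<omega>) \<partial>M) = (\<integral>\<omega>. eps_mon e \<omega> \<partial>M) * (\<integral>\<omega>. G (\<lambda>t. L t \<omega>) \<partial>M)"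
    using indep_var_lebesgue_integral[OF iv assms(4) mon] by (simp add: mult.commute)
qed

text \<open>Second moments double the exponents, hence \<open>e j \<le> 2\<close> and at most the
  eighth moment of an innovation. Once two translates of the support are disjoint, the innovation
  part factorises and the covariance at lag \<open>n\<close> is a constant times
  \<open>c n\<close>.\<close>

lemma L1_lln_eps_mon_L:
  fixes G :: "int \<Rightarrow> (int \<Rightarrow> real) \<Rightarrow> real"
  defines "\<Lambda> \<equiv> \<lambda>t \<omega>. G t (\<lambda>s. L s \<omega>)"
  assumes e: "fin_supp e" "\<And>j. e j \<le> 2"
    and [measurable]: "\<And>t. G t \<in> borel_measurable (Pi\<^sub>M UNIV (\<lambda>_. borel))"
    and sq: "\<And>t. integrable M (\<lambda>\<omega>. (\<Lambda> t \<omega>)\<^sup>2)"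
    and mean: "\<And>t. (\<integral>\<omega>. \<Lambda> t \<omega> \<partial>M) = lam"
    and c: "\<And>t n. (\<integral>\<omega>. \<Lambda> t \<omega> * \<Lambda> (t + int n) \<omega> \<partial>M) = lam\<^sup>2 + c n"
    and c0: "c \<longlonglongrightarrow> 0"
  shows "L1_lln M (\<lambda>t \<omega>. eps_mon (shift_exp t e) \<omega> * \<Lambda> t \<omega>) ((\<integral>\<omega>. eps_mon e \<omega> \<partial>M) * lam)"
proof -
  define E where "E = (\<integral>\<omega>. eps_mon e \<omega> \<partial>M)"
  have [measurable]: "\<Lambda> t \<in> borel_measurable M" for t unfolding \<Lambda>_def by measurable
  have e4: "e j \<le> 4" for j using e(2)[of j] by simp
  have fs: "fin_supp (shift_exp t e)" for t using e(1) by (rule fin_supp_shift)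
  have i\<Lambda>: "integrable M (\<Lambda> t)" for t
    using sq[of t] by (rule square_integrable_imp_integrable[rotated]) simp
  have i\<Lambda>\<Lambda>: "integrable M (\<lambda>\<omega>. \<Lambda> t \<omega> * \<Lambda> s \<omega>)" for t s
    using sq by (intro integrable_mult_square_integrable) simp_all
  have prod: "integrable M (\<lambda>\<omega>. (eps_mon (shift_exp t e) \<omega> * \<Lambda> t \<omega>) * (eps_mon (shift_exp s e) \<omega> * \<Lambda> s \<omega>))"
    "(\<integral>\<omega>. (eps_mon (shift_exp t e) \<omega> * \<Lambda> t \<omega>) * (eps_mon (shift_exp s e) \<omega> * \<Lambda> s \<omega>) \<partial>M)
      = (\<integral>\<omega>. eps_mon (\<lambda>j. shift_exp t e j + shift_exp s e j) \<omega> \<partial>M) * (\<integral>\<omega>. \<Lambda> t \<omega> * \<Lambda> s \<omega> \<partial>M)" for t s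
  proof -
    have le: "shift_exp t e j + shift_exp s e j \<le> 4" for j
      using e(2)[of "j - t"] e(2)[of "j - s"] by (simp add: shift_exp_def)
    have eq: "(eps_mon (shift_exp t e) \<omega> * \<Lambda> t \<omega>) * (eps_mon (shift_exp s e) \<omega> * \<Lambda> s \<omega>) =
      eps_mon (\<lambda>j. shift_exp t e j + shift_exp s e j) \<omega> * (\<lambda>x. G t x * G s x) (\<lambda>r. L r \<omega>)" for \<omega>
      using fs by (simp add: eps_mon_add \<Lambda>_def)
    show "integrable M (\<lambda>\<omega>. (eps_mon (shift_exp t e) \<omega> * \<Lambda> t \<omega>) * (eps_mon (shift_exp s e) \<omega> * \<Lambda> s \<omega>))"
      unfolding eq using fs le i\<Lambda>\<Lambda> by (intro eps_mon_L_factor(1) fin_supp_add) (simp_all add: \<Lambda>_def)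
    show "(\<integral>\<omega>. (eps_mon (shift_exp t e) \<omega> * \<Lambda> t \<omega>) * (eps_mon (shift_exp s e) \<omega> * \<Lambda> s \<omega>) \<partial>M)
      = (\<integral>\<omega>. eps_mon (\<lambda>j. shift_exp t e j + shift_exp s e j) \<omega> \<partial>M) * (\<integral>\<omega>. \<Lambda> t \<omega> * \<Lambda> s \<omega> \<partial>M)"
      unfolding eq using fs le i\<Lambda>\<Lambda> by (subst eps_mon_L_factor(2)) (simp_all add: \<Lambda>_def fin_supp_add)
  qed
  obtain T where T: "\<And>j n t. n \<ge> T \<Longrightarrow> shift_exp t e j = 0 \<or> shift_exp (t + int n) e j = 0"
  proof -
    obtain b where b: "\<And>j. e j \<noteq> 0 \<Longrightarrow> \<bar>j\<bar> \<le> b"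
      using e(1) finite_abs_int_segment finite_int_iff_bounded_le[of "{j. e j \<noteq> 0}"] by (auto simp: subset_iff)
    \<comment> \<open>The support lies in \<open>{-b..b}\<close>, so translates more than
      \<open>2 * b\<close> apart are disjoint.\<close>
    show thesis
    proof (rule that[of "nat (2 * b + 1)"], rule ccontr)
      fix j t n assume n: "nat (2 * b + 1) \<le> n" and "\<not> (shift_exp t e j = 0 \<or> shift_exp (t + int n) e j = 0)"
      then have "\<bar>j - t\<bar> \<le> b" "\<bar>j - (t + int n)\<bar> \<le> b" using b by (auto simp: shift_exp_def)
      moreover have "int n \<ge> 2 * b + 1" using n by linarith
      ultimately show False by linarith
    qed
  qed
  show ?thesis
  proof (rule L1_lln_weak_dependence)
    fix t
    show "(\<lambda>\<omega>. eps_mon (shift_exp t e) \<omega> * \<Lambda> t \<omega>) \<in> borel_measurable M" by measurable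
    show "integrable M (\<lambda>\<omega>. (eps_mon (shift_exp t e) \<omega> * \<Lambda> t \<omega>)\<^sup>2)"
      unfolding power2_eq_square by (rule prod)
    \<comment> \<open>The second moment is computed exactly, with \<open>c\<close> at lag 0; it does
      not depend on \<open>t\<close> and serves as the uniform bound.\<close>
    have sh: "(\<lambda>j. shift_exp t e j + shift_exp t e j) = shift_exp t (\<lambda>j. e j + e j)" by (simp add: shift_exp_def)
    have "(\<integral>\<omega>. (eps_mon (shift_exp t e) \<omega> * \<Lambda> t \<omega>)\<^sup>2 \<partial>M) =
      (\<integral>\<omega>. eps_mon (\<lambda>j. e j + e j) \<omega> \<partial>M) * (lam\<^sup>2 + c 0)"
      unfolding power2_eq_square prod sh using e c[of t 0]
      by (subst expectation_eps_mon_shift) (simp_all add: fin_supp_add mult_2[symmetric] power2_eq_square)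
    then show "(\<integral>\<omega>. (eps_mon (shift_exp t e) \<omega> * \<Lambda> t \<omega>)\<^sup>2 \<partial>M) \<le>
      (\<integral>\<omega>. eps_mon (\<lambda>j. e j + e j) \<omega> \<partial>M) * (lam\<^sup>2 + c 0)" by simp
    have s4: "shift_exp s e j \<le> 4" for s j using e4 by (simp add: shift_exp_def)
    have Es: "(\<integral>\<omega>. eps_mon (shift_exp s e) \<omega> \<partial>M) = E" for s
      unfolding E_def using e(1) e4 by (rule expectation_eps_mon_shift)
    show "(\<integral>\<omega>. eps_mon (shift_exp t e) \<omega> * \<Lambda> t \<omega> \<partial>M) = (\<integral>\<omega>. eps_mon e \<omega> \<partial>M) * lam"
      using eps_mon_L_factor(2)[OF fs s4, of "G t" t] i\<Lambda>[of t] mean[of t] Es[of t]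
      unfolding \<Lambda>_def E_def by simp
    fix n assume n: "n \<ge> T"
    have "(\<integral>\<omega>. eps_mon (\<lambda>j. shift_exp t e j + shift_exp (t + int n) e j) \<omega> \<partial>M) = E * E"
      using T[OF n] fs s4 by (subst expectation_eps_mon_disjoint) (auto simp: Es)
    then have "(\<integral>\<omega>. eps_mon (shift_exp t e) \<omega> * \<Lambda> t \<omega> * (eps_mon (shift_exp (t + int n) e) \<omega> * \<Lambda> (t + int n) \<omega>) \<partial>M)
        = E * E * (lam\<^sup>2 + c n)" by (simp add: prod c)
    then show "\<bar>(\<integral>\<omega>. eps_mon (shift_exp t e) \<omega> * \<Lambda> t \<omega> * (eps_mon (shift_exp (t + int n) e) \<omega> * \<Lambda> (t + int n) \<omega>) \<partial>M)
      - ((\<integral>\<omega>. eps_mon e \<omega> \<partial>M) * lam)\<^sup>2\<bar> \<le> \<bar>E * E * c n\<bar>"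
      unfolding E_def[symmetric] by (simp add: algebra_simps power2_eq_square)
  next
    show "(\<lambda>n. \<bar>E * E * c n\<bar>) \<longlonglongrightarrow> 0"
      using tendsto_mult_right_zero[OF c0] by (rule tendsto_rabs_zero)
  qed
qed

section \<open>Uniform L2 limits of finite windows\<close>

lemma L1_lln_mon:
  assumes e: "fin_supp e" "\<And>j. e j \<le> 2"
  shows "L1_lln M (\<lambda>t. eps_mon (shift_exp t e)) (\<integral>\<omega>. eps_mon e \<omega> \<partial>M)"
  using L1_lln_eps_mon_L[OF e, of "\<lambda>_ _. 1" 1 "\<lambda>_. 0"] by (simp add: prob_space)

lemma L1_lln_mon_L:
  assumes e: "fin_supp e" "\<And>j. e j \<le> 2"
  shows "L1_lln M (\<lambda>t \<omega>. eps_mon (shift_exp t e) \<omega> * L (t + a) \<omega>)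
    ((\<integral>\<omega>. eps_mon e \<omega> \<partial>M) * (\<integral>\<omega>. L 0 \<omega> \<partial>M))"
proof (rule L1_lln_eps_mon_L[OF e, of "\<lambda>t x. x (t + a)" "\<integral>\<omega>. L 0 \<omega> \<partial>M" "\<lambda>n. cov M (L 0) (L (int n))"])
  have mean: "(\<integral>\<omega>. L t \<omega> \<partial>M) = (\<integral>\<omega>. L 0 \<omega> \<partial>M)" for t
    using L_moments_stationary(2)[of t 1] by simp
  then show "(\<integral>\<omega>. L (t + a) \<omega> \<partial>M) = (\<integral>\<omega>. L 0 \<omega> \<partial>M)" for t by blast
  show "integrable M (\<lambda>\<omega>. (L (t + a) \<omega>)\<^sup>2)" for t by (rule integrable_L2)
  show "(\<lambda>n. cov M (L 0) (L (int n))) \<longlonglongrightarrow> 0"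
    using filterlim_compose[OF mixing1 filterlim_int_sequentially] .
  fix t n
  have "(\<integral>\<omega>. L (0 + (t + a)) \<omega> * L (int n + (t + a)) \<omega> \<partial>M) = (\<integral>\<omega>. L 0 \<omega> * L (int n) \<omega> \<partial>M)"
    by (rule L_moments_stationary(3))
  moreover have "cov M (L 0) (L (int n)) = (\<integral>\<omega>. L 0 \<omega> * L (int n) \<omega> \<partial>M) - (\<integral>\<omega>. L 0 \<omega> \<partial>M)\<^sup>2"
    unfolding cov_def using integrable_L integrable_LL mean[of "int n"]
    by (simp add: algebra_simps prob_space power2_eq_square)
  ultimately show "(\<integral>\<omega>. L (t + a) \<omega> * L (t + int n + a) \<omega> \<partial>M) =
      (\<integral>\<omega>. L 0 \<omega> \<partial>M)\<^sup>2 + cov M (L 0) (L (int n))"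
    by (simp add: algebra_simps)
qed simp

text \<open>By stationarity both the mean and the covariances depend on \<open>a\<close> and
  \<open>b\<close> through the gap \<open>b - a\<close> only, and the covariances are those of the
  product of two liquidities at this gap with its translates.\<close>

lemma L1_lln_mon_LL:
  assumes e: "fin_supp e" "\<And>j. e j \<le> 2"
  shows "L1_lln M (\<lambda>t \<omega>. eps_mon (shift_exp t e) \<omega> * (L (t + a) \<omega> * L (t + b) \<omega>))
    ((\<integral>\<omega>. eps_mon e \<omega> \<partial>M) * (\<integral>\<omega>. L 0 \<omega> * L (b - a) \<omega> \<partial>M))"
proof (rule L1_lln_eps_mon_L[OF e, of "\<lambda>t x. x (t + a) * x (t + b)" "\<integral>\<omega>. L 0 \<omega> * L (b - a) \<omega> \<partial>M"
      "\<lambda>n. cov M (\<lambda>\<omega>. L 0 \<omega> * L (b - a) \<omega>) (\<lambda>\<omega>. L (int n) \<omega> * L (int n + (b - a)) \<omega>)"])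
  have mean: "(\<integral>\<omega>. L (t + a) \<omega> * L (t + b) \<omega> \<partial>M) = (\<integral>\<omega>. L 0 \<omega> * L (b - a) \<omega> \<partial>M)" for t
    using L_moments_stationary(3)[of 0 "t + a" "b - a"] by (simp add: algebra_simps)
  then show "(\<integral>\<omega>. L (t + a) \<omega> * L (t + b) \<omega> \<partial>M) = (\<integral>\<omega>. L 0 \<omega> * L (b - a) \<omega> \<partial>M)" for t
    by blast
  show "integrable M (\<lambda>\<omega>. (L (t + a) \<omega> * L (t + b) \<omega>)\<^sup>2)" for t by (rule integrable_LL2)
  show "(\<lambda>n. cov M (\<lambda>\<omega>. L 0 \<omega> * L (b - a) \<omega>) (\<lambda>\<omega>. L (int n) \<omega> * L (int n + (b - a)) \<omega>)) \<longlonglongrightarrow> 0"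
    using filterlim_compose[OF mixing2 filterlim_int_sequentially] .
  fix t n
  have i4: "integrable M (\<lambda>\<omega>. L p \<omega> * L q \<omega> * (L r \<omega> * L s \<omega>))" for p q r s
    using integrable_LL2 by (intro integrable_mult_square_integrable) simp_all
  have "(\<integral>\<omega>. L (0 + (t + a)) \<omega> * L (b - a + (t + a)) \<omega> * (L (int n + (t + a)) \<omega> * L (int n + (b - a) + (t + a)) \<omega>) \<partial>M)
    = (\<integral>\<omega>. L 0 \<omega> * L (b - a) \<omega> * (L (int n) \<omega> * L (int n + (b - a)) \<omega>) \<partial>M)"
    by (rule L_moments_stationary(4))
  moreover have "(\<integral>\<omega>. L (int n) \<omega> * L (int n + (b - a)) \<omega> \<partial>M) = (\<integral>\<omega>. L 0 \<omega> * L (b - a) \<omega> \<partial>M)"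
    using mean[of "int n - a"] by (simp add: algebra_simps)
  then have "cov M (\<lambda>\<omega>. L 0 \<omega> * L (b - a) \<omega>) (\<lambda>\<omega>. L (int n) \<omega> * L (int n + (b - a)) \<omega>)
    = (\<integral>\<omega>. L 0 \<omega> * L (b - a) \<omega> * (L (int n) \<omega> * L (int n + (b - a)) \<omega>) \<partial>M) - (\<integral>\<omega>. L 0 \<omega> * L (b - a) \<omega> \<partial>M)\<^sup>2"
    unfolding cov_def right_diff_distrib left_diff_distrib using integrable_LL i4
    by (simp add: prob_space power2_eq_square)
  ultimately show "(\<integral>\<omega>. L (t + a) \<omega> * L (t + b) \<omega> * (L (t + int n + a) \<omega> * L (t + int n + b) \<omega>) \<partial>M) =
      (\<integral>\<omega>. L 0 \<omega> * L (b - a) \<omega> \<partial>M)\<^sup>2 +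
      cov M (\<lambda>\<omega>. L 0 \<omega> * L (b - a) \<omega>) (\<lambda>\<omega>. L (int n) \<omega> * L (int n + (b - a)) \<omega>)"
    by (simp add: ac_simps)
qed simp

text \<open>At time \<open>t\<close>, none of the innovations with index in \<open>t + A\<close> is involved.\<close>

inductive elementary :: "int set \<Rightarrow> (int \<Rightarrow> 'w \<Rightarrow> real) \<Rightarrow> bool" for A where
  base: "fin_supp e \<Longrightarrow> (\<And>j. e j \<le> 1) \<Longrightarrow> (\<And>j. j \<in> A \<Longrightarrow> e j = 0) \<Longrightarrow>
    elementary A (\<lambda>t \<omega>. eps_mon (shift_exp t e) \<omega> * (p + q * L (t + a) \<omega>))"
| add: "elementary A U \<Longrightarrow> elementary A W \<Longrightarrow> elementary A (\<lambda>t \<omega>. U t \<omega> + W t \<omega>)"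

section \<open>Finite-window processes and their products\<close>

lemma eps_mon_zero [simp]: "eps_mon (shift_exp t (\<lambda>_. 0)) \<omega> = 1"
  by (simp add: eps_mon_def even_monomial_def shift_exp_def)

lemma elementary_affine_L: "elementary A (\<lambda>t \<omega>. p + q * L (t + a) \<omega>)"
  using base[of "\<lambda>_. 0" A p q a] by simp

lemma elementary_sum:
  assumes "\<And>i. i < (m::nat) \<Longrightarrow> elementary A (U i)"
  shows "elementary A (\<lambda>t \<omega>. \<Sum>i<m. U i t \<omega>)"
  using assms
proof (induction m)
  case 0
  show ?case using elementary_affine_L[of A 0 0 0] by simp
next
  case (Suc m)
  then show ?case by (simp add: elementary.add)
qed

lemma elementary_cmult:
  assumes "elementary A U"
  shows "elementary A (\<lambda>t \<omega>. c * U t \<omega>)"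
  using assms
proof induction
  case (base e p q a)
  then show ?case using elementary.base[of e A "c * p" "c * q" a] by (simp add: algebra_simps)
next
  case (add U W)
  then show ?case using elementary.add by (simp add: distrib_left)
qed

lemma elementary_mono:
  assumes "elementary A U" "B \<subseteq> A"
  shows "elementary B U"
  using assms(1)
proof induction
  case (base e p q a)
  show ?case by (rule elementary.base) (use base assms(2) in blast)+
next
  case (add U W)
  then show ?case by (intro elementary.add)
qed

lemma shift_exp_shift_exp: "shift_exp (t + k) e = shift_exp t (shift_exp k e)"
  by (simp add: shift_exp_def fun_eq_iff algebra_simps)

text \<open>Innovations avoided at relative times \<open>A\<close> from \<open>t + k\<close> are
  avoided at relative times \<open>A\<close> moved by \<open>k\<close> when seen from
  \<open>t\<close>.\<close>

lemma elementary_shift: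
  assumes "elementary A U"
  shows "elementary ((\<lambda>j. j + k) ` A) (\<lambda>t. U (t + k))"
  using assms
proof induction
  case (base e p q a)
  have "elementary ((\<lambda>j. j + k) ` A) (\<lambda>t \<omega>. eps_mon (shift_exp t (shift_exp k e)) \<omega> * (p + q * L (t + (k + a)) \<omega>))"
    using base by (intro elementary.base fin_supp_shift) (auto simp: shift_exp_def)
  then show ?case by (simp add: shift_exp_shift_exp add.assoc)
next
  case (add U W)
  then show ?case by (simp add: elementary.add)
qed

lemma elementary_measurable:
  assumes "elementary A U"
  shows "U t \<in> borel_measurable M"
  using assms by induction simp_all

definition ind_exp :: "int set \<Rightarrow> int \<Rightarrow> nat" where
  "ind_exp A j = (if j \<in> A then 1 else 0)"

lemma fin_supp_ind_exp: "finite A \<Longrightarrow> fin_supp (ind_exp A)"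
  by (rule finite_subset[of _ A]) (auto simp: ind_exp_def)

lemma eps_mon_ind_exp: "eps_mon (shift_exp t (ind_exp A)) \<omega> = (\<Prod>j\<in>A. (\<epsilon> (t + j) \<omega>)\<^sup>2)"
proof -
  have supp: "{j. shift_exp t (ind_exp A) j \<noteq> 0} = (\<lambda>j. t + j) ` A"
    by (auto simp: shift_exp_def ind_exp_def image_iff split: if_splits intro!: bexI[of _ "_ - t"])
  show ?thesis
    unfolding eps_mon_def even_monomial_def supp
    by (subst prod.reindex) (auto simp: shift_exp_def ind_exp_def)
qed

lemma fin_supp_unit: "fin_supp (ind_exp {0})"
  by (rule fin_supp_ind_exp) simp

lemma eps_mon_unit: "eps_mon (shift_exp t (ind_exp {0})) \<omega> = (\<epsilon> t \<omega>)\<^sup>2"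
  by (simp add: eps_mon_ind_exp)

lemma eps_mon_shift_add:
  assumes "fin_supp e" "fin_supp f"
  shows "eps_mon (shift_exp t (\<lambda>j. e j + f j)) \<omega> = eps_mon (shift_exp t e) \<omega> * eps_mon (shift_exp t f) \<omega>"
  using eps_mon_add[OF fin_supp_shift[OF assms(1)] fin_supp_shift[OF assms(2)], of t t]
  by (simp add: shift_exp_def)

text \<open>As 0 is in \<open>A\<close>, the innovation at time \<open>t\<close> is absent from
  \<open>U t\<close>; the multiplication raises its exponent to one, which stays within the cap of
  the class, and 0 leaves the set of avoided times.\<close>

lemma elementary_eps_square:
  assumes "elementary A U" "0 \<in> A"
  shows "elementary (A - {0}) (\<lambda>t \<omega>. (\<epsilon> t \<omega>)\<^sup>2 * U t \<omega>)"
  using assms(1)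
proof induction
  case (base e p q a)
  have "elementary (A - {0}) (\<lambda>t \<omega>. eps_mon (shift_exp t (\<lambda>j. ind_exp {0} j + e j)) \<omega> * (p + q * L (t + a) \<omega>))"
  proof (intro elementary.base fin_supp_add fin_supp_unit base(1))
    show "ind_exp {0} j + e j \<le> 1" for j using base(2)[of j] base(3)[OF assms(2)] by (auto simp: ind_exp_def)
    show "ind_exp {0} j + e j = 0" if "j \<in> A - {0}" for j using base(3)[of j] that by (auto simp: ind_exp_def)
  qed
  then show ?case
    using eps_mon_shift_add[OF fin_supp_unit base(1)] by (simp add: eps_mon_unit mult.assoc)
next
  case (add U W)
  then show ?case using elementary.add by (simp add: distrib_left)
qed

text \<open>The mean is recorded explicitly because it depends on \<open>e\<close> only through the
  expectation of the monomial: two monomials of equal expectation give equal means of the full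
  products.\<close>

lemma L1_lln_mon_affine_product:
  assumes e: "fin_supp e" "\<And>j. e j \<le> 2"
  shows "L1_lln M (\<lambda>t \<omega>. eps_mon (shift_exp t e) \<omega> * ((p + q * L (t + a) \<omega>) * (p' + q' * L (t + b) \<omega>)))
    ((\<integral>\<omega>. eps_mon e \<omega> \<partial>M) * (p * p' + (p * q' + q * p') * (\<integral>\<omega>. L 0 \<omega> \<partial>M)
      + q * q' * (\<integral>\<omega>. L 0 \<omega> * L (b - a) \<omega> \<partial>M)))"
proof -
  have "L1_lln M (\<lambda>t \<omega>. (p * p') * eps_mon (shift_exp t e) \<omega>
      + (p * q') * (eps_mon (shift_exp t e) \<omega> * L (t + b) \<omega>)
      + (q * p') * (eps_mon (shift_exp t e) \<omega> * L (t + a) \<omega>)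
      + (q * q') * (eps_mon (shift_exp t e) \<omega> * (L (t + a) \<omega> * L (t + b) \<omega>)))
    ((p * p') * (\<integral>\<omega>. eps_mon e \<omega> \<partial>M)
      + (p * q') * ((\<integral>\<omega>. eps_mon e \<omega> \<partial>M) * (\<integral>\<omega>. L 0 \<omega> \<partial>M))
      + (q * p') * ((\<integral>\<omega>. eps_mon e \<omega> \<partial>M) * (\<integral>\<omega>. L 0 \<omega> \<partial>M))
      + (q * q') * ((\<integral>\<omega>. eps_mon e \<omega> \<partial>M) * (\<integral>\<omega>. L 0 \<omega> * L (b - a) \<omega> \<partial>M)))"
    by (intro L1_lln_add L1_lln_cmult L1_lln_mon L1_lln_mon_L L1_lln_mon_LL e)
  then show ?thesis by (simp add: algebra_simps)
qed

text \<open>Both factors are decomposed by induction; in the base case exponents of at most one add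
  up to at most two, the range of the law for monomials.\<close>

lemma L1_lln_elementary_product:
  assumes "elementary A U" "elementary B W"
  shows "\<exists>z. L1_lln M (\<lambda>t \<omega>. U t \<omega> * W t \<omega>) z"
  using assms(1)
proof induction
  case (base e p q a)
  note b1 = base
  show ?case using assms(2)
  proof induction
    case (base f p' q' b)
    have "e j + f j \<le> 2" for j using b1(2)[of j] base(2)[of j] by simp
    from L1_lln_mon_affine_product[OF fin_supp_add[OF b1(1) base(1)] this, of p q a p' q' b]
    show ?case using eps_mon_shift_add[OF b1(1) base(1)] by (auto simp: mult_ac)
  next
    case (add W W')
    then show ?case using L1_lln_add by (fastforce simp: distrib_left)
  qed
next
  case (add U U')
  then show ?case using L1_lln_add by (fastforce simp: distrib_right)
qed

lemma elementary_product_integrable: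
  "elementary A U \<Longrightarrow> elementary B W \<Longrightarrow> integrable M (\<lambda>\<omega>. U t \<omega> * W t \<omega>)"
  using L1_lln_elementary_product L1_llnD(1) by blast

text \<open>The innovation at time \<open>t\<close> has second moment one and is independent of \<open>U t\<close> and \<open>W t\<close>.\<close>

lemma elementary_eps_square_expectation:
  assumes "elementary {0} U" "elementary {0} W"
  shows "(\<integral>\<omega>. ((\<epsilon> t \<omega>)\<^sup>2 * U t \<omega>) * W t \<omega> \<partial>M) = (\<integral>\<omega>. U t \<omega> * W t \<omega> \<partial>M)"
  using assms(1)
proof induction
  case (base e p q a)
  note b1 = base
  show ?case using assms(2)
  proof induction
    case (base f p' q' b)
    define g where "g j = e j + f j" for j
    have g: "fin_supp g" "\<And>j. g j \<le> 2" "g 0 = 0"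
      using fin_supp_add[OF b1(1) base(1)] b1(2,3) base(2,3) add_mono[OF b1(2) base(2)]
      unfolding g_def by (auto simp: numeral_2_eq_2)
    have h: "fin_supp (\<lambda>j. ind_exp {0} j + g j)" "\<And>j. ind_exp {0} j + g j \<le> 2"
      using fin_supp_add[OF fin_supp_unit g(1)] g(2,3) by (auto simp: ind_exp_def)
    have mg: "eps_mon (shift_exp t g) \<omega> = eps_mon (shift_exp t e) \<omega> * eps_mon (shift_exp t f) \<omega>" for \<omega>
      unfolding g_def by (rule eps_mon_shift_add[OF b1(1) base(1)])
    have mh: "eps_mon (shift_exp t (\<lambda>j. ind_exp {0} j + g j)) \<omega> = (\<epsilon> t \<omega>)\<^sup>2 * eps_mon (shift_exp t g) \<omega>" for \<omega>
      unfolding eps_mon_shift_add[OF fin_supp_unit g(1)] eps_mon_unit ..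
    have "(\<integral>\<omega>. eps_mon (\<lambda>j. ind_exp {0} j + g j) \<omega> \<partial>M) = (\<integral>\<omega>. eps_mon (ind_exp {0}) \<omega> \<partial>M) * (\<integral>\<omega>. eps_mon g \<omega> \<partial>M)"
    proof (rule expectation_eps_mon_disjoint[OF fin_supp_unit _ g(1)])
      show "g j \<le> 4" for j using g(2)[of j] by simp
    qed (use g(3) in \<open>auto simp: ind_exp_def\<close>)
    moreover have "(\<integral>\<omega>. eps_mon (ind_exp {0}) \<omega> \<partial>M) = 1"
      using eps_mon_unit[of 0] var_eps by (simp add: shift_exp_def)
    ultimately have E: "(\<integral>\<omega>. eps_mon (\<lambda>j. ind_exp {0} j + g j) \<omega> \<partial>M) = (\<integral>\<omega>. eps_mon g \<omega> \<partial>M)" by simp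
    \<comment> \<open>By \<open>E\<close>, the additional exponent at 0 leaves the expectation of
      the monomial unchanged, so the explicit mean formula gives the same value for both
      integrals.\<close>
    show ?case
      using L1_llnD(2)[OF L1_lln_mon_affine_product[OF g(1,2), of p q a p' q' b], of t]
        L1_llnD(2)[OF L1_lln_mon_affine_product[OF h, of p q a p' q' b], of t]
      unfolding E mg mh by (simp add: mult_ac)
  next
    case (add W W')
    let ?U = "\<lambda>t \<omega>. eps_mon (shift_exp t e) \<omega> * (p + q * L (t + a) \<omega>)"
    have U: "elementary {0} ?U" using b1 by (rule elementary.base)
    note U' = elementary_eps_square[OF U insertI1]
    show ?case
      using add(3,4) elementary_product_integrable[OF U add(1)] elementary_product_integrable[OF U add(2)]
        elementary_product_integrable[OF U' add(1)] elementary_product_integrable[OF U' add(2)]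
      by (simp add: distrib_left)
  qed
next
  case (add U U')
  note i = elementary_product_integrable[OF _ assms(2)]
  show ?case
    using add(3,4) i[OF add(1)] i[OF add(2)] i[OF elementary_eps_square[OF add(1) insertI1]]
      i[OF elementary_eps_square[OF add(2) insertI1]]
    by (simp add: distrib_left distrib_right)
qed

section \<open>Approximation in L2, uniformly in time\<close>

definition L2_close :: "real \<Rightarrow> (int \<Rightarrow> 'w \<Rightarrow> real) \<Rightarrow> (int \<Rightarrow> 'w \<Rightarrow> real) \<Rightarrow> bool" where
  "L2_close \<delta> U W \<longleftrightarrow>
     (\<forall>t. integrable M (\<lambda>\<omega>. (U t \<omega> - W t \<omega>)\<^sup>2) \<and> (\<integral>\<omega>. (U t \<omega> - W t \<omega>)\<^sup>2 \<partial>M) \<le> \<delta>)"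

text \<open>The closure of the elementary processes in L2, uniformly over all times. The set
  \<open>A\<close> is imposed on the approximants, which is how independence of an innovation
  survives the limit.\<close>

definition approximable :: "int set \<Rightarrow> (int \<Rightarrow> 'w \<Rightarrow> real) \<Rightarrow> bool" where
  "approximable A U \<longleftrightarrow> (\<forall>t. U t \<in> borel_measurable M) \<and>
     (\<forall>\<delta>>0. \<exists>U'. elementary A U' \<and> L2_close \<delta> U U')"

lemma approximable_measurable: "approximable A U \<Longrightarrow> U t \<in> borel_measurable M"
  by (simp add: approximable_def)

lemma elementary_imp_approximable: "elementary A U \<Longrightarrow> approximable A U"
  unfolding approximable_def L2_close_def
  by (auto simp: elementary_measurable intro!: exI[of _ U])

lemma approximable_mono: "approximable A U \<Longrightarrow> B \<subseteq> A \<Longrightarrow> approximable B U"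
  unfolding approximable_def using elementary_mono by blast

lemma approximable_shift:
  assumes "approximable A U"
  shows "approximable ((\<lambda>j. j + k) ` A) (\<lambda>t. U (t + k))"
  unfolding approximable_def
proof (intro conjI allI impI)
  show "U (t + k) \<in> borel_measurable M" for t using assms by (simp add: approximable_def)
  fix \<delta> :: real assume "\<delta> > 0"
  then obtain U' where U': "elementary A U'" "L2_close \<delta> U U'"
    using assms unfolding approximable_def by blast
  show "\<exists>W. elementary ((\<lambda>j. j + k) ` A) W \<and> L2_close \<delta> (\<lambda>t. U (t + k)) W"
    using elementary_shift[OF U'(1), of k] U'(2) unfolding L2_close_def by blast
qed

text \<open>An elementary process has a second moment that is constant in time, by the law of large
  numbers for its square; an approximant with squared distance at most 1 passes this bound on to
  \<open>U\<close>.\<close>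

lemma approximable_bounded:
  assumes "approximable A U"
  obtains B where "B \<ge> 0" "\<And>t. integrable M (\<lambda>\<omega>. (U t \<omega>)\<^sup>2)" "\<And>t. (\<integral>\<omega>. (U t \<omega>)\<^sup>2 \<partial>M) \<le> B"
proof -
  obtain U' where U': "elementary A U'" "L2_close 1 U U'"
    using assms unfolding approximable_def by (meson zero_less_one)
  note [measurable] = approximable_measurable[OF assms] elementary_measurable[OF U'(1)]
  obtain z where z: "L1_lln M (\<lambda>t \<omega>. U' t \<omega> * U' t \<omega>) z"
    using L1_lln_elementary_product[OF U'(1) U'(1)] by blast
  have i': "integrable M (\<lambda>\<omega>. (U' t \<omega>)\<^sup>2)" and z': "(\<integral>\<omega>. (U' t \<omega>)\<^sup>2 \<partial>M) = z" for t
    using L1_llnD(1,2)[OF z, of t] by (simp_all add: power2_eq_square)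
  have d: "integrable M (\<lambda>\<omega>. (U t \<omega> - U' t \<omega>)\<^sup>2)" "(\<integral>\<omega>. (U t \<omega> - U' t \<omega>)\<^sup>2 \<partial>M) \<le> 1" for t
    using U'(2) by (auto simp: L2_close_def)
  have i: "integrable M (\<lambda>\<omega>. (U t \<omega>)\<^sup>2)" for t
    using integrable_square_add[of "\<lambda>\<omega>. U t \<omega> - U' t \<omega>" M "U' t"] d i' by simp
  have "(\<integral>\<omega>. (U t \<omega>)\<^sup>2 \<partial>M) \<le> 2 + 2 * z" for t
  proof -
    \<comment> \<open>The right side minus the left side is the square of
      \<open>U t \<omega> - 2 * U' t \<omega>\<close>.\<close>
    have "(U t \<omega>)\<^sup>2 \<le> 2 * (U t \<omega> - U' t \<omega>)\<^sup>2 + 2 * (U' t \<omega>)\<^sup>2" for \<omega>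
      using zero_le_power2[of "U t \<omega> - 2 * U' t \<omega>"] by (simp add: power2_eq_square algebra_simps)
    then have "(\<integral>\<omega>. (U t \<omega>)\<^sup>2 \<partial>M) \<le> (\<integral>\<omega>. 2 * (U t \<omega> - U' t \<omega>)\<^sup>2 + 2 * (U' t \<omega>)\<^sup>2 \<partial>M)"
      using i i' d by (intro integral_mono) auto
    also have "\<dots> = 2 * (\<integral>\<omega>. (U t \<omega> - U' t \<omega>)\<^sup>2 \<partial>M) + 2 * z"
      using i' d z' by simp
    finally show ?thesis using d(2)[of t] by simp
  qed
  moreover from order_trans[OF _ this[of 0], of 0] have "2 + 2 * z \<ge> 0" by simp
  ultimately show thesis using i that by blast
qed

text \<open>The uniform second moment bounds of \<open>U\<close> and \<open>W\<close> let one
  \<delta> serve every time \<open>t\<close> and every pair of approximants.\<close>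

lemma approximable_product_close:
  assumes U: "approximable A U" and W: "approximable B W" and "\<eta> > 0"
  shows "\<exists>\<delta>>0. \<forall>U' W'. (\<forall>t. U' t \<in> borel_measurable M) \<and> (\<forall>t. W' t \<in> borel_measurable M) \<and>
      L2_close \<delta> U U' \<and> L2_close \<delta> W W' \<longrightarrow>
      (\<forall>t. integrable M (\<lambda>\<omega>. U t \<omega> * W t \<omega> - U' t \<omega> * W' t \<omega>) \<and>
        (\<integral>\<omega>. \<bar>U t \<omega> * W t \<omega> - U' t \<omega> * W' t \<omega>\<bar> \<partial>M) \<le> \<eta>)"
proof -
  obtain B1 where B1: "B1 \<ge> 0" "\<And>t. integrable M (\<lambda>\<omega>. (U t \<omega>)\<^sup>2)" "\<And>t. (\<integral>\<omega>. (U t \<omega>)\<^sup>2 \<partial>M) \<le> B1"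
    using approximable_bounded[OF U] by blast
  obtain B2 where B2: "B2 \<ge> 0" "\<And>t. integrable M (\<lambda>\<omega>. (W t \<omega>)\<^sup>2)" "\<And>t. (\<integral>\<omega>. (W t \<omega>)\<^sup>2 \<partial>M) \<le> B2"
    using approximable_bounded[OF W] by blast
  have le: "(\<integral>\<omega>. (U t \<omega>)\<^sup>2 \<partial>M) \<le> max B1 B2" "(\<integral>\<omega>. (W t \<omega>)\<^sup>2 \<partial>M) \<le> max B1 B2" for t
    using B1(3)[of t] B2(3)[of t] by auto
  have "max B1 B2 \<ge> 0" using B1(1) by simp
  from L2_product_continuous[where ?'w = 'w, OF this \<open>\<eta> > 0\<close>]
  obtain \<delta> where \<delta>: "\<delta> > 0" and
    *: "\<And>(M :: 'w measure) U U' W W'.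
      \<lbrakk> U \<in> borel_measurable M; U' \<in> borel_measurable M; W \<in> borel_measurable M; W' \<in> borel_measurable M;
        integrable M (\<lambda>\<omega>. (U \<omega>)\<^sup>2); integrable M (\<lambda>\<omega>. (W \<omega>)\<^sup>2);
        (\<integral>\<omega>. (U \<omega>)\<^sup>2 \<partial>M) \<le> max B1 B2; (\<integral>\<omega>. (W \<omega>)\<^sup>2 \<partial>M) \<le> max B1 B2;
        integrable M (\<lambda>\<omega>. (U \<omega> - U' \<omega>)\<^sup>2); integrable M (\<lambda>\<omega>. (W \<omega> - W' \<omega>)\<^sup>2);
        (\<integral>\<omega>. (U \<omega> - U' \<omega>)\<^sup>2 \<partial>M) \<le> \<delta>; (\<integral>\<omega>. (W \<omega> - W' \<omega>)\<^sup>2 \<partial>M) \<le> \<delta> \<rbrakk> \<Longrightarrow>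
      integrable M (\<lambda>\<omega>. U \<omega> * W \<omega> - U' \<omega> * W' \<omega>) \<and>
      (\<integral>\<omega>. \<bar>U \<omega> * W \<omega> - U' \<omega> * W' \<omega>\<bar> \<partial>M) \<le> \<eta>"
    by blast
  show ?thesis
  proof (intro exI[of _ \<delta>] conjI \<delta> allI impI; elim conjE)
    fix U' W' :: "int \<Rightarrow> 'w \<Rightarrow> real" and t
    assume m: "\<forall>t. U' t \<in> borel_measurable M" "\<forall>t. W' t \<in> borel_measurable M"
      and c: "L2_close \<delta> U U'" "L2_close \<delta> W W'"
    have "integrable M (\<lambda>\<omega>. U t \<omega> * W t \<omega> - U' t \<omega> * W' t \<omega>) \<and>
        (\<integral>\<omega>. \<bar>U t \<omega> * W t \<omega> - U' t \<omega> * W' t \<omega>\<bar> \<partial>M) \<le> \<eta>"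
      by (rule *) (use m c B1 B2 le approximable_measurable[OF U] approximable_measurable[OF W]
          in \<open>auto simp: L2_close_def\<close>)
    then show "integrable M (\<lambda>\<omega>. U t \<omega> * W t \<omega> - U' t \<omega> * W' t \<omega>)"
      "(\<integral>\<omega>. \<bar>U t \<omega> * W t \<omega> - U' t \<omega> * W' t \<omega>\<bar> \<partial>M) \<le> \<eta>" by blast+
  qed
qed

lemma approximable_product_integrable:
  assumes "approximable A U" "approximable B W"
  shows "integrable M (\<lambda>\<omega>. U t \<omega> * W s \<omega>)"
proof (rule integrable_mult_square_integrable)
  show "integrable M (\<lambda>\<omega>. (U t \<omega>)\<^sup>2)" using approximable_bounded[OF assms(1)] by blast
  show "integrable M (\<lambda>\<omega>. (W s \<omega>)\<^sup>2)" using approximable_bounded[OF assms(2)] by blast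
qed (use assms approximable_measurable in blast)+

text \<open>Besides the convergence of averages this yields that the mean of
  \<open>U t \<omega> * W t \<omega>\<close> does not depend on \<open>t\<close>, the form of
  stationarity on which the moment equations rely.\<close>

lemma L1_lln_approximable_product:
  assumes U: "approximable A U" and W: "approximable B W"
  shows "L1_lln M (\<lambda>t \<omega>. U t \<omega> * W t \<omega>) (\<integral>\<omega>. U 0 \<omega> * W 0 \<omega> \<partial>M)"
proof (rule L1_lln_approx)
  show "integrable M (\<lambda>\<omega>. U t \<omega> * W t \<omega>)" for t
    using U W by (rule approximable_product_integrable)
  fix \<eta> :: real assume "\<eta> > 0"
  then obtain \<delta> where \<delta>: "\<delta> > 0" "\<forall>U' W'. (\<forall>t. U' t \<in> borel_measurable M) \<and> (\<forall>t. W' t \<in> borel_measurable M) \<and>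
      L2_close \<delta> U U' \<and> L2_close \<delta> W W' \<longrightarrow>
      (\<forall>t. integrable M (\<lambda>\<omega>. U t \<omega> * W t \<omega> - U' t \<omega> * W' t \<omega>) \<and>
        (\<integral>\<omega>. \<bar>U t \<omega> * W t \<omega> - U' t \<omega> * W' t \<omega>\<bar> \<partial>M) \<le> \<eta>)"
    using approximable_product_close[OF U W \<open>\<eta> > 0\<close>] by blast
  obtain U' where U': "elementary A U'" "L2_close \<delta> U U'"
    using U \<delta>(1) unfolding approximable_def by blast
  obtain W' where W': "elementary B W'" "L2_close \<delta> W W'"
    using W \<delta>(1) unfolding approximable_def by blast
  have "\<forall>t. (\<integral>\<omega>. \<bar>U t \<omega> * W t \<omega> - U' t \<omega> * W' t \<omega>\<bar> \<partial>M) \<le> \<eta>"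
    using \<delta>(2) U' W' elementary_measurable[OF U'(1)] elementary_measurable[OF W'(1)] by blast
  then show "\<exists>Y y. L1_lln M Y y \<and> (\<forall>t. (\<integral>\<omega>. \<bar>U t \<omega> * W t \<omega> - Y t \<omega>\<bar> \<partial>M) \<le> \<eta>)"
    using L1_lln_elementary_product[OF U'(1) W'(1)] by blast
qed

text \<open>\<open>Y\<close> stands for \<epsilon>_t^2 times \<open>S\<close>. Multiplication by
  \<epsilon>_t^2 need not be continuous in L2, so approximants of \<open>S\<close> do not
  automatically yield approximants of \<open>Y\<close>; \<open>SY\<close> asks for one
  \<open>U\<close> that serves both. The identity holds for elementary processes and passes to the
  limit.\<close>

lemma expectation_eps_square_product:
  assumes S: "approximable {0} S" and Y: "approximable {} Y"
    and SY: "\<And>\<delta>. \<delta> > 0 \<Longrightarrow> \<exists>U. elementary {0} U \<and> L2_close \<delta> S U \<and>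
      L2_close \<delta> Y (\<lambda>t \<omega>. (\<epsilon> t \<omega>)\<^sup>2 * U t \<omega>)"
    and W: "approximable {0} W"
  shows "(\<integral>\<omega>. Y t \<omega> * W t \<omega> \<partial>M) = (\<integral>\<omega>. S t \<omega> * W t \<omega> \<partial>M)"
proof (rule ccontr)
  assume ne: "(\<integral>\<omega>. Y t \<omega> * W t \<omega> \<partial>M) \<noteq> (\<integral>\<omega>. S t \<omega> * W t \<omega> \<partial>M)"
  \<comment> \<open>Two errors of at most \<eta> cannot account for a gap of three times
    \<eta>.\<close>
  define \<eta> where "\<eta> = \<bar>(\<integral>\<omega>. Y t \<omega> * W t \<omega> \<partial>M) - (\<integral>\<omega>. S t \<omega> * W t \<omega> \<partial>M)\<bar> / 3"
  have "\<eta> > 0" using ne by (simp add: \<eta>_def)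
  obtain \<delta>1 where \<delta>1: "\<delta>1 > 0" "\<forall>U' W'. (\<forall>t. U' t \<in> borel_measurable M) \<and> (\<forall>t. W' t \<in> borel_measurable M) \<and>
      L2_close \<delta>1 S U' \<and> L2_close \<delta>1 W W' \<longrightarrow>
      (\<forall>t. integrable M (\<lambda>\<omega>. S t \<omega> * W t \<omega> - U' t \<omega> * W' t \<omega>) \<and>
        (\<integral>\<omega>. \<bar>S t \<omega> * W t \<omega> - U' t \<omega> * W' t \<omega>\<bar> \<partial>M) \<le> \<eta>)"
    using approximable_product_close[OF S W \<open>\<eta> > 0\<close>] by blast
  obtain \<delta>2 where \<delta>2: "\<delta>2 > 0" "\<forall>U' W'. (\<forall>t. U' t \<in> borel_measurable M) \<and> (\<forall>t. W' t \<in> borel_measurable M) \<and>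
      L2_close \<delta>2 Y U' \<and> L2_close \<delta>2 W W' \<longrightarrow>
      (\<forall>t. integrable M (\<lambda>\<omega>. Y t \<omega> * W t \<omega> - U' t \<omega> * W' t \<omega>) \<and>
        (\<integral>\<omega>. \<bar>Y t \<omega> * W t \<omega> - U' t \<omega> * W' t \<omega>\<bar> \<partial>M) \<le> \<eta>)"
    using approximable_product_close[OF Y W \<open>\<eta> > 0\<close>] by blast
  define \<delta> where "\<delta> = min \<delta>1 \<delta>2"
  have "\<delta> > 0" using \<delta>1(1) \<delta>2(1) by (simp add: \<delta>_def)
  have close_mono: "L2_close \<delta>1 U V" "L2_close \<delta>2 U V" if "L2_close \<delta> U V" for U V
    using that unfolding L2_close_def \<delta>_def by force+
  obtain U where U: "elementary {0} U" "L2_close \<delta> S U" "L2_close \<delta> Y (\<lambda>t \<omega>. (\<epsilon> t \<omega>)\<^sup>2 * U t \<omega>)"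
    using SY[OF \<open>\<delta> > 0\<close>] by blast
  obtain W' where W': "elementary {0} W'" "L2_close \<delta> W W'"
    using W \<open>\<delta> > 0\<close> unfolding approximable_def by blast
  note U2 = elementary_eps_square[OF U(1) insertI1]
  have 1: "integrable M (\<lambda>\<omega>. S t \<omega> * W t \<omega> - U t \<omega> * W' t \<omega>)"
      "(\<integral>\<omega>. \<bar>S t \<omega> * W t \<omega> - U t \<omega> * W' t \<omega>\<bar> \<partial>M) \<le> \<eta>"
    using \<delta>1(2) elementary_measurable[OF U(1)] elementary_measurable[OF W'(1)] U W' close_mono by blast+
  have 2: "integrable M (\<lambda>\<omega>. Y t \<omega> * W t \<omega> - (\<epsilon> t \<omega>)\<^sup>2 * U t \<omega> * W' t \<omega>)"
      "(\<integral>\<omega>. \<bar>Y t \<omega> * W t \<omega> - (\<epsilon> t \<omega>)\<^sup>2 * U t \<omega> * W' t \<omega>\<bar> \<partial>M) \<le> \<eta>"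
    using \<delta>2(2)[THEN spec, THEN spec, of "\<lambda>t \<omega>. (\<epsilon> t \<omega>)\<^sup>2 * U t \<omega>" W']
      elementary_measurable[OF U2] elementary_measurable[OF W'(1)] close_mono(2)[OF U(3)] close_mono(2)[OF W'(2)]
    by simp_all
  have i: "integrable M (\<lambda>\<omega>. S t \<omega> * W t \<omega>)" "integrable M (\<lambda>\<omega>. Y t \<omega> * W t \<omega>)"
      "integrable M (\<lambda>\<omega>. U t \<omega> * W' t \<omega>)" "integrable M (\<lambda>\<omega>. (\<epsilon> t \<omega>)\<^sup>2 * U t \<omega> * W' t \<omega>)"
    by (rule approximable_product_integrable[OF S W] approximable_product_integrable[OF Y W]
      elementary_product_integrable[OF U(1) W'(1)] elementary_product_integrable[OF U2 W'(1)])+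
  have "\<bar>(\<integral>\<omega>. S t \<omega> * W t \<omega> \<partial>M) - (\<integral>\<omega>. U t \<omega> * W' t \<omega> \<partial>M)\<bar> \<le> \<eta>"
    using integral_abs_bound[of M "\<lambda>\<omega>. S t \<omega> * W t \<omega> - U t \<omega> * W' t \<omega>"] 1 i by simp
  moreover have "\<bar>(\<integral>\<omega>. Y t \<omega> * W t \<omega> \<partial>M) - (\<integral>\<omega>. U t \<omega> * W' t \<omega> \<partial>M)\<bar> \<le> \<eta>"
    using integral_abs_bound[of M "\<lambda>\<omega>. Y t \<omega> * W t \<omega> - (\<epsilon> t \<omega>)\<^sup>2 * U t \<omega> * W' t \<omega>"] 2 i
      elementary_eps_square_expectation[OF U(1) W'(1), of t] by simp
  moreover have "\<bar>(\<integral>\<omega>. Y t \<omega> * W t \<omega> \<partial>M) - (\<integral>\<omega>. S t \<omega> * W t \<omega> \<partial>M)\<bar> = 3 * \<eta>"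
    by (simp add: \<eta>_def)
  ultimately show False using \<open>\<eta> > 0\<close> by (smt (verit))
qed

section \<open>The stationary solution\<close>

lemma one_le_eps_moment_2: "1 \<le> eps_moment 2"
proof -
  have "1 \<le> sqrt (eps_moment 2)"
    using expectation_abs_le_sqrt[of "\<lambda>\<omega>. (\<epsilon> 0 \<omega>)\<^sup>2"] integrable_eps_power[of 2 0] var_eps
    by (simp add: eps_moment_def)
  then show ?thesis by simp
qed

text \<open>This brings the eighth moment condition on \<alpha>1 to bear on the fourth moment, which
  governs the L2 size of the series.\<close>

lemma eps_moment_2_le: "eps_moment 2 \<le> sqrt (\<integral>\<omega>. \<epsilon> 0 \<omega> ^ 8 \<partial>M)"
  using expectation_abs_le_sqrt[of "\<lambda>\<omega>. \<epsilon> 0 \<omega> ^ 4"] int_eps8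
  by (simp add: eps_moment_def flip: power_mult)

lemma L1_llnD_const: "L1_lln M Z z \<Longrightarrow> (\<integral>\<omega>. Z t \<omega> \<partial>M) = (\<integral>\<omega>. Z s \<omega> \<partial>M)"
  by (simp add: L1_llnD(2))

text \<open>The second moment of \<open>p + q * L 0 \<omega>\<close>, in the unsimplified form that
  \<open>L1_lln_mon_affine_product\<close> gives for two equal factors.\<close>

definition affine_L_square :: "real \<Rightarrow> real \<Rightarrow> real" where
  "affine_L_square p q = p * p + (p * q + q * p) * (\<integral>\<omega>. L 0 \<omega> \<partial>M) + q * q * (\<integral>\<omega>. L 0 \<omega> * L 0 \<omega> \<partial>M)"

text \<open>Squaring doubles the exponents, after which each index in \<open>A\<close> contributes
  one fourth moment.\<close>

lemma second_moment_ind_exp: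
  assumes "finite A"
  shows "integrable M (\<lambda>\<omega>. (c * (eps_mon (shift_exp t (ind_exp A)) \<omega> * (p + q * L (t + a) \<omega>)))\<^sup>2)"
    "(\<integral>\<omega>. (c * (eps_mon (shift_exp t (ind_exp A)) \<omega> * (p + q * L (t + a) \<omega>)))\<^sup>2 \<partial>M)
      = c\<^sup>2 * (eps_moment 2 ^ card A * affine_L_square p q)"
proof -
  have e: "fin_supp (\<lambda>j. ind_exp A j + ind_exp A j)" "\<And>j. ind_exp A j + ind_exp A j \<le> 2"
    using fin_supp_add[OF fin_supp_ind_exp fin_supp_ind_exp] assms by (auto simp: ind_exp_def)
  have eq: "(c * (eps_mon (shift_exp t (ind_exp A)) \<omega> * (p + q * L (t + a) \<omega>)))\<^sup>2 =
      c\<^sup>2 * (eps_mon (shift_exp t (\<lambda>j. ind_exp A j + ind_exp A j)) \<omega> * ((p + q * L (t + a) \<omega>) * (p + q * L (t + a) \<omega>)))" for \<omega>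
    unfolding eps_mon_shift_add[OF fin_supp_ind_exp[OF assms] fin_supp_ind_exp[OF assms]]
    by (simp add: power2_eq_square algebra_simps)
  have "(\<integral>\<omega>. eps_mon (\<lambda>j. ind_exp A j + ind_exp A j) \<omega> \<partial>M) = (\<Prod>j\<in>A. eps_moment 2)"
    using assms e(2)
    by (subst expectation_eps_mon_superset[of A]) (auto simp: ind_exp_def numeral_2_eq_2 intro!: prod.cong)
  then have E: "(\<integral>\<omega>. eps_mon (\<lambda>j. ind_exp A j + ind_exp A j) \<omega> \<partial>M) = eps_moment 2 ^ card A"
    by simp
  note lln = L1_lln_mon_affine_product[OF e, of p q a p q a]
  show "integrable M (\<lambda>\<omega>. (c * (eps_mon (shift_exp t (ind_exp A)) \<omega> * (p + q * L (t + a) \<omega>)))\<^sup>2)"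
    unfolding eq using L1_llnD(1)[OF lln, of t] by simp
  show "(\<integral>\<omega>. (c * (eps_mon (shift_exp t (ind_exp A)) \<omega> * (p + q * L (t + a) \<omega>)))\<^sup>2 \<partial>M)
      = c\<^sup>2 * (eps_moment 2 ^ card A * affine_L_square p q)"
    unfolding eq using L1_llnD(2)[OF lln, of t] E by (simp add: affine_L_square_def)
qed

end

text \<open>The series yields the L2 approximation, the recursion the moment equations. As an
  equation with \<open>suminf\<close>, the series assumption does not itself assert
  convergence.\<close>

locale liquidity_arch = noise_liquidity M \<epsilon> L for M :: "'w measure" and \<epsilon> L +
  fixes X \<sigma> :: "int \<Rightarrow> 'w \<Rightarrow> real" and \<alpha>0 \<alpha>1 l1 :: real
  assumes mean_L: "(\<integral>\<omega>. L 0 \<omega> \<partial>M) = 1"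
    and alpha1_pos: "\<alpha>1 > 0"
    and X_measurable [measurable]: "\<And>t. X t \<in> borel_measurable M"
    and sigma_measurable [measurable]: "\<And>t. \<sigma> t \<in> borel_measurable M"
    and X_eq: "\<And>t. AE \<omega> in M. X t \<omega> = \<sigma> t \<omega> * \<epsilon> t \<omega>"
    and sigma_rec: "\<And>t. AE \<omega> in M. (\<sigma> t \<omega>)\<^sup>2 = \<alpha>0 + \<alpha>1 * (X (t - 1) \<omega>)\<^sup>2 + l1 * L (t - 1) \<omega>"
    and sigma_series: "\<And>t. AE \<omega> in M. (\<sigma> (t + 1) \<omega>)\<^sup>2 =
           (\<Sum>i. (\<Prod>j<i. \<alpha>1 * (\<epsilon> (t - int j) \<omega>)\<^sup>2) * (\<alpha>0 + l1 * L (t - int i) \<omega>))"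
    and alpha1_less: "\<alpha>1 < 1 / (\<integral>\<omega>. (\<epsilon> 0 \<omega>) ^ 8 \<partial>M) powr (1 / 4)"
begin

definition rate :: real where "rate = \<alpha>1 * sqrt (eps_moment 2)"

text \<open>\<open>rate\<close> is the ratio by which the L2 norms of consecutive terms of the
  series shrink. Since sqrt(E(\<epsilon>^4)) is at most E(\<epsilon>^8)^(1/4), the condition on
  \<alpha>1 puts it below one.\<close>

lemma rate: "0 < rate" "rate < 1" "rate\<^sup>2 = \<alpha>1\<^sup>2 * eps_moment 2"
proof -
  define m where "m = (\<integral>\<omega>. \<epsilon> 0 \<omega> ^ 8 \<partial>M)"
  have m1: "1 \<le> eps_moment 2" and le: "eps_moment 2 \<le> sqrt m"
    using one_le_eps_moment_2 eps_moment_2_le by (auto simp: m_def)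
  have "1 \<le> sqrt m" using m1 le by linarith
  then have m0: "m \<ge> 1" by simp
  show "0 < rate" using m1 alpha1_pos by (simp add: rate_def)
  show "rate\<^sup>2 = \<alpha>1\<^sup>2 * eps_moment 2" using m1 by (simp add: rate_def power_mult_distrib)
  have "sqrt (eps_moment 2) \<le> sqrt (sqrt m)" using le by simp
  also have "\<dots> = m powr (1 / 4)" using m0 by (simp add: powr_half_sqrt[symmetric] powr_powr)
  finally have "rate \<le> \<alpha>1 * m powr (1 / 4)" unfolding rate_def using alpha1_pos by simp
  also have "\<dots> < 1" using alpha1_less m0 by (simp add: m_def[symmetric] field_simps)
  finally show "rate < 1" .
qed

text \<open>A term of the series for \<sigma>_t^2, obtained by moving the given series for time t +
  1 back by one step. The window of relative times is empty for \<open>i = 0\<close> and otherwise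
  ends at -1, so only innovations strictly before \<open>t\<close> occur.\<close>

definition summand :: "nat \<Rightarrow> int \<Rightarrow> 'w \<Rightarrow> real" where
  "summand i t \<omega> = \<alpha>1 ^ i *
     (eps_mon (shift_exp t (ind_exp {- int i..-1})) \<omega> * (\<alpha>0 + l1 * L (t + (- 1 - int i)) \<omega>))"

lemma summand_measurable [measurable]: "summand i t \<in> borel_measurable M"
  unfolding summand_def by measurable

lemma elementary_summand: "elementary {0..} (summand i)"
  unfolding summand_def[abs_def]
  by (intro elementary_cmult elementary.base fin_supp_ind_exp) (auto simp: ind_exp_def)

lemma sigma_square_series: "AE \<omega> in M. (\<sigma> t \<omega>)\<^sup>2 = (\<Sum>i. summand i t \<omega>)"
proof -
  have "(\<Prod>j<i. \<alpha>1 * (\<epsilon> (t - 1 - int j) \<omega>)\<^sup>2) * (\<alpha>0 + l1 * L (t - 1 - int i) \<omega>) = summand i t \<omega>" for i \<omega>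
  proof -
    have img: "{- int i..-1} = (\<lambda>j. - 1 - int j) ` {..<i}"
    proof (intro set_eqI iffI)
      fix x assume "x \<in> {- int i..-1}"
      then show "x \<in> (\<lambda>j. - 1 - int j) ` {..<i}"
        by (intro image_eqI[of _ _ "nat (- 1 - x)"]) auto
    qed auto
    show ?thesis
      unfolding summand_def eps_mon_ind_exp img
      by (subst prod.reindex) (auto simp: inj_on_def prod.distrib algebra_simps)
  qed
  then show ?thesis using sigma_series[of "t - 1"] by simp
qed

lemma eps_square_summand:
  "(\<epsilon> t \<omega>)\<^sup>2 * summand i t \<omega> = \<alpha>1 ^ i *
     (eps_mon (shift_exp t (ind_exp (insert 0 {- int i..-1}))) \<omega> * (\<alpha>0 + l1 * L (t + (- 1 - int i)) \<omega>))"
  by (simp add: summand_def eps_mon_ind_exp mult_ac)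

lemma summand_second_moment:
  "integrable M (\<lambda>\<omega>. (summand i t \<omega>)\<^sup>2)"
  "(\<integral>\<omega>. (summand i t \<omega>)\<^sup>2 \<partial>M) = affine_L_square \<alpha>0 l1 * (rate\<^sup>2) ^ i"
  "integrable M (\<lambda>\<omega>. ((\<epsilon> t \<omega>)\<^sup>2 * summand i t \<omega>)\<^sup>2)"
  "(\<integral>\<omega>. ((\<epsilon> t \<omega>)\<^sup>2 * summand i t \<omega>)\<^sup>2 \<partial>M) = eps_moment 2 * affine_L_square \<alpha>0 l1 * (rate\<^sup>2) ^ i"
proof -
  \<comment> \<open>A window of \<open>i\<close> innovations carries \<open>i\<close> fourth
    moments, one for each factor \<open>\<alpha>1\<^sup>2\<close>; once the innovation at time
    \<open>t\<close> is included, one fourth moment is left over as a constant factor.\<close>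
  have pow: "(\<alpha>1 ^ i)\<^sup>2 * eps_moment 2 ^ i = (rate\<^sup>2) ^ i"
    by (simp add: rate(3) power_mult_distrib flip: power_mult) (simp add: mult.commute)
  show "integrable M (\<lambda>\<omega>. (summand i t \<omega>)\<^sup>2)"
    unfolding summand_def by (rule second_moment_ind_exp(1)) simp
  show "integrable M (\<lambda>\<omega>. ((\<epsilon> t \<omega>)\<^sup>2 * summand i t \<omega>)\<^sup>2)"
    unfolding eps_square_summand by (rule second_moment_ind_exp(1)) simp
  show "(\<integral>\<omega>. (summand i t \<omega>)\<^sup>2 \<partial>M) = affine_L_square \<alpha>0 l1 * (rate\<^sup>2) ^ i"
    unfolding summand_def by (subst second_moment_ind_exp(2)) (auto simp flip: pow)
  show "(\<integral>\<omega>. ((\<epsilon> t \<omega>)\<^sup>2 * summand i t \<omega>)\<^sup>2 \<partial>M) = eps_moment 2 * affine_L_square \<alpha>0 l1 * (rate\<^sup>2) ^ i"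
    unfolding eps_square_summand by (subst second_moment_ind_exp(2)) (auto simp flip: pow)
qed

abbreviation S2 :: "int \<Rightarrow> 'w \<Rightarrow> real" where "S2 \<equiv> \<lambda>t \<omega>. (\<sigma> t \<omega>)\<^sup>2"
abbreviation X2 :: "int \<Rightarrow> 'w \<Rightarrow> real" where "X2 \<equiv> \<lambda>t \<omega>. (X t \<omega>)\<^sup>2"

text \<open>Almost sure convergence is what permits \<epsilon>_t^2 to move inside the sum in
  \<open>X2_series\<close>. The limit in the general lemma is instantiated with a constant, since
  only convergence is extracted.\<close>

lemma summable_summand: "AE \<omega> in M. summable (\<lambda>i. summand i t \<omega>)"
  by (rule L2_geometric_series(1)[OF _ borel_measurable_const _ _ rate(1,2), of "\<lambda>i. summand i t" "affine_L_square \<alpha>0 l1"])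
    (simp_all add: summand_second_moment)

lemma X2_series: "AE \<omega> in M. X2 t \<omega> = (\<Sum>i. (\<epsilon> t \<omega>)\<^sup>2 * summand i t \<omega>)"
  using X_eq[of t] sigma_square_series[of t] summable_summand[of t]
  by eventually_elim (simp add: suminf_mult power_mult_distrib mult.commute)

text \<open>Both series are cut at the same index, so \<epsilon>_t^2 times the approximant of
  \<sigma>_t^2 is the approximant of X_t^2, as \<open>expectation_eps_square_product\<close>
  demands.\<close>

lemma joint_approximation:
  assumes "\<delta> > 0"
  shows "\<exists>U. elementary {0..} U \<and> L2_close \<delta> S2 U \<and> L2_close \<delta> X2 (\<lambda>t \<omega>. (\<epsilon> t \<omega>)\<^sup>2 * U t \<omega>)"
proof -
  \<comment> \<open>\<open>C\<close> and \<open>D\<close> are the constants of the geometric tail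
    bound for \<open>X2\<close> and for \<open>S2\<close>.\<close>
  define C where "C = eps_moment 2 * affine_L_square \<alpha>0 l1 / (1 - rate)\<^sup>2"
  define D where "D = affine_L_square \<alpha>0 l1 / (1 - rate)\<^sup>2"
  have "(\<lambda>m. C * rate ^ m) \<longlonglongrightarrow> 0" "(\<lambda>m. D * rate ^ m) \<longlonglongrightarrow> 0"
    using rate by (auto intro!: tendsto_mult_right_zero LIMSEQ_power_zero)
  then have "\<forall>\<^sub>F m in sequentially. C * rate ^ m < \<delta>" "\<forall>\<^sub>F m in sequentially. D * rate ^ m < \<delta>"
    using assms by (auto dest: order_tendstoD(2))
  then have "\<forall>\<^sub>F m in sequentially. C * rate ^ m < \<delta> \<and> D * rate ^ m < \<delta>"
    by (rule eventually_conj)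
  then obtain m where m: "C * rate ^ m < \<delta>" "D * rate ^ m < \<delta>"
    using eventually_happens[of _ sequentially] by auto
  define U where "U t \<omega> = (\<Sum>i<m. summand i t \<omega>)" for t \<omega>
  have S: "integrable M (\<lambda>\<omega>. (S2 t \<omega> - U t \<omega>)\<^sup>2) \<and> (\<integral>\<omega>. (S2 t \<omega> - U t \<omega>)\<^sup>2 \<partial>M) \<le> D * rate ^ m" for t
    unfolding U_def D_def
    by (rule L2_geometric_series(2)[OF _ _ _ _ rate(1,2) sigma_square_series])
      (simp_all add: summand_second_moment)
  have Y: "integrable M (\<lambda>\<omega>. (X2 t \<omega> - (\<epsilon> t \<omega>)\<^sup>2 * U t \<omega>)\<^sup>2) \<and>
      (\<integral>\<omega>. (X2 t \<omega> - (\<epsilon> t \<omega>)\<^sup>2 * U t \<omega>)\<^sup>2 \<partial>M) \<le> C * rate ^ m" for t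
    unfolding U_def sum_distrib_left C_def
    by (rule L2_geometric_series(2)[OF _ _ _ _ rate(1,2) X2_series])
      (simp_all add: summand_second_moment)
  have "elementary {0..} U"
    unfolding U_def[abs_def] by (rule elementary_sum) (rule elementary_summand)
  moreover have "L2_close \<delta> S2 U" "L2_close \<delta> X2 (\<lambda>t \<omega>. (\<epsilon> t \<omega>)\<^sup>2 * U t \<omega>)"
    unfolding L2_close_def using S Y m by (meson less_imp_le order_trans)+
  ultimately show ?thesis by blast
qed

lemma approximable_S2: "approximable {0} S2"
  unfolding approximable_def
proof (intro conjI allI impI)
  fix \<delta> :: real assume "\<delta> > 0"
  then obtain U where "elementary {0..} U" "L2_close \<delta> S2 U" using joint_approximation by blast
  then show "\<exists>U. elementary {0} U \<and> L2_close \<delta> S2 U"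
    using elementary_mono[of "{0..}" U "{0}"] by auto
qed simp

lemma approximable_X2: "approximable {1..} X2"
  unfolding approximable_def
proof (intro conjI allI impI)
  fix \<delta> :: real assume "\<delta> > 0"
  then obtain U where U: "elementary {0..} U" "L2_close \<delta> X2 (\<lambda>t \<omega>. (\<epsilon> t \<omega>)\<^sup>2 * U t \<omega>)"
    using joint_approximation by blast
  have "elementary ({0..} - {0}) (\<lambda>t \<omega>. (\<epsilon> t \<omega>)\<^sup>2 * U t \<omega>)"
    using U(1) by (rule elementary_eps_square) simp
  then have "elementary {1..} (\<lambda>t \<omega>. (\<epsilon> t \<omega>)\<^sup>2 * U t \<omega>)"
    by (rule elementary_mono) auto
  then show "\<exists>U. elementary {1..} U \<and> L2_close \<delta> X2 U" using U(2) by blast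
qed simp

lemma approximable_X2_shift: "approximable {} (\<lambda>t. X2 (t + k))"
  using approximable_shift[OF approximable_X2, of k] by (rule approximable_mono) simp

text \<open>X_t^2 avoids the innovations from time t + 1 on; moved at least one step into the past,
  it avoids the one at time \<open>t\<close>.\<close>

lemma approximable_X2_past: "k \<ge> 1 \<Longrightarrow> approximable {0} (\<lambda>t. X2 (t + - k))"
  using approximable_shift[OF approximable_X2, of "- k"]
  by (rule approximable_mono) (auto intro!: image_eqI[of _ _ k])

lemma approximable_L_shift: "approximable A (\<lambda>t. L (t + k))"
  using elementary_affine_L[of A 0 1 k] by (auto dest: elementary_imp_approximable)

lemma approximable_one: "approximable A (\<lambda>_ _. 1)"
  using elementary_affine_L[of A 1 0 0] by (auto dest: elementary_imp_approximable)

text \<open>Since \<open>W t\<close> avoids the innovation at time \<open>t\<close>, the factor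
  \<epsilon>_t^2 may be replaced by its mean one under the integral, and the recursion for
  \<sigma>_t^2 is inserted. \<open>W t\<close> need not be in the past: liquidity at any time
  qualifies.\<close>

lemma arch_recursion:
  assumes W: "approximable {0} W"
  shows "(\<integral>\<omega>. X2 t \<omega> * W t \<omega> \<partial>M) = \<alpha>0 * (\<integral>\<omega>. W t \<omega> \<partial>M) + \<alpha>1 * (\<integral>\<omega>. X2 (t - 1) \<omega> * W t \<omega> \<partial>M)
    + l1 * (\<integral>\<omega>. L (t - 1) \<omega> * W t \<omega> \<partial>M)"
proof -
  note [measurable] = approximable_measurable[OF W]
  have i: "integrable M (W t)" "integrable M (\<lambda>\<omega>. X2 (t - 1) \<omega> * W t \<omega>)" "integrable M (\<lambda>\<omega>. L (t - 1) \<omega> * W t \<omega>)"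
    using approximable_product_integrable[OF approximable_one[of "{}"] W, of t]
      approximable_product_integrable[OF approximable_X2 W, of "t - 1" t]
      approximable_product_integrable[OF approximable_L_shift[of "{}" 0] W, of "t - 1" t] by simp_all
  have "(\<integral>\<omega>. X2 t \<omega> * W t \<omega> \<partial>M) = (\<integral>\<omega>. S2 t \<omega> * W t \<omega> \<partial>M)"
  proof (rule expectation_eps_square_product[OF approximable_S2 _ _ W])
    show "approximable {} X2" using approximable_X2 by (rule approximable_mono) simp
    fix \<delta> :: real assume "\<delta> > 0"
    then obtain U where U: "elementary {0..} U" "L2_close \<delta> S2 U" "L2_close \<delta> X2 (\<lambda>t \<omega>. (\<epsilon> t \<omega>)\<^sup>2 * U t \<omega>)"
      using joint_approximation by blast
    then have "elementary {0} U" using elementary_mono[of "{0..}" U "{0}"] by auto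
    then show "\<exists>U. elementary {0} U \<and> L2_close \<delta> S2 U \<and> L2_close \<delta> X2 (\<lambda>t \<omega>. (\<epsilon> t \<omega>)\<^sup>2 * U t \<omega>)"
      using U by blast
  qed
  also have "\<dots> = (\<integral>\<omega>. \<alpha>0 * W t \<omega> + \<alpha>1 * (X2 (t - 1) \<omega> * W t \<omega>) + l1 * (L (t - 1) \<omega> * W t \<omega>) \<partial>M)"
  proof (rule integral_cong_AE)
    show "AE \<omega> in M. S2 t \<omega> * W t \<omega> = \<alpha>0 * W t \<omega> + \<alpha>1 * (X2 (t - 1) \<omega> * W t \<omega>) + l1 * (L (t - 1) \<omega> * W t \<omega>)"
      using sigma_rec[of t] by eventually_elim (simp add: algebra_simps)
  qed measurable
  also have "\<dots> = \<alpha>0 * (\<integral>\<omega>. W t \<omega> \<partial>M) + \<alpha>1 * (\<integral>\<omega>. X2 (t - 1) \<omega> * W t \<omega> \<partial>M)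
    + l1 * (\<integral>\<omega>. L (t - 1) \<omega> * W t \<omega> \<partial>M)"
    using i by simp
  finally show ?thesis .
qed

section \<open>Moment equations for the autocovariances\<close>

definition mean_X2 :: real where "mean_X2 = (\<integral>\<omega>. X2 0 \<omega> \<partial>M)"

lemma L1_lln_X2: "L1_lln M X2 mean_X2"
  using L1_lln_approximable_product[OF approximable_X2 approximable_one] by (simp add: mean_X2_def)

lemma L1_lln_X2_X2: "L1_lln M (\<lambda>t \<omega>. X2 t \<omega> * X2 (t + k) \<omega>) (\<integral>\<omega>. X2 0 \<omega> * X2 k \<omega> \<partial>M)"
  using L1_lln_approximable_product[OF approximable_X2 approximable_X2_shift[of k]] by simp

text \<open>The means in the law of large numbers for products are constant in time.\<close>

lemma expectation_X2_X2: "(\<integral>\<omega>. X2 (t + h) \<omega> * X2 (s + h) \<omega> \<partial>M) = (\<integral>\<omega>. X2 t \<omega> * X2 s \<omega> \<partial>M)"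
  using L1_llnD_const[OF L1_lln_X2_X2[of "s - t"], of "t + h" t] by (simp add: algebra_simps)

lemma expectation_L_X2: "(\<integral>\<omega>. L (t + h) \<omega> * X2 (s + h) \<omega> \<partial>M) = (\<integral>\<omega>. L t \<omega> * X2 s \<omega> \<partial>M)"
  using L1_llnD_const[OF L1_lln_approximable_product[OF approximable_L_shift[of "{}" 0] approximable_X2_shift[of "s - t"]],
    of "t + h" t] by (simp add: algebra_simps)

lemma expectation_L: "(\<integral>\<omega>. L t \<omega> \<partial>M) = 1"
  using L_moments_stationary(2)[of t 1] mean_L by simp

lemma integrable_X2: "integrable M (X2 t)"
  using L1_llnD(1)[OF L1_lln_X2] .

lemma autocov_X2: "autocov M X2 k = (\<integral>\<omega>. X2 0 \<omega> * X2 k \<omega> \<partial>M) - mean_X2\<^sup>2"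
proof -
  have "integrable M (\<lambda>\<omega>. X2 0 \<omega> * X2 k \<omega>)"
    using L1_llnD(1)[OF L1_lln_X2_X2[of k], of 0] by simp
  then show ?thesis
    unfolding autocov_def cov_def using integrable_X2 L1_llnD(2)[OF L1_lln_X2]
    by (simp add: left_diff_distrib right_diff_distrib prob_space power2_eq_square)
qed

lemma autocov_X2_minus: "autocov M X2 (- k) = autocov M X2 k"
  using expectation_X2_X2[of "- k" k 0] by (simp add: autocov_X2 mult.commute)

lemma autocov_L: "autocov M L k = (\<integral>\<omega>. L 0 \<omega> * L k \<omega> \<partial>M) - 1"
  unfolding autocov_def cov_def using integrable_L integrable_LL[of 0 k]
  by (simp add: left_diff_distrib right_diff_distrib prob_space expectation_L)

lemma autocov_L_minus: "autocov M L (- k) = autocov M L k"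
  using L_moments_stationary(3)[of "- k" k 0] by (simp add: autocov_L mult.commute)

lemma mean_equation: "mean_X2 = \<alpha>0 + \<alpha>1 * mean_X2 + l1"
  using arch_recursion[OF approximable_one, of 0] L1_llnD(2)[OF L1_lln_X2]
  by (simp add: prob_space expectation_L)

text \<open>Testing the recursion against an earlier X^2 produces cross-covariances with the
  liquidity; testing it against \<open>L k\<close> turns these into covariances of the
  liquidity.\<close>

lemma autocov_quadratic_pos:
  assumes "k \<ge> 1"
  shows "\<alpha>1\<^sup>2 * autocov M X2 k - \<alpha>1 * (autocov M X2 (k + 1) + autocov M X2 (k - 1)) + autocov M X2 k
    = l1\<^sup>2 * autocov M L k"
proof -
  \<comment> \<open>This is the covariance of \<open>L k\<close> and \<open>X2 0\<close>, because
    the liquidity has mean one.\<close>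
  define h where "h k = (\<integral>\<omega>. L k \<omega> * X2 0 \<omega> \<partial>M) - mean_X2" for k
  have X2_step: "autocov M X2 k = \<alpha>1 * autocov M X2 (k - 1) + l1 * h (k - 1)" if "k \<ge> 1" for k
  proof -
    have "(\<integral>\<omega>. X2 0 \<omega> * X2 (- k) \<omega> \<partial>M) = \<alpha>0 * mean_X2 + \<alpha>1 * (\<integral>\<omega>. X2 (- 1) \<omega> * X2 (- k) \<omega> \<partial>M)
        + l1 * (\<integral>\<omega>. L (- 1) \<omega> * X2 (- k) \<omega> \<partial>M)"
      using arch_recursion[OF approximable_X2_past[OF that], of 0] L1_llnD(2)[OF L1_lln_X2] by simp
    moreover have "(\<integral>\<omega>. X2 0 \<omega> * X2 (- k) \<omega> \<partial>M) = autocov M X2 k + mean_X2\<^sup>2"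
      using autocov_X2[of "- k"] by (simp add: autocov_X2_minus)
    moreover have "(\<integral>\<omega>. X2 (- 1) \<omega> * X2 (- k) \<omega> \<partial>M) = autocov M X2 (k - 1) + mean_X2\<^sup>2"
      using expectation_X2_X2[of "- k" k "- 1"] autocov_X2[of "k - 1"] by (simp add: mult.commute)
    moreover have "(\<integral>\<omega>. L (- 1) \<omega> * X2 (- k) \<omega> \<partial>M) = h (k - 1) + mean_X2"
      using expectation_L_X2[of "- 1" k "- k"] by (simp add: h_def)
    \<comment> \<open>The last summand collects the products of means; the mean equation makes it
      vanish.\<close>
    ultimately have "autocov M X2 k = \<alpha>1 * autocov M X2 (k - 1) + l1 * h (k - 1)
        + mean_X2 * (\<alpha>0 + \<alpha>1 * mean_X2 + l1 - mean_X2)"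
      by (simp add: algebra_simps power2_eq_square)
    then show ?thesis using mean_equation by simp
  qed
  have h_step: "h k = \<alpha>1 * h (k + 1) + l1 * autocov M L (k + 1)" for k
  proof -
    have "(\<integral>\<omega>. X2 0 \<omega> * L k \<omega> \<partial>M) = \<alpha>0 + \<alpha>1 * (\<integral>\<omega>. X2 (- 1) \<omega> * L k \<omega> \<partial>M)
        + l1 * (\<integral>\<omega>. L (- 1) \<omega> * L k \<omega> \<partial>M)"
      using arch_recursion[OF approximable_L_shift, of 0 k] by (simp add: expectation_L)
    moreover have "(\<integral>\<omega>. X2 (- 1) \<omega> * L k \<omega> \<partial>M) = h (k + 1) + mean_X2"
      using expectation_L_X2[of k 1 "- 1"] by (simp add: h_def mult.commute)
    moreover have "(\<integral>\<omega>. L (- 1) \<omega> * L k \<omega> \<partial>M) = autocov M L (k + 1) + 1"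
      using L_moments_stationary(3)[of "- 1" 1 k] by (simp add: autocov_L)
    moreover have "(\<integral>\<omega>. X2 0 \<omega> * L k \<omega> \<partial>M) = h k + mean_X2" by (simp add: h_def mult.commute)
    ultimately show ?thesis using mean_equation by (simp add: algebra_simps)
  qed
  \<comment> \<open>Grouped so that \<open>X2_step\<close> applies at \<open>k\<close> and at
    \<open>k + 1\<close>; the difference of \<open>h\<close> values that remains is given by
    \<open>h_step\<close> at \<open>k - 1\<close>.\<close>
  have "\<alpha>1\<^sup>2 * autocov M X2 k - \<alpha>1 * (autocov M X2 (k + 1) + autocov M X2 (k - 1)) + autocov M X2 k
    = (autocov M X2 k - \<alpha>1 * autocov M X2 (k - 1)) - \<alpha>1 * (autocov M X2 (k + 1) - \<alpha>1 * autocov M X2 k)"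
    by (simp add: algebra_simps power2_eq_square)
  also have "\<dots> = l1 * (h (k - 1) - \<alpha>1 * h k)"
    using X2_step[of k] X2_step[of "k + 1"] assms by (simp add: algebra_simps)
  also have "\<dots> = l1\<^sup>2 * autocov M L k"
    using h_step[of "k - 1"] by (simp add: power2_eq_square)
  finally show ?thesis .
qed

text \<open>Negative lags follow because both autocovariances are even. Lag 0 is excluded: X_0^2
  itself contains the innovation at time 0, so the recursion cannot be tested against it.\<close>

lemma autocov_quadratic:
  assumes "k \<noteq> 0"
  shows "\<alpha>1\<^sup>2 * autocov M X2 k - \<alpha>1 * (autocov M X2 (k + 1) + autocov M X2 (k - 1)) + autocov M X2 k
    = l1\<^sup>2 * autocov M L k"
proof (cases "k \<ge> 1")
  case False
  have "- k + 1 = - (k - 1)" "- k - 1 = - (k + 1)" by simp_all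
  then show ?thesis
    using autocov_quadratic_pos[of "- k"] assms False
    by (simp only: autocov_X2_minus autocov_L_minus) (simp add: add.commute)
qed (rule autocov_quadratic_pos)

end

section \<open>Convergence in probability\<close>

text \<open>The principal root jumps across the negative real axis, so measurability is read off
  from a formula by real square roots. \<open>conv_in_prob\<close> demands it of the
  estimators.\<close>

lemma csqrt_measurable [measurable]: "csqrt \<in> borel_measurable borel"
proof -
  have "csqrt z = complex_of_real (sqrt ((cmod z + Re z) / 2))
      + \<i> * complex_of_real ((if Im z < 0 then - 1 else 1) * sqrt ((cmod z - Re z) / 2))" for z
    by (simp add: complex_eq_iff sgn_if)
  then have "csqrt = (\<lambda>z. complex_of_real (sqrt ((cmod z + Re z) / 2))
      + \<i> * complex_of_real ((if Im z < 0 then - 1 else 1) * sqrt ((cmod z - Re z) / 2)))" by blast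
  moreover have "\<dots> \<in> borel_measurable borel" by measurable
  ultimately show ?thesis by simp
qed

text \<open>Near \<open>c\<close> the function \<open>a\<close> does not vanish, so the default
  value \<open>d\<close> is invisible there.\<close>

lemma isCont_if_nonzero:
  fixes a :: "'a::t2_space \<Rightarrow> real" and g :: "'a \<Rightarrow> 'b::topological_space"
  assumes a: "isCont a c" "a c \<noteq> 0" and g: "isCont g c"
  shows "isCont (\<lambda>v. if a v = 0 then d else g v) c"
proof -
  have "\<forall>\<^sub>F v in at c. a v \<noteq> 0"
    using a by (intro tendsto_imp_eventually_ne) (simp_all add: isCont_def)
  then have "\<forall>\<^sub>F v in at c. g v = (if a v = 0 then d else g v)"
    by eventually_elim simp
  with g a(2) show ?thesis
    unfolding isCont_def by (simp add: Lim_transform_eventually)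
qed

section \<open>Mapping rules for convergence in probability\<close>

lemma conv_in_probD:
  assumes "conv_in_prob M Y c"
  shows "Y N \<in> borel_measurable M"
    and "e > 0 \<Longrightarrow> (\<lambda>N. measure M {\<omega> \<in> space M. dist (Y N \<omega>) c > e}) \<longlonglongrightarrow> 0"
  using assms by (simp_all add: conv_in_prob_def)

text \<open>Continuity is assumed at the limit only, since the estimators may be discontinuous where
  the denominator vanishes or the root meets its branch cut; measurability of the composition is
  therefore a separate hypothesis.\<close>

lemma conv_in_prob_isCont:
  assumes Y: "conv_in_prob M Y c" and f: "isCont f c" and meas: "\<And>N. (\<lambda>\<omega>. f (Y N \<omega>)) \<in> borel_measurable M"
    and "prob_space M"
  shows "conv_in_prob M (\<lambda>N \<omega>. f (Y N \<omega>)) (f c)"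
  unfolding conv_in_prob_def
proof (intro conjI allI impI meas)
  interpret prob_space M by fact
  fix e :: real assume "e > 0"
  then obtain d where d: "d > 0" "\<And>x. dist x c < d \<Longrightarrow> dist (f x) (f c) < e"
    using f unfolding continuous_at_eps_delta by blast
  have [measurable]: "Y N \<in> borel_measurable M" for N using Y by (simp add: conv_in_prob_def)
  \<comment> \<open>A deviation above \<open>e\<close> forces
    \<open>dist (Y N \<omega>) c \<ge> d\<close>; halving \<open>d\<close> gives the strict
    inequality of the definition.\<close>
  have "(\<lambda>N. measure M {\<omega> \<in> space M. dist (Y N \<omega>) c > d / 2}) \<longlonglongrightarrow> 0"
    using Y d(1) by (intro conv_in_probD(2)) simp_all
  then show "(\<lambda>N. measure M {\<omega> \<in> space M. dist (f (Y N \<omega>)) (f c) > e}) \<longlonglongrightarrow> 0"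
  proof (rule tendsto_sandwich[OF _ _ tendsto_const, rotated 2])
    show "\<forall>\<^sub>F N in sequentially. measure M {\<omega> \<in> space M. dist (f (Y N \<omega>)) (f c) > e}
        \<le> measure M {\<omega> \<in> space M. dist (Y N \<omega>) c > d / 2}"
    proof (intro always_eventually allI finite_measure_mono)
      fix N
      show "{\<omega> \<in> space M. dist (f (Y N \<omega>)) (f c) > e} \<subseteq> {\<omega> \<in> space M. dist (Y N \<omega>) c > d / 2}"
        using d by (smt (verit) Collect_mono field_sum_of_halves)
    qed measurable
  qed simp
qed

lemma conv_in_prob_Pair:
  assumes Y: "conv_in_prob M Y c" and Z: "conv_in_prob M Z c'" and "prob_space M"
  shows "conv_in_prob M (\<lambda>N \<omega>. (Y N \<omega>, Z N \<omega>)) (c, c')"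
  unfolding conv_in_prob_def
proof (intro conjI allI impI)
  interpret prob_space M by fact
  have [measurable]: "Y N \<in> borel_measurable M" "Z N \<in> borel_measurable M" for N
    using Y Z by (simp_all add: conv_in_prob_def)
  show "(\<lambda>\<omega>. (Y N \<omega>, Z N \<omega>)) \<in> borel_measurable M" for N by measurable
  fix e :: real assume e: "e > 0"
  have lim: "(\<lambda>N. measure M {\<omega> \<in> space M. dist (Y N \<omega>) c > e / 2}
      + measure M {\<omega> \<in> space M. dist (Z N \<omega>) c' > e / 2}) \<longlonglongrightarrow> 0"
    using tendsto_add[OF conv_in_probD(2)[OF Y] conv_in_probD(2)[OF Z], of "e / 2" "e / 2"] e by simp
  show "(\<lambda>N. measure M {\<omega> \<in> space M. dist (Y N \<omega>, Z N \<omega>) (c, c') > e}) \<longlonglongrightarrow> 0"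
  proof (rule tendsto_sandwich[OF _ _ tendsto_const lim])
    show "\<forall>\<^sub>F N in sequentially. measure M {\<omega> \<in> space M. dist (Y N \<omega>, Z N \<omega>) (c, c') > e}
        \<le> measure M {\<omega> \<in> space M. dist (Y N \<omega>) c > e / 2} + measure M {\<omega> \<in> space M. dist (Z N \<omega>) c' > e / 2}"
    proof (intro always_eventually allI)
      fix N
      have "dist (y, z) (c, c') \<le> dist y c + dist z c'" for y z
        unfolding dist_Pair_Pair by (simp add: sqrt_sum_squares_le_sum)
      then have sub: "{\<omega> \<in> space M. dist (Y N \<omega>, Z N \<omega>) (c, c') > e}
        \<subseteq> {\<omega> \<in> space M. dist (Y N \<omega>) c > e / 2} \<union> {\<omega> \<in> space M. dist (Z N \<omega>) c' > e / 2}"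
        by (smt (verit) Collect_mono UnCI field_sum_of_halves mem_Collect_eq subsetI)
      have "measure M {\<omega> \<in> space M. dist (Y N \<omega>, Z N \<omega>) (c, c') > e}
        \<le> measure M ({\<omega> \<in> space M. dist (Y N \<omega>) c > e / 2} \<union> {\<omega> \<in> space M. dist (Z N \<omega>) c' > e / 2})"
        by (rule finite_measure_mono[OF sub]) measurable
      also have "\<dots> \<le> measure M {\<omega> \<in> space M. dist (Y N \<omega>) c > e / 2}
          + measure M {\<omega> \<in> space M. dist (Z N \<omega>) c' > e / 2}"
        by (rule measure_Un_le) measurable
      finally show "measure M {\<omega> \<in> space M. dist (Y N \<omega>, Z N \<omega>) (c, c') > e}
        \<le> measure M {\<omega> \<in> space M. dist (Y N \<omega>) c > e / 2} + measure M {\<omega> \<in> space M. dist (Z N \<omega>) c' > e / 2}" .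
    qed
  qed simp
qed

text \<open>Markov's inequality; here the laws in L1 become statements in probability.\<close>

lemma conv_in_prob_L1:
  fixes Y :: "nat \<Rightarrow> 'w \<Rightarrow> real"
  assumes int: "\<And>N. integrable M (Y N)" and lim: "(\<lambda>N. \<integral>\<omega>. \<bar>Y N \<omega> - c\<bar> \<partial>M) \<longlonglongrightarrow> 0"
    and "prob_space M"
  shows "conv_in_prob M Y c"
  unfolding conv_in_prob_def
proof (intro conjI allI impI)
  interpret prob_space M by fact
  show [measurable]: "Y N \<in> borel_measurable M" for N using int by simp
  fix e :: real assume e: "e > 0"
  have lim': "(\<lambda>N. (\<integral>\<omega>. \<bar>Y N \<omega> - c\<bar> \<partial>M) / e) \<longlonglongrightarrow> 0"
    using tendsto_divide[OF lim tendsto_const[of e]] e by simp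
  show "(\<lambda>N. measure M {\<omega> \<in> space M. dist (Y N \<omega>) c > e}) \<longlonglongrightarrow> 0"
  proof (rule tendsto_sandwich[OF _ _ tendsto_const lim'])
    show "\<forall>\<^sub>F N in sequentially. measure M {\<omega> \<in> space M. dist (Y N \<omega>) c > e} \<le> (\<integral>\<omega>. \<bar>Y N \<omega> - c\<bar> \<partial>M) / e"
    proof (intro always_eventually allI)
      fix N
      have "measure M {\<omega> \<in> space M. dist (Y N \<omega>) c > e} \<le> measure M {\<omega> \<in> space M. \<bar>Y N \<omega> - c\<bar> \<ge> e}"
        by (intro finite_measure_mono) (auto simp: dist_real_def)
      also have "\<dots> \<le> (\<integral>\<omega>. \<bar>Y N \<omega> - c\<bar> \<partial>M) / e"
        using int e by (intro integral_Markov_inequality_measure[where A = "{}"]) auto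
      finally show "measure M {\<omega> \<in> space M. dist (Y N \<omega>) c > e} \<le> (\<integral>\<omega>. \<bar>Y N \<omega> - c\<bar> \<partial>M) / e" .
    qed
  qed simp
qed

text \<open>A sum of \<open>N - k\<close> terms is divided by \<open>N\<close>. With n = N - k and A
  the error of the genuine average of n terms, the error is (n / N) A - k z / N, and both parts
  vanish.\<close>

lemma conv_in_prob_truncated_average:
  assumes Z: "L1_lln M Z z" and "prob_space M" and k: "k \<ge> 0"
  shows "conv_in_prob M (\<lambda>N \<omega>. (1 / real N) * (\<Sum>t\<in>{1..int N - k}. Z t \<omega>)) z"
proof (rule conv_in_prob_L1)
  interpret prob_space M by fact
  note ZD = L1_llnD[OF Z]
  show "integrable M (\<lambda>\<omega>. (1 / real N) * (\<Sum>t\<in>{1..int N - k}. Z t \<omega>))" for N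
    using ZD(1) by simp
  define e where "e n = (\<integral>\<omega>. \<bar>(\<Sum>i<n. Z (1 + int i) \<omega>) / real n - z\<bar> \<partial>M)" for n
  have "(\<lambda>N. e (N - nat k)) \<longlonglongrightarrow> 0"
    using filterlim_compose[OF ZD(3)[of 1] filterlim_minus_const_nat_at_top[of "nat k"]]
    by (simp add: e_def)
  moreover have "(\<lambda>N. real_of_int k * \<bar>z\<bar> / real N) \<longlonglongrightarrow> 0"
    by (rule lim_const_over_n)
  ultimately have lim: "(\<lambda>N. e (N - nat k) + real_of_int k * \<bar>z\<bar> / real N) \<longlonglongrightarrow> 0"
    using tendsto_add by fastforce
  show "(\<lambda>N. \<integral>\<omega>. \<bar>(1 / real N) * (\<Sum>t\<in>{1..int N - k}. Z t \<omega>) - z\<bar> \<partial>M) \<longlonglongrightarrow> 0"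
  proof (rule tendsto_sandwich[OF _ _ tendsto_const lim])
    show "\<forall>\<^sub>F N in sequentially. (\<integral>\<omega>. \<bar>(1 / real N) * (\<Sum>t\<in>{1..int N - k}. Z t \<omega>) - z\<bar> \<partial>M)
        \<le> e (N - nat k) + real_of_int k * \<bar>z\<bar> / real N"
    proof (rule eventually_sequentiallyI[of "nat k + 1"])
      fix N assume N: "nat k + 1 \<le> N"
      define n where "n = N - nat k"
      have n: "n > 0" "real N = real n + real_of_int k" using N k by (auto simp: n_def)
      have img: "{1..int N - k} = (\<lambda>i. 1 + int i) ` {..<n}"
      proof (intro set_eqI iffI)
        fix x assume "x \<in> {1..int N - k}"
        then show "x \<in> (\<lambda>i. 1 + int i) ` {..<n}"
          using N k by (intro image_eqI[of _ _ "nat (x - 1)"]) (auto simp: n_def)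
      qed (use N k in \<open>auto simp: n_def\<close>)
      have sum: "(\<Sum>t\<in>{1..int N - k}. Z t \<omega>) = (\<Sum>i<n. Z (1 + int i) \<omega>)" for \<omega>
        unfolding img by (subst sum.reindex) (auto simp: inj_on_def)
      have pt: "\<bar>(1 / real N) * (\<Sum>t\<in>{1..int N - k}. Z t \<omega>) - z\<bar>
          \<le> \<bar>(\<Sum>i<n. Z (1 + int i) \<omega>) / real n - z\<bar> + real_of_int k * \<bar>z\<bar> / real N" for \<omega>
      proof -
        define A where "A = (\<Sum>i<n. Z (1 + int i) \<omega>) / real n - z"
        have NN: "real N > 0" using n k by simp
        have eq: "(1 / real N) * (\<Sum>t\<in>{1..int N - k}. Z t \<omega>) - z = real n / real N * A - real_of_int k * z / real N"
        proof -
          have "(\<Sum>i<n. Z (1 + int i) \<omega>) = real n * (A + z)" using n by (simp add: A_def)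
          then have "(1 / real N) * (\<Sum>t\<in>{1..int N - k}. Z t \<omega>) - z = (real n * (A + z) - real N * z) / real N"
            unfolding sum using NN by (simp add: field_simps)
          also have "real n * (A + z) - real N * z = real n * A - real_of_int k * z"
            unfolding n(2) by (simp add: algebra_simps)
          finally show ?thesis by (simp add: diff_divide_distrib)
        qed
        have b: "\<bar>real n / real N * A\<bar> \<le> 1 * \<bar>A\<bar>"
          unfolding abs_mult using n k NN by (intro mult_right_mono) auto
        have c: "\<bar>real_of_int k * z / real N\<bar> = real_of_int k * \<bar>z\<bar> / real N"
          using k by (simp add: abs_mult)
        show ?thesis
          unfolding eq A_def[symmetric]
          using order_trans[OF abs_triangle_ineq4 add_mono[OF b eq_refl[OF c]]] by simp
      qed
      have "(\<integral>\<omega>. \<bar>(1 / real N) * (\<Sum>t\<in>{1..int N - k}. Z t \<omega>) - z\<bar> \<partial>M)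
        \<le> (\<integral>\<omega>. \<bar>(\<Sum>i<n. Z (1 + int i) \<omega>) / real n - z\<bar> + real_of_int k * \<bar>z\<bar> / real N \<partial>M)"
        using ZD(1) pt by (intro integral_mono) auto
      also have "\<dots> = e n + real_of_int k * \<bar>z\<bar> / real N"
        using ZD(1) by (simp add: e_def prob_space)
      finally show "(\<integral>\<omega>. \<bar>(1 / real N) * (\<Sum>t\<in>{1..int N - k}. Z t \<omega>) - z\<bar> \<partial>M)
        \<le> e (N - nat k) + real_of_int k * \<bar>z\<bar> / real N" by (simp add: n_def)
    qed
  qed (auto simp: integral_nonneg_AE)
qed fact

section \<open>Coefficients of the quadratic equation and choice of its root\<close>

lemma a_coef_altdef: "a_coef s n1 n2 = (\<lambda>v. fst (snd (snd v)) - s n1 / s n2 * fst (snd (snd (snd v))))"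
  by (auto simp: a_coef_def fun_eq_iff)

lemma b_coef_altdef: "b_coef s n1 n2 = (\<lambda>v. s n1 / s n2 * (fst (snd v) + snd (snd (snd (snd (snd v)))))
    - (fst v + fst (snd (snd (snd (snd v))))))"
  by (auto simp: b_coef_def fun_eq_iff)

lemma isCont_coefs:
  "isCont (a_coef s n1 n2) v" "isCont (b_coef s n1 n2) v" "isCont (g_coef s n1 n2) v"
  unfolding g_coef_def[abs_def] a_coef_altdef b_coef_altdef by (intro continuous_intros)+

text \<open>Completing the square gives \<open>(2 * A * x + B)\<^sup>2 = 4 * A * (A * x\<^sup>2 + B
  * x + A) + G\<close>, so at a root \<open>2 * A * x + B\<close> is \<open>sqrt G\<close> or its
  negative; strict positivity of \<open>G\<close> makes the two cases exclusive.\<close>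

lemma correct_sign_unique:
  assumes a: "a_coef s n1 n2 v \<noteq> 0" and g: "g_coef s n1 n2 v > 0"
    and root: "a_coef s n1 n2 v * x\<^sup>2 + b_coef s n1 n2 v * x + a_coef s n1 n2 v = 0"
  shows "\<exists>!sg. correct_sign s n1 n2 v x sg"
proof -
  define A B G where "A = a_coef s n1 n2 v" and "B = b_coef s n1 n2 v" and "G = g_coef s n1 n2 v"
  have iff: "correct_sign s n1 n2 v x sg \<longleftrightarrow> sg \<in> {1, -1} \<and> 2 * A * x + B = sg * sqrt G" for sg
    using a unfolding correct_sign_def A_def[symmetric] B_def[symmetric] G_def[symmetric]
    by (auto simp: field_simps)
  have "(2 * A * x + B)\<^sup>2 = 4 * A * (A * x\<^sup>2 + B * x + A) + G"
    by (simp add: G_def g_coef_def A_def[symmetric] B_def[symmetric] power2_eq_square algebra_simps)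
  then have "(2 * A * x + B)\<^sup>2 = (sqrt G)\<^sup>2" using root g by (simp add: A_def B_def G_def)
  then have "2 * A * x + B = sqrt G \<or> 2 * A * x + B = - sqrt G" by (simp add: power2_eq_iff)
  moreover have "sqrt G > 0" using g by (simp add: G_def)
  ultimately show ?thesis
  proof (elim disjE)
    assume "2 * A * x + B = sqrt G" "sqrt G > 0"
    then show ?thesis unfolding iff by (intro ex1I[of _ 1]) auto
  next
    assume "2 * A * x + B = - sqrt G" "sqrt G > 0"
    then show ?thesis unfolding iff by (intro ex1I[of _ "- 1"]) auto
  qed
qed

section \<open>Consistency of the sample moments and of the estimators\<close>

context liquidity_arch
begin

lemma sample_mean_measurable [measurable]: "sample_mean X2 N \<in> borel_measurable M"
  unfolding sample_mean_def[abs_def] by measurable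

lemma sample_autocov_measurable [measurable]: "(\<lambda>\<omega>. sample_autocov X2 N \<omega> k) \<in> borel_measurable M"
  unfolding sample_autocov_def by measurable

lemma sample_mean_consistent: "conv_in_prob M (sample_mean X2) mean_X2"
  using conv_in_prob_truncated_average[OF L1_lln_X2 prob_space_axioms, of 0]
  by (simp add: sample_mean_def[abs_def])

text \<open>Expanding the product around the sample mean leaves a polynomial in four averages, each
  covered by a law of large numbers.\<close>

lemma sample_autocov_consistent:
  "conv_in_prob M (\<lambda>N \<omega>. sample_autocov X2 N \<omega> k) (autocov M X2 k)"
proof -
  define K where "K = \<bar>k\<bar>"
  have K: "K \<ge> 0" by (simp add: K_def)
  define T where "T Z N \<omega> = (1 / real N) * (\<Sum>t\<in>{1..int N - K}. Z t \<omega>)" for Z :: "int \<Rightarrow> 'w \<Rightarrow> real" and N \<omega>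
  have T: "conv_in_prob M (T Z) z" if "L1_lln M Z z" for Z z
    using conv_in_prob_truncated_average[OF that prob_space_axioms K] by (simp add: T_def[abs_def])
  define YY where "YY t \<omega> = X2 t \<omega> * X2 (t + K) \<omega>" for t \<omega>
  define YS where "YS t \<omega> = X2 t \<omega> + X2 (t + K) \<omega>" for t \<omega>
  \<comment> \<open>For large N the truncated average of the constant 1 is (N - K) / N; as a process
    it gets its limit 1 from the same lemma as the others.\<close>
  define one where "one t \<omega> = (1::real)" for t :: int and \<omega> :: 'w
  define f where "f = (\<lambda>(p, q, r, m). p - m * q + m * m * (r::real))"
  have lYY: "L1_lln M YY (\<integral>\<omega>. X2 0 \<omega> * X2 K \<omega> \<partial>M)"
    using L1_lln_X2_X2[of K] by (simp add: YY_def[abs_def])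
  have "L1_lln M (\<lambda>t. X2 (t + K)) (\<integral>\<omega>. X2 K \<omega> \<partial>M)"
    using L1_lln_approximable_product[OF approximable_X2_shift[of K] approximable_one] by simp
  from L1_lln_add[OF L1_lln_X2 this] have lYS: "L1_lln M YS (mean_X2 + mean_X2)"
    using L1_llnD(2)[OF L1_lln_X2, of K] by (simp add: YS_def[abs_def])
  have lone: "L1_lln M one 1" using L1_lln_const by (simp add: one_def[abs_def])
  have split: "sample_autocov X2 N \<omega> k = f (T YY N \<omega>, T YS N \<omega>, T one N \<omega>, sample_mean X2 N \<omega>)" for N \<omega>
  proof -
    let ?m = "sample_mean X2 N \<omega>"
    have eq: "(X2 t \<omega> - ?m) * (X2 (t + K) \<omega> - ?m) = YY t \<omega> - ?m * YS t \<omega> + ?m * ?m * one t \<omega>" for t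
      by (simp add: YY_def YS_def one_def algebra_simps)
    show ?thesis
      unfolding sample_autocov_def K_def[symmetric] eq sum.distrib sum_subtractf sum_distrib_left[symmetric]
      by (simp add: f_def T_def diff_divide_distrib add_divide_distrib)
  qed
  have cf: "isCont f c" for c
  proof -
    have "f = (\<lambda>v. fst v - snd (snd (snd v)) * fst (snd v)
        + snd (snd (snd v)) * snd (snd (snd v)) * fst (snd (snd v)))"
      by (auto simp: f_def fun_eq_iff)
    then show ?thesis by (auto intro!: continuous_intros)
  qed
  have "conv_in_prob M (\<lambda>N \<omega>. f (T YY N \<omega>, T YS N \<omega>, T one N \<omega>, sample_mean X2 N \<omega>))
      (f ((\<integral>\<omega>. X2 0 \<omega> * X2 K \<omega> \<partial>M), mean_X2 + mean_X2, 1, mean_X2))"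
  proof (rule conv_in_prob_isCont[OF _ cf _ prob_space_axioms])
    show "conv_in_prob M (\<lambda>N \<omega>. (T YY N \<omega>, T YS N \<omega>, T one N \<omega>, sample_mean X2 N \<omega>))
      ((\<integral>\<omega>. X2 0 \<omega> * X2 K \<omega> \<partial>M), mean_X2 + mean_X2, 1, mean_X2)"
      using T lYY lYS lone sample_mean_consistent by (intro conv_in_prob_Pair prob_space_axioms) blast+
    show "(\<lambda>\<omega>. f (T YY N \<omega>, T YS N \<omega>, T one N \<omega>, sample_mean X2 N \<omega>)) \<in> borel_measurable M" for N
      unfolding split[symmetric] by measurable
  qed
  moreover have "f ((\<integral>\<omega>. X2 0 \<omega> * X2 K \<omega> \<partial>M), mean_X2 + mean_X2, 1, mean_X2) = autocov M X2 K"
    by (simp add: f_def autocov_X2 power2_eq_square[of mean_X2] algebra_simps)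
  moreover have "autocov M X2 K = autocov M X2 k"
    by (cases "k \<ge> 0") (simp_all add: K_def autocov_X2_minus)
  ultimately show ?thesis by (simp add: split)
qed

lemma sample_gamma_vec_consistent:
  "conv_in_prob M (\<lambda>N \<omega>. gamma_vec (sample_autocov X2 N \<omega>) n1 n2) (gamma_vec (autocov M X2) n1 n2)"
  unfolding gamma_vec_def
  by (intro conv_in_prob_Pair sample_autocov_consistent prob_space_axioms)

lemma quadratic_equation:
  fixes n1 n2 :: int
  defines "\<gamma> \<equiv> gamma_vec (autocov M X2) n1 n2"
  assumes "n1 \<noteq> 0" "n2 \<noteq> 0" "autocov M L n2 \<noteq> 0"
  shows "a_coef (autocov M L) n1 n2 \<gamma> * \<alpha>1\<^sup>2 + b_coef (autocov M L) n1 n2 \<gamma> * \<alpha>1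
    + a_coef (autocov M L) n1 n2 \<gamma> = 0"
proof -
  define r where "r = autocov M L n1 / autocov M L n2"
  \<comment> \<open>The left side is the autocovariance identity at \<open>n1\<close> minus
    \<open>r\<close> times the one at \<open>n2\<close>.\<close>
  have "a_coef (autocov M L) n1 n2 \<gamma> * \<alpha>1\<^sup>2 + b_coef (autocov M L) n1 n2 \<gamma> * \<alpha>1 + a_coef (autocov M L) n1 n2 \<gamma>
    = l1\<^sup>2 * autocov M L n1 - r * (l1\<^sup>2 * autocov M L n2)"
    unfolding autocov_quadratic[OF assms(2), symmetric] autocov_quadratic[OF assms(3), symmetric]
    by (simp add: a_coef_def b_coef_def \<gamma>_def gamma_vec_def r_def[symmetric] algebra_simps)
  also have "\<dots> = 0" using assms(4) by (simp add: r_def)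
  finally show ?thesis .
qed

text \<open>Each estimator is a fixed function of statistics that converge jointly, and is
  continuous at their limit; an estimator already treated becomes one of these statistics for the
  next.\<close>

lemma estimators_consistent:
  fixes n1 n2 :: int and sg :: real and d1 d2 d3 :: complex
  defines "s \<equiv> autocov M L" and "\<gamma> \<equiv> gamma_vec (autocov M X2) n1 n2"
  defines "A \<equiv> alpha1_hat s n1 n2 sg d1 X2"
  defines "B \<equiv> l1_hat s n1 n2 d2 A X2"
  defines "C \<equiv> alpha0_hat s n1 n2 d3 A B X2"
  assumes l1: "l1 > 0" and n2: "n2 \<noteq> 0" and s: "s n2 \<noteq> 0"
    and a: "a_coef s n1 n2 \<gamma> \<noteq> 0" and g: "g_coef s n1 n2 \<gamma> > 0"
    and sg: "correct_sign s n1 n2 \<gamma> \<alpha>1 sg"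
  shows "conv_in_prob M A (complex_of_real \<alpha>1)"
    and "conv_in_prob M B (complex_of_real l1)"
    and "conv_in_prob M C (complex_of_real \<alpha>0)"
proof -
  note [simp] = prob_space_axioms
  define V where "V N \<omega> = gamma_vec (sample_autocov X2 N \<omega>) n1 n2" for N \<omega>
  have V: "conv_in_prob M V \<gamma>"
    using sample_gamma_vec_consistent by (simp add: V_def[abs_def] \<gamma>_def)
  have [measurable]: "(\<lambda>\<omega>. a_coef s n1 n2 (V N \<omega>)) \<in> borel_measurable M"
    "(\<lambda>\<omega>. b_coef s n1 n2 (V N \<omega>)) \<in> borel_measurable M"
    "(\<lambda>\<omega>. g_coef s n1 n2 (V N \<omega>)) \<in> borel_measurable M" for N
    unfolding g_coef_def by (simp_all add: V_def gamma_vec_def a_coef_def b_coef_def)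
  define fA where "fA v = (if a_coef s n1 n2 v = 0 then d1
      else (- complex_of_real (b_coef s n1 n2 v) + complex_of_real sg * csqrt (complex_of_real (g_coef s n1 n2 v)))
           / (2 * complex_of_real (a_coef s n1 n2 v)))" for v
  have A_eq: "A N \<omega> = fA (V N \<omega>)" for N \<omega>
    by (simp add: A_def alpha1_hat_def fA_def V_def Let_def)
  have A_meas[measurable]: "A N \<in> borel_measurable M" for N
    unfolding A_eq[abs_def] fA_def by measurable
  \<comment> \<open>At the true values the radicand is a positive real, away from the branch
    cut.\<close>
  have "isCont (\<lambda>v. csqrt (complex_of_real (g_coef s n1 n2 v))) \<gamma>"
    by (rule isCont_csqrt', intro continuous_intros isCont_coefs) (use g in simp)
  then have "isCont fA \<gamma>"
    unfolding fA_def
    by (intro isCont_if_nonzero[OF isCont_coefs(1) a] continuous_intros isCont_coefs) (use a in simp_all)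
  then have "conv_in_prob M (\<lambda>N \<omega>. fA (V N \<omega>)) (fA \<gamma>)"
    by (rule conv_in_prob_isCont[OF V]) (use A_meas in \<open>simp_all add: A_eq[abs_def]\<close>)
  moreover have "fA \<gamma> = complex_of_real \<alpha>1"
  proof -
    have "\<alpha>1 = (- b_coef s n1 n2 \<gamma> + sg * sqrt (g_coef s n1 n2 \<gamma>)) / (2 * a_coef s n1 n2 \<gamma>)"
      using sg by (simp add: correct_sign_def)
    then show ?thesis using a g by (simp add: fA_def flip: of_real_sqrt)
  qed
  ultimately show conv_A: "conv_in_prob M A (complex_of_real \<alpha>1)" by (simp add: A_eq[abs_def])

  \<comment> \<open>The fourth component of \<open>gamma_vec\<close> belongs to lag
    \<open>n2\<close>, the second and the sixth to \<open>n2 + 1\<close> and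
    \<open>n2 - 1\<close>.\<close>
  define fB where "fB = (\<lambda>(v, x). if a_coef s n1 n2 v = 0 then d2
      else csqrt ((x\<^sup>2 * complex_of_real (fst (snd (snd (snd v))))
          - x * complex_of_real (fst (snd v) + snd (snd (snd (snd (snd v)))))
          + complex_of_real (fst (snd (snd (snd v))))) / complex_of_real (s n2)))"
  have B_eq: "B N \<omega> = fB (V N \<omega>, A N \<omega>)" for N \<omega>
    by (simp add: B_def l1_hat_def fB_def V_def Let_def gamma_vec_def)
  have B_meas[measurable]: "B N \<in> borel_measurable M" for N
  proof -
    have "B N \<omega> = (if a_coef s n1 n2 (V N \<omega>) = 0 then d2 else
        csqrt (((A N \<omega>)\<^sup>2 * complex_of_real (sample_autocov X2 N \<omega> n2)
          - A N \<omega> * complex_of_real (sample_autocov X2 N \<omega> (n2 + 1) + sample_autocov X2 N \<omega> (n2 - 1))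
          + complex_of_real (sample_autocov X2 N \<omega> n2)) / complex_of_real (s n2)))" for \<omega>
      by (simp add: B_def l1_hat_def V_def Let_def)
    then show ?thesis by (simp cong: measurable_cong)
  qed
  have argB: "((complex_of_real \<alpha>1)\<^sup>2 * complex_of_real (fst (snd (snd (snd \<gamma>))))
          - complex_of_real \<alpha>1 * complex_of_real (fst (snd \<gamma>) + snd (snd (snd (snd (snd \<gamma>)))))
          + complex_of_real (fst (snd (snd (snd \<gamma>))))) / complex_of_real (s n2) = complex_of_real (l1\<^sup>2)"
  proof -
    have "\<alpha>1\<^sup>2 * fst (snd (snd (snd \<gamma>))) - \<alpha>1 * (fst (snd \<gamma>) + snd (snd (snd (snd (snd \<gamma>)))))
        + fst (snd (snd (snd \<gamma>))) = l1\<^sup>2 * s n2"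
      using autocov_quadratic[OF n2] by (simp add: \<gamma>_def gamma_vec_def s_def)
    then have "(\<alpha>1\<^sup>2 * fst (snd (snd (snd \<gamma>))) - \<alpha>1 * (fst (snd \<gamma>) + snd (snd (snd (snd (snd \<gamma>)))))
        + fst (snd (snd (snd \<gamma>)))) / s n2 = l1\<^sup>2" using s by simp
    from arg_cong[OF this, of complex_of_real] show ?thesis by simp
  qed
  have "isCont fB (\<gamma>, complex_of_real \<alpha>1)"
  proof -
    have fB_alt: "fB = (\<lambda>y. if a_coef s n1 n2 (fst y) = 0 then d2
      else csqrt (((snd y)\<^sup>2 * complex_of_real (fst (snd (snd (snd (fst y)))))
          - snd y * complex_of_real (fst (snd (fst y)) + snd (snd (snd (snd (snd (fst y))))))
          + complex_of_real (fst (snd (snd (snd (fst y)))))) / complex_of_real (s n2)))"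
      by (simp add: fB_def split_beta')
    have "isCont (\<lambda>y. ((snd y)\<^sup>2 * complex_of_real (fst (snd (snd (snd (fst y)))))
          - snd y * complex_of_real (fst (snd (fst y)) + snd (snd (snd (snd (snd (fst y))))))
          + complex_of_real (fst (snd (snd (snd (fst y)))))) / complex_of_real (s n2)) (\<gamma>, complex_of_real \<alpha>1)"
      using s by (intro continuous_intros) auto
    \<comment> \<open>Positivity of \<open>l1\<close> keeps the radicand off the branch cut; further
      below it makes the principal root equal to \<open>l1\<close> and not to its negative.\<close>
    moreover have "complex_of_real (l1\<^sup>2) \<notin> \<real>\<^sub>\<le>\<^sub>0"
      unfolding nonpos_Reals_of_real_iff using l1 by simp
    ultimately have "isCont (\<lambda>y. csqrt (((snd y)\<^sup>2 * complex_of_real (fst (snd (snd (snd (fst y)))))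
          - snd y * complex_of_real (fst (snd (fst y)) + snd (snd (snd (snd (snd (fst y))))))
          + complex_of_real (fst (snd (snd (snd (fst y)))))) / complex_of_real (s n2))) (\<gamma>, complex_of_real \<alpha>1)"
      using argB by (intro isCont_csqrt') simp_all
    moreover have "isCont (\<lambda>y :: vec6 \<times> complex. a_coef s n1 n2 (fst y)) (\<gamma>, complex_of_real \<alpha>1)"
      by (rule isCont_o2[OF _ isCont_coefs(1)]) (intro continuous_intros)
    ultimately show ?thesis
      unfolding fB_alt using a by (intro isCont_if_nonzero) simp_all
  qed
  then have "conv_in_prob M (\<lambda>N \<omega>. fB (V N \<omega>, A N \<omega>)) (fB (\<gamma>, complex_of_real \<alpha>1))"
    by (rule conv_in_prob_isCont[OF conv_in_prob_Pair[OF V conv_A prob_space_axioms]])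
      (use B_meas in \<open>simp_all add: B_eq[abs_def]\<close>)
  moreover have "fB (\<gamma>, complex_of_real \<alpha>1) = complex_of_real l1"
  proof -
    have "fB (\<gamma>, complex_of_real \<alpha>1) = csqrt (complex_of_real (l1\<^sup>2))"
      using a argB by (simp add: fB_def)
    also have "\<dots> = complex_of_real (sqrt (l1\<^sup>2))" by (rule of_real_sqrt[symmetric]) simp
    finally show ?thesis using l1 by simp
  qed
  ultimately show conv_B: "conv_in_prob M B (complex_of_real l1)" by (simp add: B_eq[abs_def])

  define fC where "fC = (\<lambda>(v, m, x, y). if a_coef s n1 n2 v = 0 then d3 else complex_of_real m * (1 - x) - y)"
  have C_eq: "C N \<omega> = fC (V N \<omega>, sample_mean X2 N \<omega>, A N \<omega>, B N \<omega>)" for N \<omega>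
    by (simp add: C_def alpha0_hat_def fC_def V_def)
  have C_meas: "C N \<in> borel_measurable M" for N
    unfolding C_eq[abs_def] fC_def prod.case by measurable
  have "isCont fC (\<gamma>, mean_X2, complex_of_real \<alpha>1, complex_of_real l1)"
  proof -
    have fC_alt: "fC = (\<lambda>y. if a_coef s n1 n2 (fst y) = 0 then d3
        else complex_of_real (fst (snd y)) * (1 - fst (snd (snd y))) - snd (snd (snd y)))"
      by (simp add: fC_def split_beta')
    have "isCont (\<lambda>y :: vec6 \<times> real \<times> complex \<times> complex. a_coef s n1 n2 (fst y))
        (\<gamma>, mean_X2, complex_of_real \<alpha>1, complex_of_real l1)"
      by (rule isCont_o2[OF _ isCont_coefs(1)]) (intro continuous_intros)
    then show ?thesis
      unfolding fC_alt using a by (intro isCont_if_nonzero continuous_intros) simp_all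
  qed
  then have "conv_in_prob M (\<lambda>N \<omega>. fC (V N \<omega>, sample_mean X2 N \<omega>, A N \<omega>, B N \<omega>))
      (fC (\<gamma>, mean_X2, complex_of_real \<alpha>1, complex_of_real l1))"
    by (rule conv_in_prob_isCont[OF conv_in_prob_Pair[OF V conv_in_prob_Pair[OF sample_mean_consistent
          conv_in_prob_Pair[OF conv_A conv_B prob_space_axioms] prob_space_axioms] prob_space_axioms]])
      (use C_meas in \<open>simp_all add: C_eq[abs_def]\<close>)
  moreover have "fC (\<gamma>, mean_X2, complex_of_real \<alpha>1, complex_of_real l1) = complex_of_real \<alpha>0"
  proof -
    \<comment> \<open>The mean equation, solved for the constant term of the recursion.\<close>
    have "\<alpha>0 = mean_X2 * (1 - \<alpha>1) - l1" using mean_equation by (simp add: algebra_simps)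
    then show ?thesis using a by (simp add: fC_def)
  qed
  ultimately show "conv_in_prob M C (complex_of_real \<alpha>0)" by (simp add: C_eq[abs_def])
qed

end

text \<open>Existence and uniqueness of the sign are part of the conclusion, so the statement about
  every correct sign is not vacuous and concerns a single choice.\<close>

theorem theorem3p10:
  fixes M :: "'w measure"
    and \<epsilon> L X \<sigma> :: "int \<Rightarrow> 'w \<Rightarrow> real"
    and \<alpha>0 \<alpha>1 l1 :: real
    and n1 n2 :: int
    and d1 d2 d3 :: complex
  defines "X2 \<equiv> (\<lambda>t \<omega>. (X t \<omega>)\<^sup>2)"
    and "s \<equiv> autocov M L"
  defines "\<gamma> \<equiv> gamma_vec (autocov M X2) n1 n2"
  assumes "prob_space M"
    \<comment> \<open>innovations\<close>
    and "iid_process M \<epsilon>"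
    and "integrable M (\<epsilon> 0)" and "(\<integral>\<omega>. \<epsilon> 0 \<omega> \<partial>M) = 0"
    and "integrable M (\<lambda>\<omega>. (\<epsilon> 0 \<omega>)\<^sup>2)" and "(\<integral>\<omega>. (\<epsilon> 0 \<omega>)\<^sup>2 \<partial>M) = 1"
    \<comment> \<open>liquidity\<close>
    and "strictly_stationary M L"
    and "\<And>t. AE \<omega> in M. L t \<omega> > 0"
    and "integrable M (L 0)" and "(\<integral>\<omega>. L 0 \<omega> \<partial>M) = 1"
    and "indep_processes M L \<epsilon>"
    \<comment> \<open>the model and its stationary solution\<close>
    and "\<alpha>0 \<ge> 0" and "\<alpha>1 > 0" and "l1 > 0"
    and "\<And>t. X t \<in> borel_measurable M" and "\<And>t. \<sigma> t \<in> borel_measurable M"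
    and "\<And>t. AE \<omega> in M. X t \<omega> = \<sigma> t \<omega> * \<epsilon> t \<omega>"
    and "\<And>t. AE \<omega> in M. (\<sigma> t \<omega>)\<^sup>2 = \<alpha>0 + \<alpha>1 * (X (t - 1) \<omega>)\<^sup>2 + l1 * L (t - 1) \<omega>"
    and "\<And>t. AE \<omega> in M. (\<sigma> (t + 1) \<omega>)\<^sup>2 =
           (\<Sum>i. (\<Prod>j<i. \<alpha>1 * (\<epsilon> (t - int j) \<omega>)\<^sup>2) * (\<alpha>0 + l1 * L (t - int i) \<omega>))"
    \<comment> \<open>moment and mixing conditions\<close>
    and "integrable M (\<lambda>\<omega>. (L 0 \<omega>) ^ 4)"
    and "integrable M (\<lambda>\<omega>. (\<epsilon> 0 \<omega>) ^ 8)"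
    and "\<alpha>1 < 1 / (\<integral>\<omega>. (\<epsilon> 0 \<omega>) ^ 8 \<partial>M) powr (1 / 4)"
    and "((\<lambda>t. cov M (L 0) (L t)) \<longlongrightarrow> 0) at_top"
    and "\<And>m. ((\<lambda>t. cov M (\<lambda>\<omega>. L 0 \<omega> * L m \<omega>) (L t)) \<longlongrightarrow> 0) at_top"
    and "\<And>m. ((\<lambda>t. cov M (\<lambda>\<omega>. L 0 \<omega> * L m \<omega>) (L (- t))) \<longlongrightarrow> 0) at_top"
    and "\<And>m1 m2. ((\<lambda>t. cov M (\<lambda>\<omega>. L 0 \<omega> * L m1 \<omega>) (\<lambda>\<omega>. L t \<omega> * L (t + m2) \<omega>)) \<longlongrightarrow> 0) at_top"
    \<comment> \<open>identifiability conditions\<close>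
    and "n1 \<noteq> 0" and "n2 \<noteq> 0" and "n1 \<noteq> n2"
    and "s n2 \<noteq> 0" and "a_coef s n1 n2 \<gamma> \<noteq> 0" and "g_coef s n1 n2 \<gamma> > 0"
  shows "(\<exists>!sg. correct_sign s n1 n2 \<gamma> \<alpha>1 sg) \<and>
    (\<forall>sg. correct_sign s n1 n2 \<gamma> \<alpha>1 sg \<longrightarrow>
      (let A = alpha1_hat s n1 n2 sg d1 X2;
           B = l1_hat s n1 n2 d2 A X2;
           C = alpha0_hat s n1 n2 d3 A B X2
       in conv_in_prob M A (complex_of_real \<alpha>1) \<and>
          conv_in_prob M B (complex_of_real l1) \<and>
          conv_in_prob M C (complex_of_real \<alpha>0)))"
proof -
  interpret liquidity_arch M \<epsilon> L X \<sigma> \<alpha>0 \<alpha>1 l1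
    by (intro liquidity_arch.intro noise_liquidity.intro noise_liquidity_axioms.intro
        liquidity_arch_axioms.intro) (fact assms)+
  note hyps = \<open>s n2 \<noteq> 0\<close> \<open>a_coef s n1 n2 \<gamma> \<noteq> 0\<close> \<open>g_coef s n1 n2 \<gamma> > 0\<close>
  note hyps' = hyps[unfolded \<gamma>_def s_def X2_def]
  have "\<exists>!sg. correct_sign s n1 n2 \<gamma> \<alpha>1 sg"
    using correct_sign_unique[OF hyps'(2,3) quadratic_equation[OF \<open>n1 \<noteq> 0\<close> \<open>n2 \<noteq> 0\<close> hyps'(1)]]
    by (simp add: \<gamma>_def s_def X2_def)
  then show ?thesis
    using estimators_consistent[OF \<open>l1 > 0\<close> \<open>n2 \<noteq> 0\<close> hyps'] unfolding Let_def \<gamma>_def s_def X2_def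
    by blast
qed

end
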